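(* Let $l\in\mathbb C^\times$, $V=V(l,\mathbf 1)$, $\mu\in\mathbb C$, and let $\lambda=P(P-1)K$ for some $P\in\mathbb Z_+$. Then there does not exist any indecomposable $V$-module of class $\mathscr C$ whose composition series has length $n\ge2$ and whose composition factors are all isomorphic to $W(\lambda,[\mu])$.
   Context: Geometry: $M$ is a two-dimensional, connected, complete, orientable Riemannian manifold of constant sectional curvature $K\neq0$; $E=\mathbb C\otimes_{\mathbb R}TM$ with complex-linearly extended Levi-Civita connection $\nabla$, curvature $R(X,Y)Z=\nabla_X\nabla_YZ-\nabla_Y\nabla_XZ-\nabla_{[X,Y]}Z$, and complex-bilinearly extended metric $(\cdot,\cdot)$. Fix $p\in M$, an orthonormal basis $e_1,e_2$ of $T_pM$, and $h_\pm=e_1\mp\sqrt{-1}e_2\in E_p$; then $(h_\pm,h_\pm)=0$, $(h_+,h_-)=2$, $R(h_+,h_-)h_\pm=\pm2Kh_\pm$. $\Pi(T(E))$ is the algebra of parallel sections of $T(E)=\bigoplus_kE^{\otimes k}$, identified by evaluation at $p$ with the subalgebra of $T(E_p)$ spanned by the balanced words $h_{i_1}\otimes\cdots\otimes h_{i_k}$ (as many $+$ as $-$). $X\in\Pi(E^{\otimes k})$ acts on $C^\infty(U)$ by $g\mapsto(\nabla^kg)(X)$, with $(\nabla^kg)(Z_1,\dots,Z_k)=(\nabla_{Z_1}(\nabla^{k-1}g))(Z_2,\dots,Z_k)$. Covariant derivative condition: a $\Pi(T(E))$-module satisfies it if for every parallel tensor $\sum_aX_{(1)a}\otimes\cdots\otimes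 X_{(r)a}$ of degree $r\ge2$ the element $\sum_a(X_{(1)a}\otimes\cdots\otimes X_{(r-1)a}\otimes X_{(r)a}-X_{(1)a}\otimes\cdots\otimes X_{(r)a}\otimes X_{(r-1)a})$ acts by zero, and for each $j=1,\dots,r-2$ the element $$\sum_a(X_{(1)a}\otimes\cdots\otimes X_{(j)a}\otimes X_{(j+1)a}\otimes\cdots\otimes X_{(r)a}-X_{(1)a}\otimes\cdots\otimes X_{(j+1)a}\otimes X_{(j)a}\otimes\cdots\otimes X_{(r)a})+\sum_a\sum_{k=j+2}^rX_{(1)a}\otimes\cdots\otimes X_{(j-1)a}\otimes X_{(j+2)a}\otimes\cdots\otimes R(X_{(j)a},X_{(j+1)a})X_{(k)a}\otimes\cdots\otimes X_{(r)a}$$ acts by zero. Modes and $V$: for a left $T(E_p)$-module $S$ put $F(S)=T(\widehat E_{p,-})\otimes S$, $\widehat E_{p,-}=E_p\otimes t^{-1}\mathbb C[t^{-1}]$. For $a\in E_p$: $a(-m)$ ($m>0$) is left multiplication by $a\otimes t^{-m}$; $a(0)$ acts through $S$; $a(m)$ ($m>0$) kills $1\otimes S$ and $a(m)b(-n)=b(-n)a(m)+m(a,b)\delta_{m,n}l$. Put $a(x)=\sum_na(n)x^{-n-1}$; ${:}\ {:}$ places negative modes first, then positive, then zero modes, preserving relative order in each group. $V=V(l,\mathbf 1)$ has basis the balanced words $v=h_{i_1}(-m_1)\cdots h_{i_s}(-m_s)\mathbf 1$, $m_j\in\mathbb Z_+$, of weight $\sum m_j$; it acts on $F(S)$ by $Y(v,x)={:}\prod_{j=1}^s\frac1{(m_j-1)!}\frac{d^{m_j-1}}{dx^{m_j-1}}h_{i_j}(x){:}=\sum_nv_nx^{-n-1}$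 (product in the order $j=1,\dots,s$). For $S=\mathbb C\mathbf 1$ with $E_p$ acting by $0$ this gives the vertex operators $Y_V$ on $V\subset T(\widehat E_{p,-})$; $D_Vv=\lim_{x\to0}\frac d{dx}Y_V(v,x)\mathbf 1$ and $\mathbf d_V$ is the weight operator. A (left) $V$-module is a graded space $W=\coprod_{m\in\mathbb C}W_{[m]}$ with a linear map $Y_W:V\otimes W\to W[[x,x^{-1}]]$, $\mathbf d_W$ acting as $m$ on $W_{[m]}$, and an operator $D_W$ of weight $1$, such that: $W_{[m]}=0$ for $\mathrm{Re}\,m$ sufficiently negative; $[\mathbf d_W,Y_W(u,x)]=Y_W(\mathbf d_Vu,x)+x\frac d{dx}Y_W(u,x)$; $Y_W(\mathbf 1,x)=1_W$; $\frac d{dx}Y_W(u,x)=Y_W(D_Vu,x)=[D_W,Y_W(u,x)]$; and for all $v_1\in V,w\in W$ there is $q\in\mathbb N$ with $(x_0+x_2)^qY_W(v_1,x_0+x_2)Y_W(v_2,x_2)w=(x_0+x_2)^qY_W(Y_V(v_1,x_0)v_2,x_2)w$ for all $v_2\in V$. Submodules are graded subspaces stable under all coefficients of vertex operators; indecomposable means nonzero and not a direct sum of two nonzero submodules; isomorphisms are grading-preserving linear bijections intertwining the vertex operators. $W$ is a lowest weight $V$-module (of lowest weight $\mu$) if $W=\coprod_{n\in\mathbb N}W_{[\mu+n]}$ and $W$ is generated by $W_{[\mu]}$. The $\Pi(T(E))$-module structure on $W_{[\mu]}$ is by zero modes: for balanced $i_1,\dots,i_r$ and any $m_1,\dots,m_r\in\mathbb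 Z_+$, $w\in W_{[\mu]}$, the coefficient of $x^{-(m_1+\cdots+m_r)}$ in $Y_W(h_{i_1}(-m_1)\cdots h_{i_r}(-m_r)\mathbf 1,x)w$ is $\prod_j(-1)^{m_j-1}(h_{i_1}\otimes\cdots\otimes h_{i_r})w$; saying that $W_{[\mu]}$ is a $\Pi(T(E))$-module is meant in this sense. $W(\lambda,[\mu])$: for a nonzero eigenfunction $f:U\to\mathbb C$, $-\Delta f=\lambda f$, on an open $U\subseteq M$, let $V_U(l,f)[\mu]$ be the span of all $v_nf$ inside $F(T(E_p)\otimes_{\Pi(T(E))}C^\infty(U))$, $f$ standing for $1\otimes(1\otimes f)$, graded by $\mathrm{wt}\,f=\mu$ with each $h_\pm(-t)$ ($t>0$) adding $t$ and $h_\pm(0)$ adding $0$. It has a unique maximal proper submodule; $W(\lambda,[\mu])$ is the quotient by it (up to isomorphism it depends only on $\lambda,\mu$). Class $\mathscr C$: a $V$-module $W$ is of class $\mathscr C$ if (1) it is a lowest weight module whose lowest weight subspace, as a $\Pi(T(E))$-module, satisfies the covariant derivative condition; and (2) it has a finite composition series $W=W_1\supseteq\cdots\supseteq W_n\supseteq W_{n+1}=0$ with $W_i/W_{i+1}\cong W(\lambda_i,[\mu])$ for some $\lambda_i\in\mathbb C$ and some $\mu\in\mathbb C$ (the same for all $i$); $n$ is its length. *)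

theory Defs
  imports
    "HOL-Analysis.Analysis"
    "HOL-Library.Poly_Mapping"
    "HOL-Library.Function_Algebras"
begin

section \<open>Riemannian surfaces in coordinates\<close>

definition pd :: "2 \<Rightarrow> (real^2 \<Rightarrow> 'b::real_normed_vector) \<Rightarrow> real^2 \<Rightarrow> 'b" where
  "pd a f x = frechet_derivative f (at x) (axis a 1)"

text \<open>Smoothness on an open set: all iterated partial derivatives are differentiable there.\<close>

definition smooth_on :: "(real^2) set \<Rightarrow> (real^2 \<Rightarrow> 'b::real_normed_vector) \<Rightarrow> bool" where
  "smooth_on A f \<longleftrightarrow> (\<forall>as. \<forall>x\<in>A. foldr pd as f differentiable (at x))"

text \<open>A chart is a coordinate domain together with a coordinate map, which is only relevant on
  that domain.\<close>

type_synonym 'm chart = "'m set \<times> ('m \<Rightarrow> real^2)"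

definition chart_inv :: "'m chart \<Rightarrow> real^2 \<Rightarrow> 'm" where
  "chart_inv c = inv_into (fst c) (snd c)"

definition transition :: "'m chart \<Rightarrow> 'm chart \<Rightarrow> real^2 \<Rightarrow> real^2" where
  "transition c d = snd d \<circ> chart_inv c"

definition jacobian :: "(real^2 \<Rightarrow> real^2) \<Rightarrow> real^2 \<Rightarrow> real^2^2" where
  "jacobian \<tau> x = (\<chi> i j. pd j (\<lambda>y. \<tau> y $ i) x)"

text \<open>\<open>metric S c x\<close> is the Gram matrix of the metric in the coordinate frame of the chart \<open>c\<close> at
  the coordinate value \<open>x\<close>.\<close>

record 'm surface =
  charts :: "'m chart set"
  metric :: "'m chart \<Rightarrow> real^2 \<Rightarrow> real^2^2"

definition smooth_atlas :: "'m::topological_space chart set \<Rightarrow> bool" where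
  "smooth_atlas \<A> \<longleftrightarrow>
     (\<Union>c\<in>\<A>. fst c) = UNIV \<and>
     (\<forall>c\<in>\<A>. open (fst c) \<and> open (snd c ` fst c) \<and>
        homeomorphism (fst c) (snd c ` fst c) (snd c) (chart_inv c)) \<and>
     (\<forall>c\<in>\<A>. \<forall>d\<in>\<A>. smooth_on (snd c ` (fst c \<inter> fst d)) (transition c d))"

definition riemannian_surface :: "('m::topological_space, 'z) surface_scheme \<Rightarrow> bool" where
  "riemannian_surface S \<longleftrightarrow>
     smooth_atlas (charts S) \<and>
     (\<forall>c\<in>charts S.
        (\<forall>a b. smooth_on (snd c ` fst c) (\<lambda>x. metric S c x $ a $ b)) \<and>
        (\<forall>x\<in>snd c ` fst c. transpose (metric S c x) = metric S c x \<and>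
           (\<forall>v. v \<noteq> 0 \<longrightarrow> v \<bullet> (metric S c x *v v) > 0))) \<and>
     (\<forall>c\<in>charts S. \<forall>d\<in>charts S. \<forall>x\<in>snd c ` (fst c \<inter> fst d).
        let J = jacobian (transition c d) x
        in metric S c x = transpose J ** metric S d (transition c d x) ** J)"

text \<open>\<open>christoffel g k i j\<close> is \<open>\<Gamma>\<^sup>k\<^sub>i\<^sub>j\<close>, the \<open>k\<close>-th component of the Levi-Civita derivative of the
  \<open>j\<close>-th coordinate field along the \<open>i\<close>-th one.\<close>

definition christoffel :: "(real^2 \<Rightarrow> real^2^2) \<Rightarrow> 2 \<Rightarrow> 2 \<Rightarrow> 2 \<Rightarrow> real^2 \<Rightarrow> real" where
  "christoffel g k i j x = (1/2) * (\<Sum>m\<in>UNIV. matrix_inv (g x) $ k $ m *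
     (pd i (\<lambda>y. g y $ j $ m) x + pd j (\<lambda>y. g y $ i $ m) x - pd m (\<lambda>y. g y $ i $ j) x))"

text \<open>\<open>riemann g k m i j\<close> is the \<open>k\<close>-th component of \<open>R(\<partial>\<^sub>i, \<partial>\<^sub>j)\<partial>\<^sub>m\<close>, where
  \<open>R(X,Y) = \<nabla>\<^sub>X\<nabla>\<^sub>Y - \<nabla>\<^sub>Y\<nabla>\<^sub>X - \<nabla>\<^bsub>[X,Y]\<^esub>\<close>.\<close>

definition riemann :: "(real^2 \<Rightarrow> real^2^2) \<Rightarrow> 2 \<Rightarrow> 2 \<Rightarrow> 2 \<Rightarrow> 2 \<Rightarrow> real^2 \<Rightarrow> real" where
  "riemann g k m i j x =
     pd i (christoffel g k j m) x - pd j (christoffel g k i m) x +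
     (\<Sum>n\<in>UNIV. christoffel g n j m x * christoffel g k i n x
            - christoffel g n i m x * christoffel g k j n x)"

text \<open>\<open>(R(\<partial>\<^sub>1,\<partial>\<^sub>2)\<partial>\<^sub>2, \<partial>\<^sub>1) / (|\<partial>\<^sub>1|\<^sup>2 |\<partial>\<^sub>2|\<^sup>2 - (\<partial>\<^sub>1,\<partial>\<^sub>2)\<^sup>2)\<close>; a surface has just one tangent plane at each
  point.\<close>

definition sectional_curvature :: "(real^2 \<Rightarrow> real^2^2) \<Rightarrow> real^2 \<Rightarrow> real" where
  "sectional_curvature g x = (\<Sum>k\<in>UNIV. riemann g k 2 1 2 x * g x $ k $ 1) / det (g x)"

text \<open>A continuous choice of orientation of all tangent spaces: \<open>\<sigma> c q\<close> says whether the coordinate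
  frame of \<open>c\<close> at \<open>q\<close> is positively oriented.\<close>

definition orientable :: "('m::topological_space, 'z) surface_scheme \<Rightarrow> bool" where
  "orientable S \<longleftrightarrow> (\<exists>\<sigma> :: 'm chart \<Rightarrow> 'm \<Rightarrow> real.
     (\<forall>c\<in>charts S. continuous_on (fst c) (\<sigma> c) \<and> (\<forall>q\<in>fst c. \<sigma> c q \<in> {1, -1})) \<and>
     (\<forall>c\<in>charts S. \<forall>d\<in>charts S. \<forall>q\<in>fst c \<inter> fst d.
        \<sigma> c q = sgn (det (jacobian (transition c d) (snd c q))) * \<sigma> d q))"

definition geodesic :: "('m::topological_space, 'z) surface_scheme \<Rightarrow> (real \<Rightarrow> 'm) \<Rightarrow> bool" where
  "geodesic S \<gamma> \<longleftrightarrow> continuous_on UNIV \<gamma> \<and>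
     (\<forall>t. \<forall>c\<in>charts S. \<gamma> t \<in> fst c \<longrightarrow>
        (let x = (\<lambda>s. snd c (\<gamma> s)) in
         \<exists>v. (\<forall>\<^sub>F s in nhds t. (x has_vector_derivative v s) (at s)) \<and>
           (v has_vector_derivative
              (\<chi> k. - (\<Sum>i\<in>UNIV. \<Sum>j\<in>UNIV.
                 christoffel (metric S c) k i j (x t) * v t $ i * v t $ j))) (at t)))"

definition geodesically_complete :: "('m::topological_space, 'z) surface_scheme \<Rightarrow> bool" where
  "geodesically_complete S \<longleftrightarrow>
     (\<forall>c\<in>charts S. \<forall>q\<in>fst c. \<forall>u. \<exists>\<gamma>. geodesic S \<gamma> \<and> \<gamma> 0 = q \<and>
        ((\<lambda>s. snd c (\<gamma> s)) has_vector_derivative u) (at 0))"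

definition space_form ::
  "('m::{t2_space,second_countable_topology}, 'z) surface_scheme \<Rightarrow> real \<Rightarrow> bool" where
  "space_form S K \<longleftrightarrow>
     riemannian_surface S \<and> connected (UNIV :: 'm set) \<and> orientable S \<and>
     geodesically_complete S \<and>
     (\<forall>c\<in>charts S. \<forall>x\<in>snd c ` fst c. sectional_curvature (metric S c) x = K)"

text \<open>A base point with an orthonormal basis of its tangent space, in the components of a chart.\<close>

record 'm framed_surface = "'m surface" +
  basept :: 'm
  basechart :: "'m chart"
  frame1 :: "real^2"
  frame2 :: "real^2"

definition orthonormal_frame :: "('m, 'z) framed_surface_scheme \<Rightarrow> bool" where
  "orthonormal_frame S \<longleftrightarrow>
     basechart S \<in> charts S \<and> basept S \<in> fst (basechart S) \<and>
     (let g = metric S (basechart S) (snd (basechart S) (basept S)) in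
        frame1 S \<bullet> (g *v frame1 S) = 1 \<and> frame2 S \<bullet> (g *v frame2 S) = 1 \<and>
        frame1 S \<bullet> (g *v frame2 S) = 0)"

text \<open>The vectors \<open>h\<^sub>+ = e\<^sub>1 - \<i> e\<^sub>2\<close> (index \<^const>\<open>True\<close>) and \<open>h\<^sub>- = e\<^sub>1 + \<i> e\<^sub>2\<close> (index \<^const>\<open>False\<close>).\<close>

definition hvec :: "('m, 'z) framed_surface_scheme \<Rightarrow> bool \<Rightarrow> complex^2" where
  "hvec S i = (\<chi> a. complex_of_real (frame1 S $ a)
                 - (if i then 1 else -1) * \<i> * complex_of_real (frame2 S $ a))"


section \<open>Functions, covariant derivatives and parallel tensors\<close>

text \<open>Elements of \<open>C\<^sup>\<infinity>(U)\<close> are extended by zero outside \<open>U\<close>.\<close>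

definition Cinf :: "('m, 'z) surface_scheme \<Rightarrow> 'm set \<Rightarrow> ('m \<Rightarrow> complex) set" where
  "Cinf S U = {f. (\<forall>q. q \<notin> U \<longrightarrow> f q = 0) \<and>
     (\<forall>c\<in>charts S. smooth_on (snd c ` (fst c \<inter> U)) (f \<circ> chart_inv c))}"

text \<open>Covariant tensors are given by their components in a chart. The direction of differentiation
  becomes the first argument:
  \<open>(\<nabla>T)(Z\<^sub>1,\<dots>,Z\<^sub>k) = (\<nabla>\<^bsub>Z\<^sub>1\<^esub>T)(Z\<^sub>2,\<dots>,Z\<^sub>k)\<close>.\<close>

definition cov_deriv ::
  "(real^2 \<Rightarrow> real^2^2) \<Rightarrow> (2 list \<Rightarrow> real^2 \<Rightarrow> complex) \<Rightarrow> 2 list \<Rightarrow> real^2 \<Rightarrow> complex" where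
  "cov_deriv g T as x = (case as of [] \<Rightarrow> 0 | a # bs \<Rightarrow>
     pd a (T bs) x - (\<Sum>j<length bs. \<Sum>b\<in>UNIV.
        complex_of_real (christoffel g b a (bs ! j) x) * T (bs[j := b]) x))"

definition nabla ::
  "('m, 'z) surface_scheme \<Rightarrow> 'm chart \<Rightarrow> nat \<Rightarrow> ('m \<Rightarrow> complex) \<Rightarrow> 2 list \<Rightarrow> real^2 \<Rightarrow> complex" where
  "nabla S c k f = (cov_deriv (metric S c) ^^ k) (\<lambda>as. f \<circ> chart_inv c)"

definition laplacian ::
  "('m, 'z) surface_scheme \<Rightarrow> 'm chart \<Rightarrow> ('m \<Rightarrow> complex) \<Rightarrow> real^2 \<Rightarrow> complex" where
  "laplacian S c f x = (\<Sum>a\<in>UNIV. \<Sum>b\<in>UNIV.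
     complex_of_real (matrix_inv (metric S c x) $ a $ b) * nabla S c 2 f [a, b] x)"

definition eigenfunction ::
  "('m, 'z) surface_scheme \<Rightarrow> 'm set \<Rightarrow> complex \<Rightarrow> ('m \<Rightarrow> complex) \<Rightarrow> bool" where
  "eigenfunction S U lam f \<longleftrightarrow> f \<in> Cinf S U \<and>
     (\<forall>c\<in>charts S. \<forall>q\<in>fst c \<inter> U. - laplacian S c f (snd c q) = lam * f q)"

text \<open>A section \<open>X\<close> of \<open>E\<^bsup>\<otimes>k\<^esup>\<close> is given by its contravariant components in each chart; the last
  condition below says \<open>\<nabla>X = 0\<close>.\<close>

definition parallel_section ::
  "('m, 'z) surface_scheme \<Rightarrow> nat \<Rightarrow> ('m chart \<Rightarrow> 2 list \<Rightarrow> real^2 \<Rightarrow> complex) \<Rightarrow> bool" where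
  "parallel_section S k X \<longleftrightarrow>
     (\<forall>c\<in>charts S. \<forall>as. length as = k \<longrightarrow> smooth_on (snd c ` fst c) (X c as)) \<and>
     (\<forall>c\<in>charts S. \<forall>d\<in>charts S. \<forall>q\<in>fst c \<inter> fst d. \<forall>bs. length bs = k \<longrightarrow>
        X d bs (snd d q) = (\<Sum>as\<in>{as. length as = k}.
          (\<Prod>j<k. complex_of_real (jacobian (transition c d) (snd c q) $ (bs ! j) $ (as ! j)))
            * X c as (snd c q))) \<and>
     (\<forall>c\<in>charts S. \<forall>x\<in>snd c ` fst c. \<forall>a as. length as = k \<longrightarrow>
        pd a (X c as) x + (\<Sum>j<k. \<Sum>b\<in>UNIV.
          complex_of_real (christoffel (metric S c) (as ! j) a b x) * X c (as[j := b]) x) = 0)"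

text \<open>The action \<open>g \<mapsto> (\<nabla>\<^sup>kg)(X)\<close> on \<open>C\<^sup>\<infinity>(U)\<close>, evaluated at each point in some chart around it.\<close>

definition par_act ::
  "('m, 'z) surface_scheme \<Rightarrow> 'm set \<Rightarrow> nat \<Rightarrow> ('m chart \<Rightarrow> 2 list \<Rightarrow> real^2 \<Rightarrow> complex)
     \<Rightarrow> ('m \<Rightarrow> complex) \<Rightarrow> 'm \<Rightarrow> complex" where
  "par_act S U k X g q = (if q \<in> U then
     (let c = (SOME c. c \<in> charts S \<and> q \<in> fst c) in
        \<Sum>as\<in>{as. length as = k}. nabla S c k g as (snd c q) * X c as (snd c q)) else 0)"


section \<open>Fock spaces and vertex operators\<close>

text \<open>\<open>A \<Rightarrow>\<^sub>0 S\<close> models \<open>\<complex>A \<otimes> S\<close>. Here \<open>lin_ext\<close> extends a map given on \<open>k \<otimes> s\<close> additively.\<close>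

definition lin_ext :: "('k \<Rightarrow> 's::zero \<Rightarrow> 't::comm_monoid_add) \<Rightarrow> ('k \<Rightarrow>\<^sub>0 's) \<Rightarrow> 't" where
  "lin_ext \<phi> x = (\<Sum>k\<in>Poly_Mapping.keys x. \<phi> k (Poly_Mapping.lookup x k))"

abbreviation pm_scale :: "('c \<Rightarrow> 's \<Rightarrow> 's::zero) \<Rightarrow> 'c \<Rightarrow> ('k \<Rightarrow>\<^sub>0 's) \<Rightarrow> 'k \<Rightarrow>\<^sub>0 's" where
  "pm_scale sc c \<equiv> Poly_Mapping.map (sc c)"

text \<open>The word \<open>[(i\<^sub>1,m\<^sub>1),\<dots>,(i\<^sub>s,m\<^sub>s)]\<close> stands for \<open>h\<^bsub>i\<^sub>1\<^esub>(-m\<^sub>1) \<dots> h\<^bsub>i\<^sub>s\<^esub>(-m\<^sub>s)\<close>; only words with all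
  \<open>m\<^sub>j \<ge> 1\<close> represent elements of \<open>T(E\<^sub>p \<otimes> t\<^sup>-\<^sup>1\<complex>[t\<^sup>-\<^sup>1])\<close>.\<close>

type_synonym fword = "(bool \<times> nat) list"

definition proper_word :: "fword \<Rightarrow> bool" where
  "proper_word w \<longleftrightarrow> (\<forall>(i, m)\<in>set w. m \<ge> 1)"

definition wt :: "fword \<Rightarrow> nat" where
  "wt w = sum_list (map snd w)"

definition balanced :: "bool list \<Rightarrow> bool" where
  "balanced is \<longleftrightarrow> count_list is True = count_list is False"

text \<open>\<open>(h\<^sub>i, h\<^sub>j)\<close>\<close>

definition hpair :: "bool \<Rightarrow> bool \<Rightarrow> complex" where
  "hpair i j = (if i = j then 0 else 2)"

text \<open>In the next definitions \<open>sc\<close> is the scalar multiplication of \<open>S\<close> and \<open>e i\<close> the action of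
  \<open>h\<^sub>i\<close> on \<open>S\<close>.\<close>

definition create :: "bool \<times> nat \<Rightarrow> (fword \<Rightarrow>\<^sub>0 's::comm_monoid_add) \<Rightarrow> fword \<Rightarrow>\<^sub>0 's" where
  "create a = lin_ext (\<lambda>w s. Poly_Mapping.single (a # w) s)"

fun annihilate_word ::
  "(complex \<Rightarrow> 's \<Rightarrow> 's) \<Rightarrow> complex \<Rightarrow> bool \<Rightarrow> nat \<Rightarrow> fword \<Rightarrow> 's::comm_monoid_add
     \<Rightarrow> fword \<Rightarrow>\<^sub>0 's" where
  "annihilate_word sc l i m [] s = 0"
| "annihilate_word sc l i m ((j, n) # w) s =
     create (j, n) (annihilate_word sc l i m w s) +
     (if m = n then Poly_Mapping.single w (sc (of_nat m * hpair i j * l) s) else 0)"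

text \<open>The operator \<open>h\<^sub>i(n)\<close> on \<open>F(S)\<close>.\<close>

definition mode ::
  "(complex \<Rightarrow> 's \<Rightarrow> 's) \<Rightarrow> (bool \<Rightarrow> 's \<Rightarrow> 's) \<Rightarrow> complex \<Rightarrow> bool \<times> int
     \<Rightarrow> (fword \<Rightarrow>\<^sub>0 's::comm_monoid_add) \<Rightarrow> fword \<Rightarrow>\<^sub>0 's" where
  "mode sc e l = (\<lambda>(i, n).
     if n < 0 then create (i, nat (- n))
     else if n = 0 then lin_ext (\<lambda>w s. Poly_Mapping.single w (e i s))
     else lin_ext (annihilate_word sc l i (nat n)))"

definition normal_order :: "(bool \<times> int) list \<Rightarrow> (bool \<times> int) list" where
  "normal_order xs = filter (\<lambda>(i, n). n < 0) xs @ filter (\<lambda>(i, n). n > 0) xs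
                       @ filter (\<lambda>(i, n). n = 0) xs"

text \<open>Since \<open>1/(m-1)! d\<^bsup>m-1\<^esup>/dx\<^bsup>m-1\<^esup> \<Sum>\<^sub>n h(n) x\<^bsup>-n-1\<^esup> = \<Sum>\<^sub>n (-n-1 choose m-1) h(n) x\<^bsup>-n-m\<^esup>\<close>, the
  coefficient of \<open>x\<^bsup>-k-1\<^esup>\<close> in \<open>Y(v,x)\<close>, for a word \<open>v\<close>, is the following sum over the tuples
  \<open>ns\<close> of mode numbers; only finitely many of them contribute on a given vector.\<close>

definition word_mode ::
  "(complex \<Rightarrow> 's \<Rightarrow> 's) \<Rightarrow> (bool \<Rightarrow> 's \<Rightarrow> 's) \<Rightarrow> complex \<Rightarrow> fword \<Rightarrow> int
     \<Rightarrow> (fword \<Rightarrow>\<^sub>0 's::comm_monoid_add) \<Rightarrow> fword \<Rightarrow>\<^sub>0 's" where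
  "word_mode sc e l v k x = Sum_any (\<lambda>ns :: int list.
     if length ns = length v \<and> sum_list ns + int (wt v) = k + 1
     then pm_scale sc (\<Prod>j<length v. (of_int (- (ns ! j) - 1) :: complex) gchoose (snd (v ! j) - 1))
            (foldr (mode sc e l) (normal_order (zip (map fst v) ns)) x)
     else 0)"

definition fock_vop ::
  "(complex \<Rightarrow> 's \<Rightarrow> 's) \<Rightarrow> (bool \<Rightarrow> 's \<Rightarrow> 's) \<Rightarrow> complex \<Rightarrow> (fword \<Rightarrow>\<^sub>0 complex) \<Rightarrow> int
     \<Rightarrow> (fword \<Rightarrow>\<^sub>0 's::comm_monoid_add) \<Rightarrow> fword \<Rightarrow>\<^sub>0 's" where
  "fock_vop sc e l v k x = lin_ext (\<lambda>w c. pm_scale sc c (word_mode sc e l w k x)) v"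

text \<open>The underlying space of \<open>V(l,\<one>)\<close>, its vacuum, its weight operator, its vertex operators, and
  \<open>D\<^sub>V v\<close>, which is the coefficient of \<open>x\<close> in the power series \<open>Y\<^sub>V(v,x)\<one>\<close>.\<close>

definition Vsp :: "(fword \<Rightarrow>\<^sub>0 complex) set" where
  "Vsp = {v. \<forall>w\<in>Poly_Mapping.keys v. proper_word w \<and> balanced (map fst w)}"

definition vac :: "fword \<Rightarrow>\<^sub>0 complex" where
  "vac = Poly_Mapping.single [] 1"

definition dV :: "(fword \<Rightarrow>\<^sub>0 complex) \<Rightarrow> fword \<Rightarrow>\<^sub>0 complex" where
  "dV = lin_ext (\<lambda>w c. Poly_Mapping.single w (of_nat (wt w) * c))"

definition YV ::
  "complex \<Rightarrow> (fword \<Rightarrow>\<^sub>0 complex) \<Rightarrow> int \<Rightarrow> (fword \<Rightarrow>\<^sub>0 complex) \<Rightarrow> fword \<Rightarrow>\<^sub>0 complex" where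
  "YV = fock_vop (*) (\<lambda>i s. 0)"

definition DV :: "complex \<Rightarrow> (fword \<Rightarrow>\<^sub>0 complex) \<Rightarrow> fword \<Rightarrow>\<^sub>0 complex" where
  "DV l v = YV l v (-2) vac"


section \<open>Modules for \<open>V(l,\<one>)\<close>\<close>

text \<open>A module is a type \<open>'w\<close> with a scalar multiplication \<open>scl\<close>, a family \<open>gr m\<close> of homogeneous
  subspaces and the coefficients \<open>Y v n\<close> of \<open>x\<^bsup>-n-1\<^esup>\<close> in \<open>Y\<^sub>W(v,x)\<close>, meaningful for \<open>v \<in> Vsp\<close>.\<close>

type_synonym 'w vops = "(fword \<Rightarrow>\<^sub>0 complex) \<Rightarrow> int \<Rightarrow> 'w \<Rightarrow> 'w"

definition graded_space ::
  "(complex \<Rightarrow> 'w \<Rightarrow> 'w::ab_group_add) \<Rightarrow> (complex \<Rightarrow> 'w set) \<Rightarrow> bool" where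
  "graded_space scl gr \<longleftrightarrow> vector_space scl \<and>
     (\<forall>m. module.subspace scl (gr m)) \<and>
     module.span scl (\<Union>m. gr m) = UNIV \<and>
     (\<forall>M u. finite M \<and> (\<forall>m\<in>M. u m \<in> gr m) \<and> (\<Sum>m\<in>M. u m) = 0 \<longrightarrow> (\<forall>m\<in>M. u m = 0))"

text \<open>Weak associativity is the comparison of the coefficients of \<open>x\<^sub>0\<^sup>a x\<^sub>2\<^sup>b\<close>. On the left,
  \<open>(x\<^sub>0+x\<^sub>2)\<^sup>q Y\<^sub>W(v\<^sub>1,x\<^sub>0+x\<^sub>2) = \<Sum>\<^sub>n (v\<^sub>1)\<^sub>n (x\<^sub>0+x\<^sub>2)\<^bsup>q-n-1\<^esup>\<close> is expanded in nonnegative powers of \<open>x\<^sub>2\<close>, and the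
  \<open>k\<close>-th term, with \<open>n = q-1-k-a\<close>, has the coefficient \<open>(q-n-1 choose k) = (a+k choose k)\<close>; only
  finitely many \<open>k\<close> contribute on a given vector.\<close>

definition weakly_associative ::
  "complex \<Rightarrow> (complex \<Rightarrow> 'w \<Rightarrow> 'w::ab_group_add) \<Rightarrow> 'w vops \<Rightarrow> bool" where
  "weakly_associative l scl Y \<longleftrightarrow>
     (\<forall>v1\<in>Vsp. \<forall>w. \<exists>q::nat. \<forall>v2\<in>Vsp. \<forall>a b :: int.
        Sum_any (\<lambda>k::nat. scl (of_int (a + int k) gchoose k)
                  (Y v1 (int q - 1 - int k - a) (Y v2 (int k - 1 - b) w))) =
        (\<Sum>j\<le>q. scl (of_nat (q choose j))
                  (Y (YV l v1 (int j - 1 - a) v2) (int q - int j - 1 - b) w)))"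

definition V_module ::
  "complex \<Rightarrow> (complex \<Rightarrow> 'w \<Rightarrow> 'w::ab_group_add) \<Rightarrow> (complex \<Rightarrow> 'w set) \<Rightarrow> 'w vops
     \<Rightarrow> ('w \<Rightarrow> 'w) \<Rightarrow> ('w \<Rightarrow> 'w) \<Rightarrow> bool" where
  "V_module l scl gr Y d D \<longleftrightarrow>
     graded_space scl gr \<and>
     (\<forall>u\<in>Vsp. \<forall>n. Vector_Spaces.linear scl scl (Y u n)) \<and>
     (\<forall>u\<in>Vsp. \<forall>v\<in>Vsp. \<forall>n w. Y (u + v) n w = Y u n w + Y v n w) \<and>
     (\<forall>u\<in>Vsp. \<forall>c n w. Y (pm_scale (*) c u) n w = scl c (Y u n w)) \<and>
     Vector_Spaces.linear scl scl d \<and> (\<forall>m. \<forall>w\<in>gr m. d w = scl m w) \<and>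
     Vector_Spaces.linear scl scl D \<and> (\<forall>m. \<forall>w\<in>gr m. D w \<in> gr (m + 1)) \<and>
     (\<exists>N::real. \<forall>m. Re m < N \<longrightarrow> gr m = {0}) \<and>
     (\<forall>u\<in>Vsp. \<forall>n w. d (Y u n w) - Y u n (d w) = Y (dV u) n w + scl (of_int (- n - 1)) (Y u n w)) \<and>
     (\<forall>n w. Y vac n w = (if n = -1 then w else 0)) \<and>
     (\<forall>u\<in>Vsp. \<forall>n w. scl (of_int (- n)) (Y u (n - 1) w) = Y (DV l u) n w) \<and>
     (\<forall>u\<in>Vsp. \<forall>n w. Y (DV l u) n w = D (Y u n w) - Y u n (D w)) \<and>
     weakly_associative l scl Y"

definition submodule ::
  "(complex \<Rightarrow> 'w \<Rightarrow> 'w::ab_group_add) \<Rightarrow> (complex \<Rightarrow> 'w set) \<Rightarrow> 'w vops \<Rightarrow> 'w set \<Rightarrow> bool" where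
  "submodule scl gr Y B \<longleftrightarrow> module.subspace scl B \<and>
     B \<subseteq> module.span scl (\<Union>m. B \<inter> gr m) \<and>
     (\<forall>v\<in>Vsp. \<forall>n. \<forall>x\<in>B. Y v n x \<in> B)"

definition indecomposable ::
  "(complex \<Rightarrow> 'w \<Rightarrow> 'w::ab_group_add) \<Rightarrow> (complex \<Rightarrow> 'w set) \<Rightarrow> 'w vops \<Rightarrow> bool" where
  "indecomposable scl gr Y \<longleftrightarrow> (UNIV :: 'w set) \<noteq> {0} \<and>
     \<not> (\<exists>A B. submodule scl gr Y A \<and> submodule scl gr Y B \<and> A \<noteq> {0} \<and> B \<noteq> {0} \<and>
          A \<inter> B = {0} \<and> {a + b | a b. a \<in> A \<and> b \<in> B} = UNIV)"

text \<open>\<open>A/B \<cong> A'/B'\<close> for submodules \<open>B \<subseteq> A\<close> of one module and \<open>B' \<subseteq> A'\<close> of another one: the map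
  \<open>x + B \<mapsto> \<phi> x + B'\<close> is well defined and an isomorphism.\<close>

definition subquotient_iso ::
  "(complex \<Rightarrow> 'w \<Rightarrow> 'w::ab_group_add) \<Rightarrow> (complex \<Rightarrow> 'w set) \<Rightarrow> 'w vops \<Rightarrow> 'w set \<Rightarrow> 'w set \<Rightarrow>
   (complex \<Rightarrow> 'u \<Rightarrow> 'u::ab_group_add) \<Rightarrow> (complex \<Rightarrow> 'u set) \<Rightarrow> 'u vops \<Rightarrow> 'u set \<Rightarrow> 'u set \<Rightarrow> bool"
  where
  "subquotient_iso scl gr Y A B scl' gr' Y' A' B' \<longleftrightarrow> (\<exists>\<phi>.
     (\<forall>x\<in>A. \<phi> x \<in> A') \<and>
     (\<forall>x\<in>A. \<forall>y\<in>A. \<phi> (x + y) - (\<phi> x + \<phi> y) \<in> B') \<and>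
     (\<forall>x\<in>A. \<forall>c. \<phi> (scl c x) - scl' c (\<phi> x) \<in> B') \<and>
     (\<forall>x\<in>A. \<phi> x \<in> B' \<longleftrightarrow> x \<in> B) \<and>
     (\<forall>y\<in>A'. \<exists>x\<in>A. y - \<phi> x \<in> B') \<and>
     (\<forall>m. \<forall>x\<in>A \<inter> gr m. \<exists>y\<in>A' \<inter> gr' m. \<phi> x - y \<in> B') \<and>
     (\<forall>v\<in>Vsp. \<forall>n. \<forall>x\<in>A. \<phi> (Y v n x) - Y' v n (\<phi> x) \<in> B'))"

definition lowest_weight_module ::
  "(complex \<Rightarrow> 'w \<Rightarrow> 'w::ab_group_add) \<Rightarrow> (complex \<Rightarrow> 'w set) \<Rightarrow> 'w vops \<Rightarrow> complex \<Rightarrow> bool" where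
  "lowest_weight_module scl gr Y \<mu> \<longleftrightarrow>
     (\<forall>m. (\<forall>n::nat. m \<noteq> \<mu> + of_nat n) \<longrightarrow> gr m = {0}) \<and>
     (\<forall>B. submodule scl gr Y B \<and> gr \<mu> \<subseteq> B \<longrightarrow> B = UNIV)"


section \<open>Modules for the algebra of parallel tensors\<close>

text \<open>Tensors over \<open>E\<^sub>p\<close> in the basis of words in \<open>h\<^sub>+\<close>, \<open>h\<^sub>-\<close>; the parallel ones are the balanced ones.\<close>

type_synonym tensor = "bool list \<Rightarrow>\<^sub>0 complex"

definition PiT :: "tensor set" where
  "PiT = {t. \<forall>w\<in>Poly_Mapping.keys t. balanced w}"

definition tensor_mult :: "tensor \<Rightarrow> tensor \<Rightarrow> tensor" where
  "tensor_mult s t = lin_ext (\<lambda>u a. lin_ext (\<lambda>w b. Poly_Mapping.single (u @ w) (a * b)) t) s"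

definition swap_at :: "nat \<Rightarrow> 'a list \<Rightarrow> 'a list" where
  "swap_at j w = w[j := w ! Suc j, Suc j := w ! j]"

text \<open>The scalar \<open>\<rho>\<close> with \<open>R(h\<^sub>a,h\<^sub>b)h\<^sub>c = \<rho> h\<^sub>c\<close>, coming from \<open>R(h\<^sub>+,h\<^sub>-)h\<^sub>\<plusminus> = \<plusminus>2K h\<^sub>\<plusminus>\<close>.\<close>

definition curv :: "real \<Rightarrow> bool \<Rightarrow> bool \<Rightarrow> bool \<Rightarrow> complex" where
  "curv K a b c = (if a = b then 0
     else (if a then 1 else -1) * (if c then 1 else -1) * complex_of_real (2 * K))"

text \<open>The elements that have to act by zero, extended linearly from words of length \<open>r \<ge> 2\<close>.
  Positions are counted from \<open>0\<close> in \<open>cdc_inner\<close>, so \<open>j\<close> ranges over \<open>0,\<dots>,r-3\<close>.\<close>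

definition cdc_last :: "nat \<Rightarrow> tensor \<Rightarrow> tensor" where
  "cdc_last r = lin_ext (\<lambda>w c. Poly_Mapping.single w c - Poly_Mapping.single (swap_at (r - 2) w) c)"

definition cdc_inner :: "real \<Rightarrow> nat \<Rightarrow> nat \<Rightarrow> tensor \<Rightarrow> tensor" where
  "cdc_inner K r j = lin_ext (\<lambda>w c.
     Poly_Mapping.single w c - Poly_Mapping.single (swap_at j w) c +
     (\<Sum>k\<in>{j+2..<r}. Poly_Mapping.single (take j w @ drop (j + 2) w)
                        (c * curv K (w ! j) (w ! Suc j) (w ! k))))"

definition covariant_derivative_condition ::
  "real \<Rightarrow> 'w::ab_group_add set \<Rightarrow> (tensor \<Rightarrow> 'w \<Rightarrow> 'w) \<Rightarrow> bool" where
  "covariant_derivative_condition K L \<rho> \<longleftrightarrow>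
     (\<forall>r\<ge>2. \<forall>t\<in>PiT. (\<forall>w\<in>Poly_Mapping.keys t. length w = r) \<longrightarrow>
        (\<forall>x\<in>L. \<rho> (cdc_last r t) x = 0 \<and> (\<forall>j. j + 2 < r \<longrightarrow> \<rho> (cdc_inner K r j t) x = 0)))"

text \<open>\<open>\<rho>\<close> makes \<open>gr \<mu>\<close> a module for the algebra of parallel tensors, the action being given by zero
  modes.\<close>

definition zero_mode_module ::
  "(complex \<Rightarrow> 'w \<Rightarrow> 'w::ab_group_add) \<Rightarrow> (complex \<Rightarrow> 'w set) \<Rightarrow> 'w vops \<Rightarrow> complex
     \<Rightarrow> (tensor \<Rightarrow> 'w \<Rightarrow> 'w) \<Rightarrow> bool" where
  "zero_mode_module scl gr Y \<mu> \<rho> \<longleftrightarrow>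
     (\<forall>t\<in>PiT. \<forall>x\<in>gr \<mu>. \<rho> t x \<in> gr \<mu>) \<and>
     (\<forall>t\<in>PiT. \<forall>x\<in>gr \<mu>. \<forall>y\<in>gr \<mu>. \<rho> t (x + y) = \<rho> t x + \<rho> t y) \<and>
     (\<forall>t\<in>PiT. \<forall>x\<in>gr \<mu>. \<forall>c. \<rho> t (scl c x) = scl c (\<rho> t x)) \<and>
     (\<forall>s\<in>PiT. \<forall>t\<in>PiT. \<forall>x\<in>gr \<mu>. \<rho> (s + t) x = \<rho> s x + \<rho> t x) \<and>
     (\<forall>t\<in>PiT. \<forall>x\<in>gr \<mu>. \<forall>c. \<rho> (pm_scale (*) c t) x = scl c (\<rho> t x)) \<and>
     (\<forall>x\<in>gr \<mu>. \<rho> (Poly_Mapping.single [] 1) x = x) \<and>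
     (\<forall>s\<in>PiT. \<forall>t\<in>PiT. \<forall>x\<in>gr \<mu>. \<rho> (tensor_mult s t) x = \<rho> s (\<rho> t x)) \<and>
     (\<forall>v. proper_word v \<and> balanced (map fst v) \<longrightarrow> (\<forall>x\<in>gr \<mu>.
        Y (Poly_Mapping.single v 1) (int (wt v) - 1) x =
        scl (\<Prod>(i, m)\<leftarrow>v. (-1) ^ (m - 1)) (\<rho> (Poly_Mapping.single (map fst v) 1) x)))"


section \<open>The modules \<open>W(\<lambda>,[\<mu>])\<close> and the class of modules\<close>

text \<open>\<open>T(E\<^sub>p) \<otimes> C\<^sup>\<infinity>(U)\<close>, with \<open>T(E\<^sub>p)\<close> acting from the left, lives on the following type. Its quotient
  \<open>T(E\<^sub>p) \<otimes>\<^bsub>\<Pi>(T(E))\<^esub> C\<^sup>\<infinity>(U)\<close> is the quotient by \<open>tensor_rel S U\<close>, which is spanned by the elements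
  \<open>u \<otimes> X\<^sub>p \<otimes> g - u \<otimes> (\<nabla>\<^sup>kg)(X)\<close> with \<open>u\<close> a word and \<open>X\<close> a parallel section of \<open>E\<^bsup>\<otimes>k\<^esup>\<close>.\<close>

type_synonym 'm tfun = "bool list \<Rightarrow>\<^sub>0 ('m \<Rightarrow> complex)"

abbreviation tfun_scale :: "complex \<Rightarrow> 'm tfun \<Rightarrow> 'm tfun" where
  "tfun_scale \<equiv> pm_scale (\<lambda>c g q. c * g q)"

definition tfun_act :: "bool \<Rightarrow> 'm tfun \<Rightarrow> 'm tfun" where
  "tfun_act i = lin_ext (\<lambda>w g. Poly_Mapping.single (i # w) g)"

text \<open>\<open>\<xi>\<close> is the evaluation of \<open>X\<close> at the base point in the basis of words in \<open>h\<^sub>+\<close>, \<open>h\<^sub>-\<close>.\<close>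

definition evaluates_to ::
  "('m, 'z) framed_surface_scheme \<Rightarrow> nat \<Rightarrow> ('m chart \<Rightarrow> 2 list \<Rightarrow> real^2 \<Rightarrow> complex) \<Rightarrow> tensor
     \<Rightarrow> bool" where
  "evaluates_to S k X \<xi> \<longleftrightarrow> (\<forall>w\<in>Poly_Mapping.keys \<xi>. length w = k) \<and>
     (\<forall>as. length as = k \<longrightarrow>
        X (basechart S) as (snd (basechart S) (basept S)) =
        lin_ext (\<lambda>w c. c * (\<Prod>j<k. hvec S (w ! j) $ (as ! j))) \<xi>)"

definition tensor_rel :: "('m, 'z) framed_surface_scheme \<Rightarrow> 'm set \<Rightarrow> 'm tfun set" where
  "tensor_rel S U = module.span tfun_scale
     {lin_ext (\<lambda>w c. Poly_Mapping.single (u @ w) (\<lambda>q. c * g q)) \<xi>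
        - Poly_Mapping.single u (par_act S U k X g)
      | u k X \<xi> g. parallel_section S k X \<and> evaluates_to S k X \<xi> \<and> g \<in> Cinf S U}"

text \<open>\<open>F(T(E\<^sub>p) \<otimes>\<^bsub>\<Pi>(T(E))\<^esub> C\<^sup>\<infinity>(U))\<close> is the quotient of \<open>F(T(E\<^sub>p) \<otimes> C\<^sup>\<infinity>(U))\<close> by \<open>fock_rel S U\<close>, and all of its
  subspaces are represented by their preimages in \<open>F(T(E\<^sub>p) \<otimes> C\<^sup>\<infinity>(U))\<close>.\<close>

type_synonym 'm ffun = "fword \<Rightarrow>\<^sub>0 'm tfun"

abbreviation ffun_scale :: "complex \<Rightarrow> 'm ffun \<Rightarrow> 'm ffun" where
  "ffun_scale \<equiv> pm_scale tfun_scale"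

definition fock_rel :: "('m, 'z) framed_surface_scheme \<Rightarrow> 'm set \<Rightarrow> 'm ffun set" where
  "fock_rel S U = {x. \<forall>w\<in>Poly_Mapping.keys x.
     proper_word w \<and> Poly_Mapping.lookup x w \<in> tensor_rel S U}"

definition ffun_gr :: "complex \<Rightarrow> complex \<Rightarrow> 'm ffun set" where
  "ffun_gr \<mu> m = {x. \<forall>w\<in>Poly_Mapping.keys x. proper_word w \<and> m = \<mu> + of_nat (wt w)}"

definition ffun_vop :: "complex \<Rightarrow> 'm ffun vops" where
  "ffun_vop = fock_vop tfun_scale tfun_act"

text \<open>\<open>V\<^sub>U(l,f)\<close>\<close>

definition VU ::
  "complex \<Rightarrow> ('m, 'z) framed_surface_scheme \<Rightarrow> 'm set \<Rightarrow> ('m \<Rightarrow> complex) \<Rightarrow> 'm ffun set" where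
  "VU l S U f = {x + y | x y. y \<in> fock_rel S U \<and>
     x \<in> module.span ffun_scale
       {ffun_vop l v n (Poly_Mapping.single [] (Poly_Mapping.single [] f)) | v n. v \<in> Vsp}}"

definition maximal_proper_submodule ::
  "complex \<Rightarrow> ('m, 'z) framed_surface_scheme \<Rightarrow> 'm set \<Rightarrow> ('m \<Rightarrow> complex) \<Rightarrow> complex
     \<Rightarrow> 'm ffun set \<Rightarrow> bool" where
  "maximal_proper_submodule l S U f \<mu> N \<longleftrightarrow>
     (let sub = (\<lambda>B. submodule ffun_scale (ffun_gr \<mu>) (ffun_vop l) B \<and>
                     fock_rel S U \<subseteq> B \<and> B \<subset> VU l S U f)
      in sub N \<and> (\<forall>N'. sub N' \<and> N \<subseteq> N' \<longrightarrow> N' = N))"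

text \<open>\<open>A/B \<cong> W(\<lambda>,[\<mu>])\<close>\<close>

definition iso_W ::
  "complex \<Rightarrow> ('m::topological_space, 'z) framed_surface_scheme \<Rightarrow>
   (complex \<Rightarrow> 'w \<Rightarrow> 'w::ab_group_add) \<Rightarrow> (complex \<Rightarrow> 'w set) \<Rightarrow> 'w vops \<Rightarrow> 'w set \<Rightarrow> 'w set \<Rightarrow>
   complex \<Rightarrow> complex \<Rightarrow> bool" where
  "iso_W l S scl gr Y A B lam \<mu> \<longleftrightarrow>
     (\<exists>U f N. open U \<and> eigenfunction S U lam f \<and> f \<noteq> (\<lambda>q. 0) \<and>
        maximal_proper_submodule l S U f \<mu> N \<and>
        subquotient_iso scl gr Y A B ffun_scale (ffun_gr \<mu>) (ffun_vop l) (VU l S U f) N)"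

text \<open>A composition series \<open>Ws 1 \<supseteq> \<dots> \<supseteq> Ws n \<supseteq> Ws (n+1)\<close> with factors \<open>W(lam i, [\<mu>])\<close>.\<close>

definition W_series ::
  "complex \<Rightarrow> ('m::topological_space, 'z) framed_surface_scheme \<Rightarrow>
   (complex \<Rightarrow> 'w \<Rightarrow> 'w::ab_group_add) \<Rightarrow> (complex \<Rightarrow> 'w set) \<Rightarrow> 'w vops \<Rightarrow>
   nat \<Rightarrow> (nat \<Rightarrow> 'w set) \<Rightarrow> (nat \<Rightarrow> complex) \<Rightarrow> complex \<Rightarrow> bool" where
  "W_series l S scl gr Y n Ws lam \<mu> \<longleftrightarrow>
     Ws 1 = UNIV \<and> Ws (n + 1) = {0} \<and>
     (\<forall>i\<in>{1..n+1}. submodule scl gr Y (Ws i)) \<and>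
     (\<forall>i\<in>{1..n}. Ws (i + 1) \<subseteq> Ws i \<and> iso_W l S scl gr Y (Ws i) (Ws (i + 1)) (lam i) \<mu>)"

definition class_C ::
  "complex \<Rightarrow> real \<Rightarrow> ('m::topological_space, 'z) framed_surface_scheme \<Rightarrow>
   (complex \<Rightarrow> 'w \<Rightarrow> 'w::ab_group_add) \<Rightarrow> (complex \<Rightarrow> 'w set) \<Rightarrow> 'w vops \<Rightarrow> bool" where
  "class_C l K S scl gr Y \<longleftrightarrow>
     (\<exists>\<mu> \<rho>. lowest_weight_module scl gr Y \<mu> \<and> zero_mode_module scl gr Y \<mu> \<rho> \<and>
        covariant_derivative_condition K (gr \<mu>) \<rho>) \<and>
     (\<exists>n Ws lam \<mu>. W_series l S scl gr Y n Ws lam \<mu>)"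

end

theory Submission
  imports Defs
begin

text \<open>The inverse metric is parallel, so on the lowest weight space the zero mode of \<open>h\<^sub>+ h\<^sub>-\<close> plays the role of the
  Laplacian \<open>\<Delta>\<close>, and the covariant derivative condition makes every balanced word act there by a product of factors
  \<open>\<Delta> + p(p-1)K\<close>, one for each step of its charge walk from height \<open>\<plusminus>p\<close> towards \<open>0\<close>. A composition series with
  all eigenvalues \<open>P(P-1)K\<close> makes \<open>\<Delta> + P(P-1)K\<close> nilpotent. Suppose that it does not vanish, so that
  \<open>w\<^sub>0 = (\<Delta> + P(P-1)K) w \<noteq> 0\<close> is an eigenvector for some \<open>w\<close>. A word whose walk passes through height \<open>P\<close> sends
  \<open>w\<close> to a multiple of \<open>w\<^sub>0\<close> and kills \<open>w\<^sub>0\<close>. Hence \<open>h\<^sub>+(-1)\<^sup>P h\<^sub>-(0)\<^sup>P w\<close> lies in the submodule generated by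
  \<open>w\<^sub>0\<close>, a submodule being determined by its lowest weight vectors as all composition factors are simple and generated
  by theirs. Since \<open>h\<^sub>-(1)\<^sup>P h\<^sub>+(0)\<^sup>P\<close> kills this submodule but sends the vector to a nonzero multiple of \<open>w\<^sub>0\<close>,
  this is a contradiction; individual modes of odd words do not act on the module, so both operators are replaced by
  combinations of modes of balanced words. Thus \<open>\<Delta>\<close> acts by a scalar, every subspace of the lowest weight space is
  stable, and the module splits.\<close>

text \<open>The obstacle is that \<open>W\<close> is an abstract module: only modes of balanced
  words act on it, and they do not factor into modes of single letters. So the effect of a raising
  mode followed by a lowering mode on a lowest weight vector has to be read off from weak
  associativity. One side of that axiom leads to zero modes of vectors of \<open>V\<close>, and
  these are computable in the Fock space by sums over matchings of letters. The result has the form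
  it would have if single modes existed, which permits linear combinations of letters whose unwanted
  modes have coefficient zero. The eigenvalue P(P-1)K is singled out because exactly the factor of
  height P then becomes nilpotent, while the factor of a height p with 1 \<le> p < P acts on
  \<open>w\<^sub>0\<close> by (p(p-1) - P(P-1))K, which is nonzero because K is. The product of
  these factors and of P contractions, each a nonzero multiple of l, is the multiple in the final
  contradiction.\<close>

section \<open>Linear extension and scaling of finitely supported functions\<close>

lemma lin_ext_superset:
  assumes "finite A" "Poly_Mapping.keys x \<subseteq> A" "\<And>k. \<phi> k 0 = 0"
  shows "lin_ext \<phi> x = (\<Sum>k\<in>A. \<phi> k (Poly_Mapping.lookup x k))"
  unfolding lin_ext_def using assms by (intro sum.mono_neutral_left) (auto simp: in_keys_iff)

lemma lin_ext_zero [simp]: "lin_ext \<phi> 0 = 0"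
  by (simp add: lin_ext_def)

lemma lin_ext_single: "\<phi> k 0 = 0 \<Longrightarrow> lin_ext \<phi> (Poly_Mapping.single k s) = \<phi> k s"
  by (simp add: lin_ext_def)

lemma lin_ext_add:
  assumes "\<And>k. \<phi> k 0 = 0" "\<And>k s t. \<phi> k (s + t) = \<phi> k s + \<phi> k t"
  shows "lin_ext \<phi> (x + y) = lin_ext \<phi> x + lin_ext \<phi> y"
proof -
  let ?A = "Poly_Mapping.keys x \<union> Poly_Mapping.keys y"
  have "finite ?A" "Poly_Mapping.keys (x + y) \<subseteq> ?A" using keys_add[of x y] by auto
  then show ?thesis
    by (simp add: lin_ext_superset[where A = ?A] assms lookup_add sum.distrib)
qed

lemma poly_mapping_eq_sum: "x = (\<Sum>k\<in>Poly_Mapping.keys x. Poly_Mapping.single k (Poly_Mapping.lookup x k))"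
  by (rule poly_mapping_eqI)
     (auto simp: lookup_sum lookup_single when_def in_keys_iff sum.delta)

lemma pm_induct [case_names zero add]:
  assumes "P 0" "\<And>k s x. s \<noteq> 0 \<Longrightarrow> P x \<Longrightarrow> P (Poly_Mapping.single k s + x)"
  shows "P (x :: 'k \<Rightarrow>\<^sub>0 's::comm_monoid_add)"
proof -
  have "P (\<Sum>k\<in>A. Poly_Mapping.single k (Poly_Mapping.lookup x k))" if "finite A" "A \<subseteq> Poly_Mapping.keys x" for A
    using that by (induction A rule: finite_induct) (auto intro: assms simp: in_keys_iff)
  from this[of "Poly_Mapping.keys x"] show ?thesis by (simp flip: poly_mapping_eq_sum)
qed

lemma lin_ext_Pair_zero [simp]: "lin_ext (\<lambda>k s. 0) x = 0"
  by (simp add: lin_ext_def)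

lemma lookup_pm_scale: "sc c 0 = 0 \<Longrightarrow> Poly_Mapping.lookup (pm_scale sc c x) k = sc c (Poly_Mapping.lookup x k)"
  by (simp add: map.rep_eq when_def)

lemma pm_scale_single: "sc c 0 = 0 \<Longrightarrow> pm_scale sc c (Poly_Mapping.single k s) = Poly_Mapping.single k (sc c s)"
  by (rule poly_mapping_eqI) (simp add: lookup_pm_scale lookup_single when_def)

lemma vector_space_pm_scale:
  assumes "vector_space (sc :: complex \<Rightarrow> 's::ab_group_add \<Rightarrow> 's)"
  shows "vector_space (pm_scale sc :: complex \<Rightarrow> ('k \<Rightarrow>\<^sub>0 's) \<Rightarrow> ('k \<Rightarrow>\<^sub>0 's))"
proof -
  interpret vector_space sc by fact
  show ?thesis
    by unfold_locales
       (auto intro!: poly_mapping_eqI simp: lookup_pm_scale lookup_add scale_right_distrib scale_left_distrib)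
qed

lemma lin_ext_pm_scale:
  fixes \<phi> :: "'k \<Rightarrow> 's::zero \<Rightarrow> 't::comm_monoid_add"
  assumes "\<And>k. \<phi> k 0 = 0" "sc c 0 = 0" "\<And>k s. \<phi> k (sc c s) = h (\<phi> k s)" "h 0 = 0" "\<And>a b. h (a + b) = h a + h b"
  shows "lin_ext \<phi> (pm_scale sc c x) = h (lin_ext \<phi> x)"
proof -
  have h: "h (sum f A) = (\<Sum>a\<in>A. h (f a))" for f :: "'k \<Rightarrow> 't" and A
    by (induction A rule: infinite_finite_induct) (simp_all add: assms)
  have "Poly_Mapping.keys (pm_scale sc c x) \<subseteq> Poly_Mapping.keys x"
    using assms(2) by (auto simp: in_keys_iff lookup_pm_scale)
  then show ?thesis
    by (simp add: lin_ext_superset[where A = "Poly_Mapping.keys x"] assms lookup_pm_scale h)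
qed

section \<open>The Laplacian as a parallel tensor\<close>

text \<open>\<open>frechet_derivative\<close> is a choice among all derivatives at the point, and
  which maps are derivatives depends only on the germ of the function.\<close>

lemma pd_cong_open:
  assumes "open A" "x \<in> A" "\<And>y. y \<in> A \<Longrightarrow> g y = h y"
  shows "pd a g x = pd a h x"
proof -
  have "(g has_derivative D) (at x) \<longleftrightarrow> (h has_derivative D) (at x)" for D
    using has_derivative_transform_within_open[OF _ assms(1,2)] assms(3) by metis
  then show ?thesis by (simp add: pd_def frechet_derivative_def)
qed

lemma differentiable_cong_open:
  assumes "open A" "x \<in> A" "\<And>y. y \<in> A \<Longrightarrow> g y = h y" "h differentiable (at x)"
  shows "g differentiable (at x)"
  using has_derivative_transform_within_open[OF _ assms(1,2), of h _ UNIV g] assms(3,4)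
    unfolding differentiable_def by metis

text \<open>Smoothness of one function involves all its iterated derivatives, so it is proved for a
  whole class closed under \<open>pd\<close>. Closure is demanded only up to equality on
  \<open>A\<close>, because the rule for reciprocals holds only there.\<close>

lemma smooth_on_foldr_pd:
  assumes "open A" "f \<in> F"
    and diff: "\<And>f x. f \<in> F \<Longrightarrow> x \<in> A \<Longrightarrow> f differentiable (at x)"
    and pd: "\<And>f a. f \<in> F \<Longrightarrow> \<exists>g\<in>F. \<forall>x\<in>A. pd a f x = g x"
  shows "smooth_on A f"
proof -
  note pd_cong = pd_cong_open[OF \<open>open A\<close>] and diff_cong = differentiable_cong_open[OF \<open>open A\<close>]
  have "\<exists>g\<in>F. \<forall>x\<in>A. foldr pd as f x = g x" for as
  proof (induction as)
    case Nil
    then show ?case using \<open>f \<in> F\<close> by auto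
  next
    case (Cons a as)
    then obtain g where g: "g \<in> F" "\<And>x. x \<in> A \<Longrightarrow> foldr pd as f x = g x" by blast
    obtain h where "h \<in> F" "\<And>x. x \<in> A \<Longrightarrow> pd a g x = h x" using pd[OF g(1)] by blast
    then show ?case using pd_cong[OF _ g(2)] by (intro bexI[of _ h]) auto
  qed
  then show ?thesis unfolding smooth_on_def using diff diff_cong by metis
qed

lemma smooth_on_pd: "smooth_on A f \<Longrightarrow> smooth_on A (pd a f)"
  unfolding smooth_on_def
proof (intro allI ballI)
  fix as x assume *: "\<forall>as. \<forall>x\<in>A. foldr pd as f differentiable at x" "x \<in> A"
  then have "foldr pd (as @ [a]) f differentiable at x" by blast
  then show "foldr pd as (pd a f) differentiable at x" by simp
qed

lemma smooth_on_differentiable: "smooth_on A f \<Longrightarrow> x \<in> A \<Longrightarrow> f differentiable (at x)"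
  unfolding smooth_on_def by (metis foldr.simps(1) id_apply)

text \<open>A class suited to \<open>smooth_on_foldr_pd\<close>. Reciprocals are included because of
  Cramer's rule, by which the entries of the inverse metric agree on \<open>A\<close> with members
  of the class.\<close>

inductive_set smooth_alg :: "(real^2) set \<Rightarrow> (real^2 \<Rightarrow> real) set" for A where
  smooth: "smooth_on A f \<Longrightarrow> f \<in> smooth_alg A"
| uminus: "f \<in> smooth_alg A \<Longrightarrow> (\<lambda>x. - f x) \<in> smooth_alg A"
| add: "f \<in> smooth_alg A \<Longrightarrow> g \<in> smooth_alg A \<Longrightarrow> (\<lambda>x. f x + g x) \<in> smooth_alg A"
| mult: "f \<in> smooth_alg A \<Longrightarrow> g \<in> smooth_alg A \<Longrightarrow> (\<lambda>x. f x * g x) \<in> smooth_alg A"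
| inverse: "f \<in> smooth_alg A \<Longrightarrow> (\<And>x. x \<in> A \<Longrightarrow> f x \<noteq> 0) \<Longrightarrow> (\<lambda>x. inverse (f x)) \<in> smooth_alg A"

lemma pd_eq: "(f has_derivative D) (at x) \<Longrightarrow> pd a f x = D (axis a 1)"
  unfolding pd_def using frechet_derivative_at by metis

lemma has_derivative_frechet:
  "f differentiable (at x) \<Longrightarrow> (f has_derivative frechet_derivative f (at x)) (at x)"
  by (simp add: frechet_derivative_works)

lemma smooth_alg_differentiable:
  "f \<in> smooth_alg A \<Longrightarrow> x \<in> A \<Longrightarrow> f differentiable (at x)"
  by (induction rule: smooth_alg.induct) (auto intro: smooth_on_differentiable)

lemma pd_mult:
  fixes f g :: "real^2 \<Rightarrow> real"
  assumes "f differentiable (at x)" "g differentiable (at x)"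
  shows "pd a (\<lambda>x. f x * g x) x = f x * pd a g x + pd a f x * g x"
  using pd_eq[OF has_derivative_mult[OF has_derivative_frechet[OF assms(1)] has_derivative_frechet[OF assms(2)]]]
  by (simp add: pd_def)

lemma pd_add:
  fixes f g :: "real^2 \<Rightarrow> 'a::real_normed_vector"
  assumes "f differentiable (at x)" "g differentiable (at x)"
  shows "pd a (\<lambda>x. f x + g x) x = pd a f x + pd a g x"
  using pd_eq[OF has_derivative_add[OF has_derivative_frechet[OF assms(1)] has_derivative_frechet[OF assms(2)]]]
  by (simp add: pd_def)

lemma pd_linear:
  assumes "f differentiable (at x)" "bounded_linear h"
  shows "pd a (\<lambda>x. h (f x)) x = h (pd a f x)"
  using pd_eq[OF bounded_linear.has_derivative[OF assms(2) has_derivative_frechet[OF assms(1)]]]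
  by (simp add: pd_def)

lemma pd_inverse:
  fixes f :: "real^2 \<Rightarrow> real"
  assumes "f differentiable (at x)" "f x \<noteq> 0"
  shows "pd a (\<lambda>x. inverse (f x)) x = - (inverse (f x) * pd a f x * inverse (f x))"
  using pd_eq[OF Deriv.has_derivative_inverse[OF assms(2) has_derivative_frechet[OF assms(1)]]]
  by (simp add: pd_def)

lemma smooth_alg_pd:
  "f \<in> smooth_alg A \<Longrightarrow> \<exists>g\<in>smooth_alg A. \<forall>x\<in>A. pd a f x = g x"
proof (induction rule: smooth_alg.induct)
  case (smooth f)
  then show ?case using smooth_on_pd smooth_alg.smooth by blast
next
  case (uminus f)
  then obtain g where "g \<in> smooth_alg A" "\<forall>x\<in>A. pd a f x = g x" by blast
  then show ?case using uminus
    by (intro bexI[OF _ smooth_alg.uminus[of g]])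
       (auto simp: pd_linear[of f _ uminus] smooth_alg_differentiable bounded_linear_minus[OF bounded_linear_ident])
next
  case (add f g)
  then obtain f' g' where "f' \<in> smooth_alg A" "\<forall>x\<in>A. pd a f x = f' x"
    "g' \<in> smooth_alg A" "\<forall>x\<in>A. pd a g x = g' x" by blast
  then show ?case using add
    by (intro bexI[OF _ smooth_alg.add[of f' _ g']]) (auto simp: pd_add smooth_alg_differentiable)
next
  case (mult f g)
  then obtain f' g' where "f' \<in> smooth_alg A" "\<forall>x\<in>A. pd a f x = f' x"
    "g' \<in> smooth_alg A" "\<forall>x\<in>A. pd a g x = g' x" by blast
  then show ?case using mult
    by (intro bexI[OF _ smooth_alg.add[OF smooth_alg.mult[of f _ g'] smooth_alg.mult[of f' _ g]]])
       (auto simp: pd_mult smooth_alg_differentiable)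
next
  case (inverse f)
  then obtain g where "g \<in> smooth_alg A" "\<forall>x\<in>A. pd a f x = g x" by blast
  then show ?case using inverse smooth_alg.inverse[of f A]
    by (intro bexI[OF _ smooth_alg.uminus[OF smooth_alg.mult[OF smooth_alg.mult[OF
            smooth_alg.inverse[of f A] ] smooth_alg.inverse[of f A]], of g]])
       (auto simp: pd_inverse smooth_alg_differentiable)
qed

lemma smooth_alg_smooth_on_of_real:
  assumes "open A" "f \<in> smooth_alg A"
  shows "smooth_on A (\<lambda>x. complex_of_real (f x))"
proof (rule smooth_on_foldr_pd[where F = "(\<lambda>f x. complex_of_real (f x)) ` smooth_alg A"])
  fix g :: "real^2 \<Rightarrow> complex" and x assume "g \<in> (\<lambda>f x. complex_of_real (f x)) ` smooth_alg A" "x \<in> A"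
  then show "g differentiable (at x)"
    using smooth_alg_differentiable bounded_linear.has_derivative[OF bounded_linear_of_real]
    unfolding differentiable_def by fast
next
  fix g :: "real^2 \<Rightarrow> complex" and a assume "g \<in> (\<lambda>f x. complex_of_real (f x)) ` smooth_alg A"
  then obtain f where f: "f \<in> smooth_alg A" "g = (\<lambda>x. complex_of_real (f x))" by blast
  obtain f' where f': "f' \<in> smooth_alg A" "\<forall>x\<in>A. pd a f x = f' x" using smooth_alg_pd[OF f(1)] by blast
  then have "\<forall>x\<in>A. pd a g x = complex_of_real (f' x)"
    using f by (auto simp: pd_linear[OF _ bounded_linear_of_real] smooth_alg_differentiable)
  then show "\<exists>h\<in>(\<lambda>f x. complex_of_real (f x)) ` smooth_alg A. \<forall>x\<in>A. pd a g x = h x"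
    using f'(1) by auto
qed (use assms in auto)

section \<open>Gram matrices and the inverse metric\<close>

definition gram_ok :: "real^2^2 \<Rightarrow> bool" where
  "gram_ok g \<longleftrightarrow> transpose g = g \<and> (\<forall>v. v \<noteq> 0 \<longrightarrow> v \<bullet> (g *v v) > 0)"

lemma gram_ok_invertible: "gram_ok g \<Longrightarrow> invertible g"
  unfolding gram_ok_def invertible_left_inverse matrix_left_invertible_ker
  by (metis inner_zero_right less_irrefl)

lemma gram_ok_sym: "gram_ok g \<Longrightarrow> g $ i $ j = g $ j $ i"
proof -
  assume "gram_ok g"
  then have "transpose g $ i $ j = g $ i $ j" by (simp add: gram_ok_def)
  then show ?thesis by (simp add: transpose_def)
qed

lemma matrix_inv_cancel:
  assumes "invertible g"
  shows "g ** matrix_inv g = mat 1" "matrix_inv g ** g = mat 1"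
  using someI_ex[OF assms[unfolded invertible_def]] by (simp_all add: matrix_inv_def)

text \<open>Cramer's rule, the source of both the smoothness and the symmetry of the inverse
  metric.\<close>

lemma matrix_inv_2:
  fixes g :: "real^2^2"
  assumes "invertible g"
  shows "matrix_inv g $ 1 $ 1 = g $ 2 $ 2 * inverse (det g)"
    "matrix_inv g $ 1 $ 2 = - (g $ 1 $ 2 * inverse (det g))"
    "matrix_inv g $ 2 $ 1 = - (g $ 2 $ 1 * inverse (det g))"
    "matrix_inv g $ 2 $ 2 = g $ 1 $ 1 * inverse (det g)"
proof -
  let ?D = "det g"
  define h :: "real^2^2" where "h = (\<chi> i j. if i = 1 then (if j = 1 then g $ 2 $ 2 * inverse ?D else - (g $ 1 $ 2 * inverse ?D))
     else (if j = 1 then - (g $ 2 $ 1 * inverse ?D) else g $ 1 $ 1 * inverse ?D))"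
  have D: "?D \<noteq> 0" using assms by (simp add: invertible_det_nz)
  have "(g $ 1 $ 1 * g $ 2 $ 2 - g $ 1 $ 2 * g $ 2 $ 1) * inverse ?D = 1" using D by (simp add: det_2)
  then have "h ** g = mat 1"
    by (auto simp: vec_eq_iff matrix_matrix_mult_def h_def forall_2 sum_2 mat_def algebra_simps)
  moreover have "g ** matrix_inv g = mat 1" using assms by (rule matrix_inv_cancel)
  ultimately have "matrix_inv g = h"
    by (metis matrix_mul_assoc matrix_mul_lid matrix_mul_rid)
  then show "matrix_inv g $ 1 $ 1 = g $ 2 $ 2 * inverse (det g)"
    "matrix_inv g $ 1 $ 2 = - (g $ 1 $ 2 * inverse (det g))"
    "matrix_inv g $ 2 $ 1 = - (g $ 2 $ 1 * inverse (det g))"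
    "matrix_inv g $ 2 $ 2 = g $ 1 $ 1 * inverse (det g)" by (simp_all add: h_def)
qed

lemma smooth_alg_matrix_inv:
  fixes g :: "real^2 \<Rightarrow> real^2^2"
  assumes smooth: "\<And>a b. smooth_on A (\<lambda>x. g x $ a $ b)" and inv: "\<And>x. x \<in> A \<Longrightarrow> invertible (g x)"
  shows "\<exists>h\<in>smooth_alg A. \<forall>x\<in>A. matrix_inv (g x) $ a $ b = h x"
proof -
  note [intro] = smooth_alg.intros
  have g: "(\<lambda>x. g x $ a $ b) \<in> smooth_alg A" for a b using smooth by blast
  have "(\<lambda>x. g x $ 1 $ 1 * g x $ 2 $ 2 + - (g x $ 1 $ 2 * g x $ 2 $ 1)) \<in> smooth_alg A"
    by (intro smooth_alg.add smooth_alg.mult smooth_alg.uminus g)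
  then have "(\<lambda>x. det (g x)) \<in> smooth_alg A" by (simp add: det_2)
  then have d: "(\<lambda>x. inverse (det (g x))) \<in> smooth_alg A"
    using inv by (intro smooth_alg.inverse) (auto simp: invertible_det_nz)
  have 1: "(\<lambda>x. g x $ i $ j * inverse (det (g x))) \<in> smooth_alg A" for i j by (intro smooth_alg.mult g d)
  have "\<forall>a b. \<exists>h\<in>smooth_alg A. \<forall>x\<in>A. matrix_inv (g x) $ a $ b = h x"
    unfolding forall_2
    by (intro conjI bexI[OF _ 1[of 2 2]] bexI[OF _ smooth_alg.uminus[OF 1[of 1 2]]]
      bexI[OF _ smooth_alg.uminus[OF 1[of 2 1]]] bexI[OF _ 1[of 1 1]]) (simp_all add: matrix_inv_2 inv)
  then show ?thesis by blast
qed

lemma smooth_on_cong_open: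
  assumes "open A" "\<And>y. y \<in> A \<Longrightarrow> g y = h y" "smooth_on A h"
  shows "smooth_on A g"
proof -
  have *: "\<forall>x\<in>A. foldr pd as g x = foldr pd as h x" for as
  proof (induction as)
    case (Cons a as)
    then show ?case using pd_cong_open[OF assms(1), of _ "foldr pd as g" "foldr pd as h"] by simp
  qed (use assms in auto)
  show ?thesis
    using assms(3) differentiable_cong_open[OF assms(1)] * unfolding smooth_on_def by metis
qed

text \<open>With \<open>G\<close> for the inverse, differentiating \<open>G g = 1\<close> and
  multiplying by \<open>G\<close> from the right gives \<open>G' = - G g' G\<close>.\<close>

lemma pd_matrix_inv:
  fixes g :: "real^2 \<Rightarrow> real^2^2"
  assumes A: "open A" "x \<in> A"
    and smooth: "\<And>a b. smooth_on A (\<lambda>x. g x $ a $ b)" and inv: "\<And>x. x \<in> A \<Longrightarrow> invertible (g x)"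
  shows "pd a (\<lambda>y. matrix_inv (g y) $ i $ j) x = - (\<Sum>k\<in>UNIV. \<Sum>m\<in>UNIV.
     matrix_inv (g x) $ i $ k * pd a (\<lambda>y. g y $ k $ m) x * matrix_inv (g x) $ m $ j)"
proof -
  let ?G = "\<lambda>x. matrix_inv (g x)"
  have dG: "(\<lambda>y. ?G y $ i $ k) differentiable (at x)" for i k
  proof -
    have "\<exists>h\<in>smooth_alg A. \<forall>x\<in>A. ?G x $ i $ k = h x"
      by (rule smooth_alg_matrix_inv[OF smooth inv])
    then obtain h where "h \<in> smooth_alg A" "\<forall>x\<in>A. ?G x $ i $ k = h x" ..
    then show ?thesis
      using differentiable_cong_open[OF A, of "\<lambda>y. ?G y $ i $ k" h] smooth_alg_differentiable[OF _ A(2), of h]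
      by simp
  qed
  have dg: "(\<lambda>y. g y $ i $ k) differentiable (at x)" for i k
    using smooth_on_differentiable[OF smooth A(2)] .
  have one: "?G y $ i $ 1 * g y $ 1 $ m + ?G y $ i $ 2 * g y $ 2 $ m = mat 1 $ i $ m"
    if "y \<in> A" for y i m
    using matrix_inv_cancel(2)[OF inv[OF that]] by (auto simp: vec_eq_iff matrix_matrix_mult_def sum_2)
  have one': "g x $ i $ 1 * ?G x $ 1 $ m + g x $ i $ 2 * ?G x $ 2 $ m = mat 1 $ i $ m" for i m
    using matrix_inv_cancel(1)[OF inv[OF A(2)]] by (auto simp: vec_eq_iff matrix_matrix_mult_def sum_2)
  have "pd a (\<lambda>y. ?G y $ i $ 1 * g y $ 1 $ m + ?G y $ i $ 2 * g y $ 2 $ m) x = pd a (\<lambda>y. mat 1 $ i $ m) x" for m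
    using one by (intro pd_cong_open[OF A]) auto
  then have eq: "?G x $ i $ 1 * pd a (\<lambda>y. g y $ 1 $ m) x + pd a (\<lambda>y. ?G y $ i $ 1) x * g x $ 1 $ m
     + (?G x $ i $ 2 * pd a (\<lambda>y. g y $ 2 $ m) x + pd a (\<lambda>y. ?G y $ i $ 2) x * g x $ 2 $ m) = 0" for m
    using pd_eq[OF has_derivative_const[of "mat 1 $ i $ m" "at x"]] dG dg by (simp add: pd_add pd_mult)
  \<comment> \<open>An identity matrix is inserted on the right, to be replaced by \<open>g\<close>
    times its inverse through \<open>one'\<close>; then \<open>eq\<close> removes the derivatives of
    the inverse.\<close>
  have "pd a (\<lambda>y. ?G y $ i $ j) x = pd a (\<lambda>y. ?G y $ i $ 1) x * (mat 1 :: real^2^2) $ 1 $ j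
      + pd a (\<lambda>y. ?G y $ i $ 2) x * (mat 1 :: real^2^2) $ 2 $ j"
    using exhaust_2[of j] by (auto simp: mat_def)
  also have "\<dots> = (pd a (\<lambda>y. ?G y $ i $ 1) x * g x $ 1 $ 1 + pd a (\<lambda>y. ?G y $ i $ 2) x * g x $ 2 $ 1) * ?G x $ 1 $ j
     + (pd a (\<lambda>y. ?G y $ i $ 1) x * g x $ 1 $ 2 + pd a (\<lambda>y. ?G y $ i $ 2) x * g x $ 2 $ 2) * ?G x $ 2 $ j"
    unfolding one'[symmetric] by (simp add: algebra_simps)
  also have "\<dots> = - (?G x $ i $ 1 * pd a (\<lambda>y. g y $ 1 $ 1) x + ?G x $ i $ 2 * pd a (\<lambda>y. g y $ 2 $ 1) x) * ?G x $ 1 $ j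
     - (?G x $ i $ 1 * pd a (\<lambda>y. g y $ 1 $ 2) x + ?G x $ i $ 2 * pd a (\<lambda>y. g y $ 2 $ 2) x) * ?G x $ 2 $ j"
    using eq[of 1] eq[of 2] by algebra
  finally show ?thesis by (simp add: sum_2 algebra_simps)
qed

lemma matrix_inv_symmetric: "gram_ok g \<Longrightarrow> matrix_inv g $ i $ j = matrix_inv g $ j $ i"
proof -
  assume g: "gram_ok g"
  from g have "g $ 1 $ 2 = g $ 2 $ 1" by (rule gram_ok_sym)
  with g have "\<forall>i j. matrix_inv g $ i $ j = matrix_inv g $ j $ i"
    by (simp add: forall_2 matrix_inv_2 gram_ok_invertible)
  then show ?thesis by blast
qed

text \<open>Here \<open>G\<close> stands for the inverse metric and \<open>d c i j\<close> for the
  derivative along c of the (i, j) entry of the metric. After relabelling, the two brackets add up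
  to \<open>2 * d a k m\<close>, the other terms cancelling in pairs: the compatibility of the
  Levi-Civita connection with the metric.\<close>

lemma christoffel_cancel:
  fixes G :: "2 \<Rightarrow> 2 \<Rightarrow> real" and d :: "2 \<Rightarrow> 2 \<Rightarrow> 2 \<Rightarrow> real"
  assumes symG: "\<And>i j. G i j = G j i" and symd: "\<And>c i j. d c i j = d c j i"
  shows "(\<Sum>b\<in>UNIV. (1/2) * (\<Sum>m\<in>UNIV. G i m * (d a b m + d b a m - d m a b)) * G b j)
    + (\<Sum>b\<in>UNIV. (1/2) * (\<Sum>m\<in>UNIV. G j m * (d a b m + d b a m - d m a b)) * G i b)
    = (\<Sum>k\<in>UNIV. \<Sum>m\<in>UNIV. G i k * d a k m * G m j)"
proof -
  have "(\<Sum>b\<in>UNIV. (1/2) * (\<Sum>m\<in>UNIV. G j m * (d a b m + d b a m - d m a b)) * G i b)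
    = (\<Sum>b\<in>UNIV. \<Sum>m\<in>UNIV. (1/2) * (G i b * (d a b m + d b a m - d m a b) * G m j))"
    using symG by (simp add: sum_distrib_left sum_distrib_right mult_ac)
  moreover have "(\<Sum>b\<in>UNIV. (1/2) * (\<Sum>m\<in>UNIV. G i m * (d a b m + d b a m - d m a b)) * G b j)
    = (\<Sum>m\<in>UNIV. \<Sum>b\<in>UNIV. (1/2) * (G i m * (d a b m + d b a m - d m a b) * G b j))"
    unfolding sum_distrib_left sum_distrib_right by (subst sum.swap) (simp add: mult_ac)
  moreover have "(1/2) * (G i k * (d a m k + d m a k - d k a m) * G m j)
      + (1/2) * (G i k * (d a k m + d k a m - d m a k) * G m j) = G i k * d a k m * G m j" for k m
    using symd[of a m k] by (simp add: field_simps)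
  ultimately show ?thesis by (simp only: sum.distrib[symmetric])
qed

lemma matrix_inv_parallel:
  fixes g :: "real^2 \<Rightarrow> real^2^2"
  assumes A: "open A" "x \<in> A"
    and smooth: "\<And>a b. smooth_on A (\<lambda>x. g x $ a $ b)" and ok: "\<And>x. x \<in> A \<Longrightarrow> gram_ok (g x)"
  shows "pd a (\<lambda>y. matrix_inv (g y) $ i $ j) x + ((\<Sum>b\<in>UNIV. christoffel g i a b x * matrix_inv (g x) $ b $ j)
    + (\<Sum>b\<in>UNIV. christoffel g j a b x * matrix_inv (g x) $ i $ b)) = 0"
proof -
  have symg: "pd c (\<lambda>y. g y $ i $ j) x = pd c (\<lambda>y. g y $ j $ i) x" for c i j
    by (rule pd_cong_open[OF A]) (rule gram_ok_sym[OF ok])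
  have symG: "matrix_inv (g x) $ i $ j = matrix_inv (g x) $ j $ i" for i j
    using matrix_inv_symmetric ok A by blast
  have "(\<Sum>b\<in>UNIV. christoffel g i a b x * matrix_inv (g x) $ b $ j)
    + (\<Sum>b\<in>UNIV. christoffel g j a b x * matrix_inv (g x) $ i $ b)
    = (\<Sum>k\<in>UNIV. \<Sum>m\<in>UNIV. matrix_inv (g x) $ i $ k * pd a (\<lambda>y. g y $ k $ m) x * matrix_inv (g x) $ m $ j)"
    unfolding christoffel_def
    by (rule christoffel_cancel[of "\<lambda>i j. matrix_inv (g x) $ i $ j" "\<lambda>c i j. pd c (\<lambda>y. g y $ i $ j) x"])
      (rule symG, rule symg)
  then show ?thesis
    using pd_matrix_inv[of A x g a i j, OF A smooth gram_ok_invertible[OF ok]] by simp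
qed

lemma sum_lists_2: "(\<Sum>as\<in>{as::2 list. length as = 2}. h as) = (\<Sum>a\<in>UNIV. \<Sum>b\<in>UNIV. h [a, b])"
proof -
  have "{as::2 list. length as = 2} = (\<lambda>(a, b). [a, b]) ` UNIV"
    by (auto simp: numeral_2_eq_2 length_Suc_conv image_iff)
  moreover have "inj (\<lambda>(a::2, b). [a, b])" by (auto simp: inj_def)
  ultimately have "(\<Sum>as\<in>{as::2 list. length as = 2}. h as) = (\<Sum>(a, b)\<in>UNIV. h [a, b])"
    by (simp add: sum.reindex inj_on_def case_prod_unfold)
  then show ?thesis by (simp add: sum.cartesian_product UNIV_Times_UNIV[symmetric] del: UNIV_Times_UNIV)
qed

lemma lessThan_2: "{..<2::nat} = {0, 1}"
  by auto

lemma riemannian_chart: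
  assumes S: "riemannian_surface S" and c: "c \<in> charts S"
  shows "open (snd c ` fst c)" "q \<in> fst c \<Longrightarrow> chart_inv c (snd c q) = q"
    "smooth_on (snd c ` fst c) (\<lambda>x. metric S c x $ a $ b)"
    "x \<in> snd c ` fst c \<Longrightarrow> gram_ok (metric S c x)"
  using S c unfolding riemannian_surface_def smooth_atlas_def homeomorphism_def gram_ok_def by auto

lemma riemannian_metric_transition:
  assumes S: "riemannian_surface S" and c: "c \<in> charts S" "d \<in> charts S" and q: "q \<in> fst c \<inter> fst d"
  defines "J \<equiv> jacobian (transition c d) (snd c q)"
  shows "metric S c (snd c q) = transpose J ** metric S d (snd d q) ** J"
proof -
  have "transition c d (snd c q) = snd d q"
    using riemannian_chart(2)[OF S c(1), of q] q by (simp add: transition_def)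
  then show ?thesis
    using S c q unfolding riemannian_surface_def J_def Let_def by (metis (no_types, lifting) imageI)
qed

definition metric_section :: "('m, 'z) surface_scheme \<Rightarrow> 'm chart \<Rightarrow> 2 list \<Rightarrow> real^2 \<Rightarrow> complex" where
  "metric_section S c as x = complex_of_real (matrix_inv (metric S c x) $ (as ! 0) $ (as ! 1))"

lemma matrix_inv_transition:
  fixes g h J :: "real^2^2"
  assumes "gram_ok g" "gram_ok h" "g = transpose J ** h ** J"
  shows "matrix_inv h = J ** matrix_inv g ** transpose J"
proof -
  have "(matrix_inv g ** transpose J ** h) ** J = mat 1"
    using matrix_inv_cancel(2)[OF gram_ok_invertible[OF assms(1)]] assms(3) by (simp add: matrix_mul_assoc)
  then have "J ** (matrix_inv g ** transpose J ** h) = mat 1"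
    by (rule iffD1[OF matrix_left_right_inverse])
  then have "(J ** matrix_inv g ** transpose J) ** h = mat 1" by (simp add: matrix_mul_assoc)
  then show ?thesis
    by (metis matrix_inv_cancel(1) gram_ok_invertible assms(2) matrix_mul_assoc matrix_mul_lid matrix_mul_rid)
qed

lemma parallel_metric_section:
  assumes S: "riemannian_surface S"
  shows "parallel_section S 2 (metric_section S)"
  unfolding parallel_section_def
proof (intro conjI ballI allI impI)
  fix c as assume c: "c \<in> charts S"
  note ch = riemannian_chart[OF S c]
  obtain h where "h \<in> smooth_alg (snd c ` fst c)"
    "\<forall>x\<in>snd c ` fst c. matrix_inv (metric S c x) $ (as ! 0) $ (as ! 1) = h x"
    using smooth_alg_matrix_inv[of "snd c ` fst c" "metric S c", OF ch(3) gram_ok_invertible[OF ch(4)]] by metis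
  then show "smooth_on (snd c ` fst c) (metric_section S c as)"
    by (intro smooth_on_cong_open[OF ch(1) _ smooth_alg_smooth_on_of_real[OF ch(1)]])
       (auto simp: metric_section_def)
next
  fix c d q and bs :: "2 list" assume c: "c \<in> charts S" "d \<in> charts S" and q: "q \<in> fst c \<inter> fst d" and "length bs = 2"
  let ?J = "jacobian (transition c d) (snd c q)"
  have "matrix_inv (metric S d (snd d q)) = ?J ** matrix_inv (metric S c (snd c q)) ** transpose ?J"
    using q by (intro matrix_inv_transition riemannian_chart(4)[OF S] c riemannian_metric_transition[OF S c]) auto
  then have "metric_section S d bs (snd d q) = complex_of_real
     ((?J ** matrix_inv (metric S c (snd c q)) ** transpose ?J) $ (bs ! 0) $ (bs ! 1))"
    by (simp add: metric_section_def)
  also have "\<dots> = (\<Sum>a\<in>UNIV. \<Sum>b\<in>UNIV. complex_of_real (?J $ (bs ! 0) $ a) * complex_of_real (?J $ (bs ! 1) $ b)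
       * metric_section S c [a, b] (snd c q))"
    by (simp add: matrix_matrix_mult_def transpose_def sum_2 metric_section_def algebra_simps)
  finally show "metric_section S d bs (snd d q) = (\<Sum>as\<in>{as. length as = 2}.
          (\<Prod>j<2. complex_of_real (?J $ (bs ! j) $ (as ! j))) * metric_section S c as (snd c q))"
    by (simp add: sum_lists_2 lessThan_2 mult_ac)
next
  fix c x a and as :: "2 list" assume c: "c \<in> charts S" and x: "x \<in> snd c ` fst c" and "length as = 2"
  then obtain i j where as: "as = [i, j]" by (auto simp: numeral_2_eq_2 length_Suc_conv)
  note ch = riemannian_chart[OF S c]
  have diff: "(\<lambda>y. matrix_inv (metric S c y) $ i $ j) differentiable (at x)"
  proof -
    obtain h where h: "h \<in> smooth_alg (snd c ` fst c)"
      "\<forall>x\<in>snd c ` fst c. matrix_inv (metric S c x) $ i $ j = h x"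
      using smooth_alg_matrix_inv[of "snd c ` fst c" "metric S c", OF ch(3) gram_ok_invertible[OF ch(4)]] by metis
    show ?thesis
      by (rule differentiable_cong_open[OF ch(1) x bspec[OF h(2)] smooth_alg_differentiable[OF h(1) x]])
  qed
  have "pd a (metric_section S c as) x = complex_of_real (pd a (\<lambda>y. matrix_inv (metric S c y) $ i $ j) x)"
    using pd_linear[OF diff bounded_linear_of_real, of a] by (simp add: metric_section_def[abs_def] as)
  also have "\<dots> = complex_of_real (- ((\<Sum>b\<in>UNIV. christoffel (metric S c) i a b x * matrix_inv (metric S c x) $ b $ j)
    + (\<Sum>b\<in>UNIV. christoffel (metric S c) j a b x * matrix_inv (metric S c x) $ i $ b)))"
    using matrix_inv_parallel[OF ch(1) x, of "metric S c" a i j, OF ch(3,4)]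
    unfolding eq_neg_iff_add_eq_0[symmetric] by (rule arg_cong)
  finally show "pd a (metric_section S c as) x + (\<Sum>j<2. \<Sum>b\<in>UNIV.
          complex_of_real (christoffel (metric S c) (as ! j) a b x) * metric_section S c (as[j := b]) x) = 0"
    by (simp add: as lessThan_2 metric_section_def)
qed

text \<open>For an orthonormal frame the inverse metric is the tensor \<open>e1 e1 + e2 e2\<close>,
  and \<open>h+ h- + h- h+\<close> is twice that; hence the coefficients 1/2.\<close>

lemma evaluates_metric_section:
  assumes S: "riemannian_surface S" and fr: "orthonormal_frame S"
  shows "evaluates_to S 2 (metric_section S)
    (Poly_Mapping.single [True, False] (1/2) + Poly_Mapping.single [False, True] (1/2))"
proof -
  let ?c = "basechart S"
  let ?g = "metric S ?c (snd ?c (basept S))"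
  have c: "?c \<in> charts S" "basept S \<in> fst ?c" and on: "frame1 S \<bullet> (?g *v frame1 S) = 1"
    "frame2 S \<bullet> (?g *v frame2 S) = 1" "frame1 S \<bullet> (?g *v frame2 S) = 0"
    using fr by (auto simp: orthonormal_frame_def Let_def)
  have ok: "gram_ok ?g" using riemannian_chart(4)[OF S c(1)] c(2) by blast
  then have sym: "?g $ 2 $ 1 = ?g $ 1 $ 2" by (rule gram_ok_sym)
  \<comment> \<open>The columns of \<open>F\<close> are the frame vectors. Orthonormality says that
    \<open>F\<close> transforms the metric into the identity, so the inverse metric is
    \<open>F\<close> times its transpose.\<close>
  define F :: "real^2^2" where "F = (\<chi> i k. if k = 1 then frame1 S $ i else frame2 S $ i)"
  have "(transpose F ** g) ** F = mat 1" if "frame1 S \<bullet> (g *v frame1 S) = 1"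
    "frame2 S \<bullet> (g *v frame2 S) = 1" "frame1 S \<bullet> (g *v frame2 S) = 0" "g $ 2 $ 1 = g $ 1 $ 2" for g :: "real^2^2"
    using that by (simp add: vec_eq_iff forall_2 F_def transpose_def matrix_matrix_mult_def sum_2 mat_def
        inner_vec_def matrix_vector_mult_def algebra_simps)
  from this[OF on sym] have "(transpose F ** ?g) ** F = mat 1" .
  then have "F ** (transpose F ** ?g) = mat 1" by (rule iffD1[OF matrix_left_right_inverse])
  then have "(F ** transpose F) ** (?g ** matrix_inv ?g) = matrix_inv ?g"
    by (simp add: matrix_mul_assoc)
  then have "matrix_inv ?g = F ** transpose F"
    by (simp add: matrix_inv_cancel(1)[OF gram_ok_invertible[OF ok]])
  then have inv: "matrix_inv ?g $ a $ b = frame1 S $ a * frame1 S $ b + frame2 S $ a * frame2 S $ b" for a b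
    by (simp add: F_def transpose_def matrix_matrix_mult_def sum_2)
  show ?thesis
    unfolding evaluates_to_def
  proof (intro conjI ballI allI impI)
    fix w assume "w \<in> Poly_Mapping.keys (Poly_Mapping.single [True, False] (1/2::complex) + Poly_Mapping.single [False, True] (1/2))"
    then show "length w = 2" using keys_add by fastforce
  next
    fix as :: "2 list" assume "length as = 2"
    show "metric_section S ?c as (snd ?c (basept S)) = lin_ext (\<lambda>w c. c * (\<Prod>j<2. hvec S (w ! j) $ (as ! j)))
       (Poly_Mapping.single [True, False] (1/2) + Poly_Mapping.single [False, True] (1/2))"
      by (simp add: lin_ext_add lin_ext_single distrib_right metric_section_def inv lessThan_2 hvec_def)
         (simp add: field_simps)
  qed
qed

text \<open>The bridge from geometry to algebra: the eigenvalue equation is stated in charts,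
  whereas the modules only see words in \<open>h+\<close>, \<open>h-\<close>. In the quotient by
  \<open>tensor_rel\<close> the symmetrised word acts on \<open>f\<close> as the Laplacian.\<close>

lemma laplacian_tensor_rel:
  fixes S :: "'m::topological_space framed_surface"
  assumes S: "riemannian_surface S" and fr: "orthonormal_frame S" and f: "eigenfunction S U lam f"
  shows "Poly_Mapping.single [True, False] (\<lambda>q. 1/2 * f q) + Poly_Mapping.single [False, True] (\<lambda>q. 1/2 * f q)
     - Poly_Mapping.single [] (\<lambda>q. - lam * f q) \<in> tensor_rel S U"
proof -
  have f0: "f q = 0" if "q \<notin> U" for q using f that by (auto simp: eigenfunction_def Cinf_def)
  have "par_act S U 2 (metric_section S) f = (\<lambda>q. - lam * f q)"
  proof
    fix q
    show "par_act S U 2 (metric_section S) f q = - lam * f q"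
    proof (cases "q \<in> U")
      case True
      \<comment> \<open>\<open>par_act\<close> evaluates in a chosen chart, and the eigenvalue
        equation is available in every chart around the point.\<close>
      define c where "c = (SOME c. c \<in> charts S \<and> q \<in> fst c)"
      have "\<exists>c. c \<in> charts S \<and> q \<in> fst c"
        using S unfolding riemannian_surface_def smooth_atlas_def by blast
      then have c: "c \<in> charts S \<and> q \<in> fst c" unfolding c_def by (rule someI_ex)
      have "par_act S U 2 (metric_section S) f q = laplacian S c f (snd c q)"
        using True by (simp add: par_act_def c_def Let_def sum_lists_2 laplacian_def metric_section_def mult_ac)
      also have "\<dots> = - lam * f q" using f c True unfolding eigenfunction_def
        by (metis IntI minus_minus mult_minus_left)
      finally show ?thesis .
    qed (simp add: par_act_def f0)
  qed
  then have *: "Poly_Mapping.single [True, False] (\<lambda>q. 1/2 * f q) + Poly_Mapping.single [False, True] (\<lambda>q. 1/2 * f q)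
     - Poly_Mapping.single [] (\<lambda>q. - lam * f q) = lin_ext (\<lambda>w c. Poly_Mapping.single ([] @ w) (\<lambda>q. c * f q))
        (Poly_Mapping.single [True, False] (1/2) + Poly_Mapping.single [False, True] (1/2))
        - Poly_Mapping.single [] (par_act S U 2 (metric_section S) f)"
    by (subst lin_ext_add)
       (simp_all add: lin_ext_single distrib_right zero_fun_def[symmetric] plus_fun_def single_add[symmetric])
  interpret vector_space "tfun_scale :: complex \<Rightarrow> 'm tfun \<Rightarrow> 'm tfun"
    by (intro vector_space_pm_scale, unfold_locales) (auto simp: fun_eq_iff algebra_simps)
  show ?thesis
    unfolding tensor_rel_def *
    by (rule span_base)
       (use parallel_metric_section[OF S] evaluates_metric_section[OF S fr] f in
         \<open>unfold eigenfunction_def, blast\<close>)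
qed

section \<open>Modes on Fock spaces\<close>

definition remove_at :: "nat \<Rightarrow> 'a list \<Rightarrow> 'a list" where
  "remove_at p w = take p w @ drop (Suc p) w"

lemma remove_at_Cons [simp]: "remove_at 0 (a # w) = w" "remove_at (Suc p) (a # w) = a # remove_at p w"
  by (simp_all add: remove_at_def)

lemma in_set_remove_at: "a \<in> set (remove_at p w) \<Longrightarrow> a \<in> set w"
  unfolding remove_at_def using set_take_subset[of p w] set_drop_subset[of "Suc p" w] by auto

text \<open>Two instances are used: \<open>V\<close> with the zero action on the complex numbers,
  and \<open>T\<close> with tensors over functions, on which letters act by prepending. The tensor
  algebra is free, so no relation between the two operators \<open>e i\<close> is imposed.\<close>

locale fock_module =
  fixes sc :: "complex \<Rightarrow> 's \<Rightarrow> 's::ab_group_add" and e :: "bool \<Rightarrow> 's \<Rightarrow> 's" and l :: complex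
  assumes vector_space_sc: "vector_space sc"
    and e_add: "e i (s + t) = e i s + e i t" and e_sc: "e i (sc c s) = sc c (e i s)"
begin

sublocale S: vector_space sc by (rule vector_space_sc)

sublocale F: vector_space "pm_scale sc :: complex \<Rightarrow> (fword \<Rightarrow>\<^sub>0 's) \<Rightarrow> (fword \<Rightarrow>\<^sub>0 's)"
  by (rule vector_space_pm_scale[OF vector_space_sc])

lemma e_0: "e i 0 = 0"
  using e_add[of i 0 0] by simp

lemma create_single [simp]: "create a (Poly_Mapping.single w s) = Poly_Mapping.single (a # w) s"
  for s :: 's
  by (simp add: create_def lin_ext_single)

lemma create_add: "create a (x + y) = create a x + create a y" for x y :: "fword \<Rightarrow>\<^sub>0 's"
  unfolding create_def by (rule lin_ext_add) (simp_all add: single_add)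

lemma create_0 [simp]: "create a (0 :: fword \<Rightarrow>\<^sub>0 's) = 0"
  by (simp add: create_def)

lemma create_sum: "create a (\<Sum>i\<in>I. x i) = (\<Sum>i\<in>I. create a (x i))" for x :: "'i \<Rightarrow> fword \<Rightarrow>\<^sub>0 's"
  by (induction I rule: infinite_finite_induct) (simp_all add: create_add)

lemma scale_single [simp]: "pm_scale sc c (Poly_Mapping.single w s) = Poly_Mapping.single w (sc c s)"
  by (rule pm_scale_single) simp

lemma create_scale: "create a (pm_scale sc c x) = pm_scale sc c (create a x)"
  unfolding create_def by (rule lin_ext_pm_scale) (simp_all add: F.scale_right_distrib)

lemma annihilate_word_eq:
  "annihilate_word sc l i m w s = (\<Sum>p<length w. if snd (w ! p) = m then
     Poly_Mapping.single (remove_at p w) (sc (of_nat m * hpair i (fst (w ! p)) * l) s) else 0)"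
proof (induction w)
  case (Cons b w)
  show ?case
    unfolding length_Cons sum.lessThan_Suc_shift
    by (cases b) (simp add: Cons.IH create_sum if_distrib[of "create _"] cong: if_cong)
qed simp

lemma annihilate_word_0 [simp]: "annihilate_word sc l i m w 0 = 0"
  by (auto simp: annihilate_word_eq intro!: sum.neutral)

lemma annihilate_word_add: "annihilate_word sc l i m w (s + t) = annihilate_word sc l i m w s + annihilate_word sc l i m w t"
  by (simp add: annihilate_word_eq sum.distrib[symmetric] S.scale_right_distrib single_add if_distrib cong: if_cong)

lemma annihilate_word_scale: "annihilate_word sc l i m w (sc c s) = pm_scale sc c (annihilate_word sc l i m w s)"
  by (simp add: annihilate_word_eq F.scale_sum_right if_distrib[of "pm_scale sc c"] mult_ac cong: if_cong)

lemma mode_add: "mode sc e l a (x + y) = mode sc e l a x + mode sc e l a y"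
  by (cases a) (simp add: mode_def create_add lin_ext_add e_0 e_add single_add annihilate_word_add)

lemma mode_0 [simp]: "mode sc e l a 0 = 0"
  by (cases a) (simp add: mode_def e_0)

lemma mode_sum: "mode sc e l a (\<Sum>i\<in>I. x i) = (\<Sum>i\<in>I. mode sc e l a (x i))"
  by (induction I rule: infinite_finite_induct) (simp_all add: mode_add)

lemma mode_scale: "mode sc e l a (pm_scale sc c x) = pm_scale sc c (mode sc e l a x)"
proof (cases a)
  case (Pair i n)
  consider "n < 0" | "n = 0" | "n > 0" by linarith
  then show ?thesis
  proof cases
    case 1 then show ?thesis by (simp add: Pair mode_def create_scale)
  next
    case 2
    have "lin_ext (\<lambda>w s. Poly_Mapping.single w (e i s)) (pm_scale sc c x) = pm_scale sc c (lin_ext (\<lambda>w s. Poly_Mapping.single w (e i s)) x)"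
      by (rule lin_ext_pm_scale) (simp_all add: F.scale_right_distrib e_sc e_0)
    then show ?thesis by (simp add: Pair mode_def 2)
  next
    case 3
    have "lin_ext (annihilate_word sc l i (nat n)) (pm_scale sc c x) = pm_scale sc c (lin_ext (annihilate_word sc l i (nat n)) x)"
      by (rule lin_ext_pm_scale) (simp_all add: F.scale_right_distrib annihilate_word_scale)
    then show ?thesis using 3 by (simp add: Pair mode_def)
  qed
qed

abbreviation modes :: "(bool \<times> int) list \<Rightarrow> (fword \<Rightarrow>\<^sub>0 's) \<Rightarrow> fword \<Rightarrow>\<^sub>0 's" where
  "modes \<equiv> foldr (mode sc e l)"

lemma modes_add: "modes as (x + y) = modes as x + modes as y"
  by (induction as) (simp_all add: mode_add)

lemma modes_0 [simp]: "modes as 0 = 0"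
  by (induction as) simp_all

lemma modes_scale: "modes as (pm_scale sc c x) = pm_scale sc c (modes as x)"
  by (induction as) (simp_all add: mode_scale)

text \<open>A bound on the letters of \<open>x\<close> bounds the modes that do not kill
  \<open>x\<close>, and so makes the sums over mode numbers finite.\<close>

definition letters_le :: "nat \<Rightarrow> (fword \<Rightarrow>\<^sub>0 's) \<Rightarrow> bool" where
  "letters_le B x \<longleftrightarrow> (\<forall>w\<in>Poly_Mapping.keys x. \<forall>a\<in>set w. snd a \<le> B)"

lemma letters_le_mono: "letters_le B x \<Longrightarrow> B \<le> B' \<Longrightarrow> letters_le B' x"
  unfolding letters_le_def by fastforce

lemma letters_le_ex: "\<exists>B. letters_le B x"
proof -
  have "finite (\<Union>w\<in>Poly_Mapping.keys x. snd ` set w)" by simp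
  then show ?thesis unfolding letters_le_def
    by (intro exI[of _ "Max (\<Union>w\<in>Poly_Mapping.keys x. snd ` set w)"]) (auto intro!: Max_ge)
qed

lemma letters_le_0 [simp]: "letters_le B 0"
  by (simp add: letters_le_def)

lemma letters_le_add: "letters_le B x \<Longrightarrow> letters_le B y \<Longrightarrow> letters_le B (x + y)"
  unfolding letters_le_def using keys_add[of x y] by blast

lemma letters_le_sum: "(\<And>i. i \<in> I \<Longrightarrow> letters_le B (x i)) \<Longrightarrow> letters_le B (\<Sum>i\<in>I. x i)"
  by (induction I rule: infinite_finite_induct) (auto intro: letters_le_add)

lemma letters_le_single: "(\<And>a. a \<in> set w \<Longrightarrow> snd a \<le> B) \<Longrightarrow> letters_le B (Poly_Mapping.single w s)"
  by (simp add: letters_le_def)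

lemma mode_nonneg_letters_le:
  assumes "letters_le B x" "n \<ge> 0"
  shows "letters_le B (mode sc e l (i, n) x)"
proof -
  have *: "mode sc e l (i, n) x = (\<Sum>w\<in>Poly_Mapping.keys x. if n = 0 then Poly_Mapping.single w (e i (Poly_Mapping.lookup x w))
    else annihilate_word sc l i (nat n) w (Poly_Mapping.lookup x w))"
    using assms(2) by (simp add: mode_def lin_ext_def)
  show ?thesis
    unfolding * using assms(1) unfolding letters_le_def[of _ x]
    by (intro letters_le_sum)
       (auto simp: annihilate_word_eq intro!: letters_le_sum letters_le_single dest!: in_set_remove_at, fastforce+)
qed

lemma mode_large:
  assumes "letters_le B x" "n > int B"
  shows "mode sc e l (i, n) x = 0"
proof -
  have "annihilate_word sc l i (nat n) w s = 0" if "w \<in> Poly_Mapping.keys x" for w s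
    unfolding annihilate_word_eq
  proof (intro sum.neutral ballI)
    fix p assume "p \<in> {..<length w}"
    then have "snd (w ! p) \<le> B" using assms(1) that unfolding letters_le_def by simp
    then show "(if snd (w ! p) = nat n then Poly_Mapping.single (remove_at p w) (sc (of_nat (nat n) * hpair i (fst (w ! p)) * l) s) else 0) = 0"
      using assms(2) by auto
  qed
  then show ?thesis using assms(2) by (simp add: mode_def lin_ext_def)
qed

lemma modes_nonneg_large:
  assumes "letters_le B x" "\<And>a. a \<in> set as \<Longrightarrow> snd a \<ge> 0"
  shows "letters_le B (modes as x) \<and> ((\<exists>a\<in>set as. snd a > int B) \<longrightarrow> modes as x = 0)"
  using assms(2)
proof (induction as)
  case (Cons a as)
  then show ?case
    using mode_nonneg_letters_le[of B "modes as x" "snd a" "fst a"] mode_large[of B "modes as x" "snd a" "fst a"]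
    by auto
qed (use assms in auto)

text \<open>In normal order the nonnegative modes act first, and they never introduce larger
  letters; so a mode beyond the bound meets no letter that it could remove.\<close>

lemma normal_order_large:
  assumes "letters_le B x" "a \<in> set as" "snd a > int B"
  shows "modes (normal_order as) x = 0"
proof -
  have "modes (filter (\<lambda>(i, n). n > 0) as @ filter (\<lambda>(i, n). n = 0) as) x = 0"
    using assms by (intro modes_nonneg_large[THEN conjunct2, THEN mp, of B]) (auto intro!: bexI[of _ a])
  then show ?thesis unfolding normal_order_def by simp
qed

end

text \<open>The mode numbers that can contribute: the sum is fixed by the weight, and the upper
  bound comes from \<open>letters_le\<close>. Together they also bound the entries from
  below.\<close>

definition mode_tuples :: "nat \<Rightarrow> int \<Rightarrow> int \<Rightarrow> int list set" where
  "mode_tuples n \<sigma> B = {ns. length ns = n \<and> sum_list ns = \<sigma> \<and> (\<forall>k\<in>set ns. k \<le> B)}"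

lemma mode_tuples_0: "mode_tuples 0 \<sigma> B = (if \<sigma> = 0 then {[]} else {})"
  by (auto simp: mode_tuples_def)

lemma sum_list_le: "(\<And>k. k \<in> set ns \<Longrightarrow> k \<le> (B::int)) \<Longrightarrow> sum_list ns \<le> int (length ns) * B"
  by (induction ns) (auto simp: algebra_simps intro!: add_mono)

lemma mode_tuples_empty: "\<sigma> > int n * B \<Longrightarrow> mode_tuples n \<sigma> B = {}"
  using sum_list_le by (force simp: mode_tuples_def)

text \<open>The remaining n entries add up to at most \<open>n * B\<close>, which bounds the first
  one from below. \<open>K\<close> is left free so that the range can be enlarged to suit later
  identities.\<close>

lemma mode_tuples_Suc:
  assumes "K \<ge> int n * B - \<sigma>"
  shows "mode_tuples (Suc n) \<sigma> B = (\<lambda>(k, ns). k # ns) ` (SIGMA k:{-K..B}. mode_tuples n (\<sigma> - k) B)"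
proof (intro equalityI subsetI)
  fix ns assume *: "ns \<in> mode_tuples (Suc n) \<sigma> B"
  then obtain k ms where ns: "ns = k # ms" by (auto simp: mode_tuples_def length_Suc_conv)
  with * have ms: "ms \<in> mode_tuples n (\<sigma> - k) B" "k \<le> B" by (auto simp: mode_tuples_def)
  then have "\<sigma> - k \<le> int n * B" using mode_tuples_empty[of n B "\<sigma> - k"] by (cases "\<sigma> - k \<le> int n * B") auto
  then show "ns \<in> (\<lambda>(k, ns). k # ns) ` (SIGMA k:{-K..B}. mode_tuples n (\<sigma> - k) B)"
    using ms ns assms by (intro image_eqI[of _ _ "(k, ms)"]) auto
qed (auto simp: mode_tuples_def)

lemma finite_mode_tuples [simp]: "finite (mode_tuples n \<sigma> B)"
proof (induction n arbitrary: \<sigma>)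
  case (Suc n)
  show ?case unfolding mode_tuples_Suc[OF order_refl] using Suc by (intro finite_imageI finite_SigmaI) auto
qed (simp add: mode_tuples_0)

lemma sum_mode_tuples_Suc:
  assumes "K \<ge> int n * B - \<sigma>"
  shows "(\<Sum>ns\<in>mode_tuples (Suc n) \<sigma> B. F ns) = (\<Sum>k=-K..B. \<Sum>ns\<in>mode_tuples n (\<sigma> - k) B. F (k # ns))"
  unfolding mode_tuples_Suc[OF assms]
  by (subst sum.reindex) (auto simp: inj_on_def sum.Sigma intro!: sum.cong)

definition mode_coeff :: "fword \<Rightarrow> int list \<Rightarrow> complex" where
  "mode_coeff v ns = (\<Prod>j<length v. (of_int (- (ns ! j) - 1) :: complex) gchoose (snd (v ! j) - 1))"

lemma mode_coeff_Nil [simp]: "mode_coeff [] ns = 1"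
  by (simp add: mode_coeff_def)

lemma mode_coeff_Cons [simp]: "mode_coeff (a # v) (k # ns) = ((of_int (- k - 1) :: complex) gchoose (snd a - 1)) * mode_coeff v ns"
  unfolding mode_coeff_def length_Cons prod.lessThan_Suc_shift by simp

context fock_module
begin

abbreviation op :: "fword \<Rightarrow> int list \<Rightarrow> (fword \<Rightarrow>\<^sub>0 's) \<Rightarrow> fword \<Rightarrow>\<^sub>0 's" where
  "op v ns \<equiv> modes (normal_order (zip (map fst v) ns))"

lemma op_large:
  assumes "letters_le B x" "k \<in> set ns" "k > int B" "length ns = length v"
  shows "op v ns x = 0"
proof -
  obtain j where "j < length ns" "ns ! j = k" using assms(2) by (metis in_set_conv_nth)
  then have "(fst (v ! j), k) \<in> set (zip (map fst v) ns)"
    using assms(4) by (auto simp: in_set_zip intro!: exI[of _ j])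
  then show ?thesis using assms by (intro normal_order_large) auto
qed

lemma word_mode_eq:
  assumes "letters_le B x"
  shows "word_mode sc e l v k x = (\<Sum>ns\<in>mode_tuples (length v) (k + 1 - int (wt v)) (int B).
     pm_scale sc (mode_coeff v ns) (op v ns x))"
proof -
  have "word_mode sc e l v k x = (\<Sum>ns\<in>mode_tuples (length v) (k + 1 - int (wt v)) (int B).
     if length ns = length v \<and> sum_list ns + int (wt v) = k + 1
     then pm_scale sc (mode_coeff v ns) (op v ns x) else 0)"
    unfolding word_mode_def mode_coeff_def[symmetric]
    by (rule Sum_any.expand_superset, rule finite_mode_tuples)
       (auto simp: mode_tuples_def intro: ccontr dest: op_large[OF assms])
  then show ?thesis by (auto simp: mode_tuples_def intro!: sum.cong)
qed

lemma word_mode_add: "word_mode sc e l v k (x + y) = word_mode sc e l v k x + word_mode sc e l v k y"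
proof -
  obtain B1 B2 where "letters_le B1 x" "letters_le B2 y" using letters_le_ex by metis
  then have *: "letters_le (max B1 B2) x" "letters_le (max B1 B2) y" by (auto intro: letters_le_mono)
  then show ?thesis
    by (simp add: word_mode_eq[OF letters_le_add[OF *]] word_mode_eq[OF *(1)] word_mode_eq[OF *(2)]
        modes_add F.scale_right_distrib sum.distrib)
qed

lemma word_mode_scale: "word_mode sc e l v k (pm_scale sc c x) = pm_scale sc c (word_mode sc e l v k x)"
proof -
  obtain B where *: "letters_le B x" using letters_le_ex by metis
  then have "letters_le B (pm_scale sc c x)"
    by (auto simp: letters_le_def in_keys_iff lookup_pm_scale)
  then show ?thesis
    by (simp add: word_mode_eq[of B] * modes_scale F.scale_sum_right mult.commute)
qed

lemma word_mode_0 [simp]: "word_mode sc e l v k 0 = 0"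
  using word_mode_add[of v k 0 0] by simp

lemma fock_vop_add: "fock_vop sc e l v k (x + y) = fock_vop sc e l v k x + fock_vop sc e l v k y"
  by (simp add: fock_vop_def lin_ext_def word_mode_add F.scale_right_distrib sum.distrib)

lemma fock_vop_single: "fock_vop sc e l (Poly_Mapping.single v 1) k x = word_mode sc e l v k x"
  by (simp add: fock_vop_def lin_ext_def)

lemma word_mode_Nil: "word_mode sc e l [] k x = (if k = -1 then x else 0)"
proof -
  obtain B where *: "letters_le B x" using letters_le_ex by metis
  show ?thesis by (simp add: word_mode_eq[OF *] mode_tuples_0 wt_def normal_order_def)
qed

end

section \<open>Zero modes and matchings\<close>

text \<open>The coefficient of t^i in (1+t)^z, for every integer i.\<close>

definition ibinom :: "complex \<Rightarrow> int \<Rightarrow> complex" where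
  "ibinom z i = (if i < 0 then 0 else z gchoose nat i)"

lemma ibinom_neg [simp]: "i < 0 \<Longrightarrow> ibinom z i = 0"
  by (simp add: ibinom_def)

lemma ibinom_0 [simp]: "ibinom 0 i = (if i = 0 then 1 else 0)"
  by (auto simp: ibinom_def gbinomial_0_left)

lemma ibinom_Vandermonde:
  assumes "i \<le> int n"
  shows "(\<Sum>k\<le>n. (x gchoose k) * ibinom y (i - int k)) = ibinom (x + y) i"
proof (cases "i < 0")
  case False
  then obtain m where i: "i = int m" by (metis nonneg_int_cases not_less)
  with assms have "m \<le> n" by simp
  have "(\<Sum>k\<le>n. (x gchoose k) * ibinom y (i - int k)) = (\<Sum>k=0..m. (x gchoose k) * (y gchoose (m - k)))"
    using \<open>m \<le> n\<close> by (intro sum.mono_neutral_cong_right) (auto simp: ibinom_def i nat_diff_distrib[symmetric] of_nat_diff[symmetric] simp del: of_nat_diff)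
  also have "\<dots> = ibinom (x + y) i" by (simp add: gbinomial_Vandermonde i ibinom_def)
  finally show ?thesis .
qed (auto simp: ibinom_def)

lemma ibinom_symmetric: "ibinom (of_nat n) (int n - i) = ibinom (of_nat n) i"
proof (cases "i < 0 \<or> i > int n")
  case True
  then show ?thesis by (auto simp: ibinom_def binomial_gbinomial[symmetric])
next
  case False
  then show ?thesis using binomial_symmetric[of "nat i" n]
    by (auto simp: ibinom_def binomial_gbinomial[symmetric] nat_diff_distrib)
qed

text \<open>The coefficient of t^i in (1-t)^(-C). With t = x2/x1 these are the coefficients in the
  expansion of (x1-x2)^(-C) in nonnegative powers of x2.\<close>

definition series_coeff :: "nat \<Rightarrow> int \<Rightarrow> complex" where
  "series_coeff C i = (-1) ^ nat i * ibinom (- of_nat C) i"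

lemma series_coeff_neg [simp]: "i < 0 \<Longrightarrow> series_coeff C i = 0"
  by (simp add: series_coeff_def)

lemma series_coeff_0 [simp]: "series_coeff 0 i = (if i = 0 then 1 else 0)"
  by (simp add: series_coeff_def)

lemma minus_one_power_split:
  "(-1) ^ k * (z * ((-1) ^ nat (i - int k) * ibinom y (i - int k))) = (-1 :: complex) ^ nat i * (z * ibinom y (i - int k))"
proof (cases "int k \<le> i")
  case True
  then have "nat i = k + nat (i - int k)" by linarith
  then have "(-1 :: complex) ^ nat i = (-1) ^ k * (-1) ^ nat (i - int k)" by (metis power_add)
  then show ?thesis by (simp add: mult_ac)
qed simp

lemma series_coeff_add:
  assumes "i \<le> int n"
  shows "(\<Sum>k\<le>n. series_coeff A (int k) * series_coeff B (i - int k)) = series_coeff (A + B) i"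
proof -
  have "(\<Sum>k\<le>n. series_coeff A (int k) * series_coeff B (i - int k))
     = (-1) ^ nat i * (\<Sum>k\<le>n. ((- of_nat A) gchoose k) * ibinom (- of_nat B) (i - int k))"
    unfolding sum_distrib_left minus_one_power_split[symmetric]
    by (intro sum.cong refl) (simp add: series_coeff_def ibinom_def)
  then show ?thesis by (simp add: ibinom_Vandermonde[OF assms] series_coeff_def)
qed

text \<open>Both sides are coefficients of \<open>(x\<^sub>0+x\<^sub>2)\<^sup>N x\<^sub>0\<^bsup>-C\<^esup>\<close>.\<close>

lemma rational_expansion:
  assumes "i \<le> int n"
  shows "(\<Sum>k\<le>n. (of_int (int N - i - int C + int k) gchoose k) * series_coeff C (i - int k)) = ibinom (of_nat N) (int N - i)"
proof -
  have "(of_int (int N - i - int C + int k) :: complex) gchoose k = (-1) ^ k * ((- of_int (int N - i - int C) - 1) gchoose k)" for k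
    by (subst gbinomial_negated_upper) (simp add: algebra_simps)
  then have "(\<Sum>k\<le>n. (of_int (int N - i - int C + int k) gchoose k) * series_coeff C (i - int k))
     = (-1) ^ nat i * (\<Sum>k\<le>n. ((- of_int (int N - i - int C) - 1) gchoose k) * ibinom (- of_nat C) (i - int k))"
    unfolding sum_distrib_left minus_one_power_split[symmetric]
    by (intro sum.cong refl) (simp add: series_coeff_def mult.assoc)
  also have "\<dots> = (-1) ^ nat i * ibinom (of_int (i - int N - 1)) i"
    by (subst ibinom_Vandermonde[OF assms]) (simp add: algebra_simps)
  also have "\<dots> = ibinom (of_nat N) i"
  proof (cases "i < 0")
    case False
    then show ?thesis
      by (simp add: ibinom_def gbinomial_negated_upper[of "of_nat N"] )
  qed simp
  finally show ?thesis by (simp add: ibinom_symmetric)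
qed

definition word_sign :: "fword \<Rightarrow> complex" where
  "word_sign v = (\<Prod>(i, m)\<leftarrow>v. (-1) ^ (m - 1))"

lemma word_sign_Nil [simp]: "word_sign [] = 1"
  and word_sign_Cons [simp]: "word_sign (a # v) = (-1) ^ (snd a - 1) * word_sign v"
  by (simp_all add: word_sign_def case_prod_unfold)

lemma wt_Nil [simp]: "wt [] = 0" and wt_Cons [simp]: "wt (a # v) = snd a + wt v"
  and wt_append: "wt (u @ v) = wt u + wt v"
  by (simp_all add: wt_def)

lemma wt_remove_at: "p < length v \<Longrightarrow> snd (v ! p) + wt (remove_at p v) = wt v"
  unfolding remove_at_def by (subst (3) id_take_nth_drop[of p v]) (simp_all add: wt_append)

text \<open>In the field of the letter \<open>a\<close>, the mode whose index is the weight of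
  \<open>b\<close> removes \<open>b\<close>. This is the resulting scalar, which multiplies x^(-m-p)
  if m and p are the weights of \<open>a\<close> and \<open>b\<close>.\<close>

definition contraction :: "complex \<Rightarrow> bool \<times> nat \<Rightarrow> bool \<times> nat \<Rightarrow> complex" where
  "contraction l a b = (of_int (- int (snd b) - 1) gchoose (snd a - 1)) * of_nat (snd b) * hpair (fst a) (fst b) * l"

locale complex_vector_space = vector_space scl for scl :: "complex \<Rightarrow> 'w::ab_group_add \<Rightarrow> 'w"
begin

text \<open>The zero mode part of \<open>Y(u,x\<^sub>1)Y(v,x\<^sub>2)\<close> is a sum over the partial matchings of letters of \<open>u\<close> with
  letters of \<open>v\<close>. A matching contributes \<open>x\<^sub>1\<^bsup>-A\<^esup>(x\<^sub>1-x\<^sub>2)\<^bsup>-C\<^esup>\<close> times a power of \<open>x\<^sub>2\<close>, where \<open>A\<close> is the weight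
  of the unmatched letters of \<open>u\<close> and \<open>C\<close> the weight of all matched letters; \<open>g A C\<close> is the coefficient
  that is extracted from this function, and \<open>\<theta>\<close> evaluates the word of the unmatched letters.\<close>

fun wick :: "complex \<Rightarrow> fword \<Rightarrow> (bool list \<Rightarrow> 'w) \<Rightarrow> fword \<Rightarrow> (nat \<Rightarrow> nat \<Rightarrow> complex) \<Rightarrow> 'w" where
  "wick l [] \<theta> v g = scl (g 0 0 * word_sign v) (\<theta> (map fst v))"
| "wick l (a # u) \<theta> v g =
     scl ((-1) ^ (snd a - 1)) (wick l u (\<lambda>z. \<theta> (fst a # z)) v (\<lambda>A C. g (A + snd a) C)) +
     (\<Sum>p<length v. scl (contraction l a (v ! p))
        (wick l u \<theta> (remove_at p v) (\<lambda>A C. g A (C + snd a + snd (v ! p)))))"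

text \<open>Every letter of \<open>u\<close> is counted in A if it is unmatched, and otherwise in C
  together with its partner from \<open>v\<close>; so only such pairs (A, C) occur.\<close>

lemma wick_cong:
  assumes "\<And>A C. A \<le> wt u \<Longrightarrow> wt u \<le> A + C \<Longrightarrow> C \<le> wt u + wt v \<Longrightarrow> g A C = g' A C"
  shows "wick l u \<theta> v g = wick l u \<theta> v g'"
  using assms
proof (induction u arbitrary: \<theta> v g g')
  case (Cons a u)
  have "wick l u (\<lambda>z. \<theta> (fst a # z)) v (\<lambda>A C. g (A + snd a) C) = wick l u (\<lambda>z. \<theta> (fst a # z)) v (\<lambda>A C. g' (A + snd a) C)"
    by (intro Cons.IH Cons.prems) auto
  moreover have "wick l u \<theta> (remove_at p v) (\<lambda>A C. g A (C + snd a + snd (v ! p)))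
     = wick l u \<theta> (remove_at p v) (\<lambda>A C. g' A (C + snd a + snd (v ! p)))" if "p < length v" for p
    using wt_remove_at[OF that] by (intro Cons.IH Cons.prems) auto
  ultimately show ?case by simp
qed simp

lemma wick_sum:
  "wick l u \<theta> v (\<lambda>A C. \<Sum>k\<in>I. c k * g k A C) = (\<Sum>k\<in>I. scl (c k) (wick l u \<theta> v (g k)))"
proof (induction u arbitrary: \<theta> v g)
  case (Cons a u)
  show ?case
    by (simp add: Cons.IH scale_sum_right scale_right_distrib sum.distrib mult.commute)
       (rule sum.swap)
qed (simp add: sum_distrib_right scale_sum_left mult.assoc)

text \<open>For \<open>\<theta> = eval_word x\<close> this is the action on \<open>x\<close> of the
  zero mode of a homogeneous vector of charge 0, see \<open>zero_mode_homogeneous\<close>.\<close>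

definition zero_map :: "(bool list \<Rightarrow> 'w) \<Rightarrow> (fword \<Rightarrow>\<^sub>0 complex) \<Rightarrow> 'w" where
  "zero_map \<theta> = lin_ext (\<lambda>w c. scl (c * word_sign w) (\<theta> (map fst w)))"

lemma zero_map_add: "zero_map \<theta> (x + y) = zero_map \<theta> x + zero_map \<theta> y"
  unfolding zero_map_def by (rule lin_ext_add) (simp_all add: algebra_simps)

lemma zero_map_0 [simp]: "zero_map \<theta> 0 = 0"
  by (simp add: zero_map_def)

lemma zero_map_sum: "zero_map \<theta> (\<Sum>i\<in>I. x i) = (\<Sum>i\<in>I. zero_map \<theta> (x i))"
  by (induction I rule: infinite_finite_induct) (simp_all add: zero_map_add)

lemma zero_map_scale: "zero_map \<theta> (pm_scale (*) c x) = scl c (zero_map \<theta> x)"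
  unfolding zero_map_def by (rule lin_ext_pm_scale) (simp_all add: algebra_simps)

lemma zero_map_single: "zero_map \<theta> (Poly_Mapping.single w c) = scl (c * word_sign w) (\<theta> (map fst w))"
  unfolding zero_map_def by (rule lin_ext_single) simp

lemma zero_map_create: "zero_map \<theta> (create a x) = scl ((-1) ^ (snd a - 1)) (zero_map (\<lambda>z. \<theta> (fst a # z)) x)"
proof (induction x rule: pm_induct)
  case (add w s x)
  have "create a (Poly_Mapping.single w s + x) = create a (Poly_Mapping.single w s) + create a x"
    unfolding create_def by (rule lin_ext_add) (simp_all add: single_add)
  then show ?case
    by (simp add: add zero_map_add scale_right_distrib zero_map_single mult_ac)
       (simp add: create_def lin_ext_single zero_map_single mult_ac)
qed (simp add: create_def)

end

section \<open>The vertex operators of V on V itself\<close>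

interpretation V: fock_module "(*)" "\<lambda>i s. 0 :: complex" l for l
  by unfold_locales (simp_all add: algebra_simps)

abbreviation vmode :: "complex \<Rightarrow> bool \<times> int \<Rightarrow> (fword \<Rightarrow>\<^sub>0 complex) \<Rightarrow> fword \<Rightarrow>\<^sub>0 complex" where
  "vmode \<equiv> mode (*) (\<lambda>i s. 0)"

abbreviation vword :: "complex \<Rightarrow> fword \<Rightarrow> int \<Rightarrow> (fword \<Rightarrow>\<^sub>0 complex) \<Rightarrow> fword \<Rightarrow>\<^sub>0 complex" where
  "vword \<equiv> word_mode (*) (\<lambda>i s. 0)"

lemma YV_single: "YV l (Poly_Mapping.single v 1) k x = vword l v k x"
  by (simp add: YV_def V.fock_vop_single)

lemma vmode_zero [simp]: "vmode l (i, 0) x = 0"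
  by (simp add: mode_def)

lemma vmode_neg: "n < 0 \<Longrightarrow> vmode l (i, n) = create (i, nat (- n))"
  by (simp add: mode_def)

lemma vmode_pos_single: "n > 0 \<Longrightarrow> vmode l (i, n) (Poly_Mapping.single w s) = annihilate_word (*) l i (nat n) w s"
  by (simp add: mode_def lin_ext_single)

lemma vmode_pos_create:
  assumes "n > 0"
  shows "vmode l (i, n) (create (j, m) x) = create (j, m) (vmode l (i, n) x)
    + (if nat n = m then pm_scale (*) (of_nat (nat n) * hpair i j * l) x else 0)"
proof (induction x rule: pm_induct)
  case (add w s x)
  then show ?case
    using assms by (auto simp: V.create_add V.mode_add vmode_pos_single V.F.scale_right_distrib V.scale_single)
qed simp

lemma vmode_single_mult: "vmode l a (Poly_Mapping.single w (z * s)) = pm_scale (*) z (vmode l a (Poly_Mapping.single w s))"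
  by (simp flip: V.mode_scale)

lemma vword_single_scale:
  "vword l u n (Poly_Mapping.single w s) = pm_scale (*) s (vword l u n (Poly_Mapping.single w 1))"
  by (simp flip: V.word_mode_scale)

text \<open>Creating modes generate a free algebra and do not commute, but each annihilating mode
  only deletes a letter, and the order of two deletions is irrelevant.\<close>

lemma vmode_pos_commute:
  assumes "m > 0" "n > 0"
  shows "vmode l (i, m) (vmode l (j, n) x) = vmode l (j, n) (vmode l (i, m) x)"
proof -
  have "vmode l (i, m) (vmode l (j, n) (Poly_Mapping.single w s)) = vmode l (j, n) (vmode l (i, m) (Poly_Mapping.single w s))" for w s
  proof (induction w)
    case (Cons a w)
    obtain k p where a: "a = (k, p)" by force
    have e: "Poly_Mapping.single (a # w) s = create (k, p) (Poly_Mapping.single w s)" by (simp add: a)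
    show ?case
      unfolding e using assms Cons.IH by (simp add: vmode_pos_create V.mode_add V.mode_scale vmode_single_mult del: V.create_single)
  qed (use assms in \<open>simp add: vmode_pos_single\<close>)
  then show ?thesis
    by (induction x rule: pm_induct) (simp_all add: V.mode_add)
qed

lemma vmodes_nonneg_commute:
  assumes "k > 0" "\<And>a. a \<in> set as \<Longrightarrow> snd a \<ge> 0"
  shows "foldr (vmode l) as (vmode l (i, k) x) = vmode l (i, k) (foldr (vmode l) as x)"
  using assms(2)
proof (induction as)
  case (Cons a as)
  obtain j n where a: "a = (j, n)" by force
  with Cons.prems[of a] have "n = 0 \<or> n > 0" by auto
  then show ?case using Cons assms(1) by (auto simp: a vmode_pos_commute)
qed simp

text \<open>A creating mode of the first letter stays in front. An annihilating one is moved past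
  the other nonnegative modes to act first, so that a recursion over the word only has to change the
  argument.\<close>

lemma vop_Cons:
  "V.modes l (normal_order ((i, k) # xs)) x = (if k = 0 then 0
     else if k < 0 then create (i, nat (- k)) (V.modes l (normal_order xs) x)
     else V.modes l (normal_order xs) (vmode l (i, k) x))"
proof -
  let ?p = "filter (\<lambda>(i, n). n > 0) xs" and ?z = "filter (\<lambda>(i, n). n = 0) xs"
  consider "k < 0" | "k = 0" | "k > 0" by linarith
  then show ?thesis
  proof cases
    case 1
    then show ?thesis by (simp add: normal_order_def vmode_neg)
  next
    case 2
    then show ?thesis by (simp add: normal_order_def)
  next
    case 3
    have "foldr (vmode l) (?p @ ?z) (vmode l (i, k) x) = vmode l (i, k) (foldr (vmode l) (?p @ ?z) x)"
      by (rule vmodes_nonneg_commute) (use 3 in auto)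
    then show ?thesis using 3 by (simp add: normal_order_def)
  qed
qed

lemma vword_Cons:
  assumes x: "V.letters_le B x" and K: "K \<ge> int (length u) * int B - (n + 1 - int (wt (a # u)))"
  shows "vword l (a # u) n x = (\<Sum>k=-K..int B. if k = 0 then 0 else
     pm_scale (*) ((of_int (- k - 1) :: complex) gchoose (snd a - 1))
       (if k < 0 then create (fst a, nat (- k)) (vword l u (n - k - int (snd a)) x)
        else vword l u (n - k - int (snd a)) (vmode l (fst a, k) x)))"
proof -
  have x': "V.letters_le B (vmode l (i, k) x)" if "k > 0" for i k
    using V.mode_nonneg_letters_le[OF x, of k] that by simp
  have "vword l (a # u) n x = (\<Sum>k=-K..int B. \<Sum>ns\<in>mode_tuples (length u) (n + 1 - int (wt (a # u)) - k) (int B).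
     pm_scale (*) (mode_coeff (a # u) (k # ns)) (V.op l (a # u) (k # ns) x))"
    unfolding V.word_mode_eq[OF x] length_Cons by (rule sum_mode_tuples_Suc) (use K in simp)
  also have "\<dots> = (\<Sum>k=-K..int B. if k = 0 then 0 else
     pm_scale (*) ((of_int (- k - 1) :: complex) gchoose (snd a - 1))
       (if k < 0 then create (fst a, nat (- k)) (vword l u (n - k - int (snd a)) x)
        else vword l u (n - k - int (snd a)) (vmode l (fst a, k) x)))"
  proof (rule sum.cong[OF refl])
    fix k
    have eq: "n + 1 - (int (snd a) + int (wt u)) - k = n - k - int (snd a) + 1 - int (wt u)" by simp
    show "(\<Sum>ns\<in>mode_tuples (length u) (n + 1 - int (wt (a # u)) - k) (int B).
     pm_scale (*) (mode_coeff (a # u) (k # ns)) (V.op l (a # u) (k # ns) x)) = (if k = 0 then 0 else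
     pm_scale (*) ((of_int (- k - 1) :: complex) gchoose (snd a - 1))
       (if k < 0 then create (fst a, nat (- k)) (vword l u (n - k - int (snd a)) x)
        else vword l u (n - k - int (snd a)) (vmode l (fst a, k) x)))"
      by (cases "k = 0"; cases "k < 0")
         (simp_all add: eq vop_Cons V.word_mode_eq[OF x] V.word_mode_eq[OF x'] V.F.scale_sum_right V.create_sum V.create_scale
            del: of_int_minus of_int_diff)
  qed
  finally show ?thesis .
qed

text \<open>After the substitution k = -(j+m) the coefficients of the creating modes, with the sign
  of the created letter, are (-1)^(m-1) times the coefficients of (1+t)^(-m), and multiplying by
  (1+t)^(-A) gives (1+t)^(-A-m).\<close>

lemma creation_coeff_sum:
  assumes m: "m \<ge> 1" and K: "K \<ge> int m" "K \<ge> int m + i"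
  shows "(\<Sum>k=-K..-1. ((of_int (- k - 1) :: complex) gchoose (m - 1)) * (-1) ^ (nat (- k) - 1) * ibinom (- of_nat A) (i + k + int m))
    = (-1) ^ (m - 1) * ibinom (- of_nat (A + m)) i"
proof -
  define J where "J = nat (K - int m)"
  let ?f = "\<lambda>k. ((of_int (- k - 1) :: complex) gchoose (m - 1)) * (-1) ^ (nat (- k) - 1) * ibinom (- of_nat A) (i + k + int m)"
  \<comment> \<open>For -m < k < 0 the binomial coefficient has the upper entry -k-1 < m-1 and
    vanishes.\<close>
  have "(\<Sum>k=-K..-1. ?f k) = (\<Sum>k\<in>(\<lambda>j. - int (j + m)) ` {..J}. ?f k)"
  proof (rule sum.mono_neutral_right)
    show "(\<lambda>j. - int (j + m)) ` {..J} \<subseteq> {-K..-1}" using m K by (auto simp: J_def)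
    show "\<forall>k\<in>{- K..- 1} - (\<lambda>j. - int (j + m)) ` {..J}. ?f k = 0"
    proof
      fix k assume k: "k \<in> {- K..- 1} - (\<lambda>j. - int (j + m)) ` {..J}"
      have "nat (- k) < m"
      proof (rule ccontr)
        assume "\<not> nat (- k) < m"
        then have "k = - int ((nat (- k) - m) + m)" "nat (- k) - m \<in> {..J}" using k by (auto simp: J_def)
        then show False using k by blast
      qed
      then have "(of_int (- k - 1) :: complex) = of_nat (nat (- k) - 1)" "nat (- k) - 1 < m - 1" using k by auto
      then show "?f k = 0" by (metis binomial_gbinomial binomial_eq_0 mult_zero_left of_nat_0)
    qed
  qed simp
  also have "\<dots> = (\<Sum>j\<le>J. ?f (- int (j + m)))"
    by (subst sum.reindex) (auto simp: inj_on_def)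
  also have "\<dots> = (\<Sum>j\<le>J. (-1) ^ (m - 1) * (((- of_nat m) gchoose j) * ibinom (- of_nat A) (i - int j)))"
  proof (rule sum.cong[OF refl])
    fix j
    have "(of_int (int (j + m) - 1) :: complex) = of_nat (j + m - 1)" using m by simp
    moreover have "(j + m - 1) choose (m - 1) = (j + m - 1) choose j"
      using m binomial_symmetric[of j "j + m - 1"] by simp
    ultimately have "(of_int (int (j + m) - 1) :: complex) gchoose (m - 1) = of_nat ((j + m - 1) choose j)"
      by (metis binomial_gbinomial)
    moreover have "(- of_nat m :: complex) gchoose j = (-1) ^ j * of_nat ((j + m - 1) choose j)"
      using m by (simp add: gbinomial_minus binomial_gbinomial add_ac of_nat_diff)
    moreover have "(-1 :: complex) ^ (j + m - 1) = (-1) ^ (m - 1) * (-1) ^ j"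
    proof -
      have "j + m - 1 = (m - 1) + j" using m by simp
      then show ?thesis by (simp only: power_add)
    qed
    ultimately show "?f (- int (j + m)) = (-1) ^ (m - 1) * (((- of_nat m) gchoose j) * ibinom (- of_nat A) (i - int j))"
      by (simp add: mult_ac add.commute nat_add_distrib del: of_int_diff)
  qed
  also have "\<dots> = (-1) ^ (m - 1) * ibinom (- of_nat m + - of_nat A) i"
    using K by (subst ibinom_Vandermonde[symmetric, of i J]) (auto simp: J_def sum_distrib_left)
  finally show ?thesis by (simp add: add.commute)
qed

lemma vmode_pos_single_sum:
  assumes "k > 0"
  shows "vmode l (i, k) (Poly_Mapping.single v 1) = (\<Sum>p<length v. if snd (v ! p) = nat k then
     Poly_Mapping.single (remove_at p v) (of_nat (nat k) * hpair i (fst (v ! p)) * l) else 0)"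
  using assms by (auto simp: vmode_pos_single V.annihilate_word_eq intro!: sum.cong)

context complex_vector_space
begin

text \<open>The binomial coefficient arises by expanding \<open>x\<^sub>1\<^bsup>-A\<^esup>\<close> in powers of \<open>x\<^sub>0 = x\<^sub>1 - x\<^sub>2\<close>.\<close>

theorem zero_map_vword:
  assumes "proper_word u"
  shows "zero_map \<theta> (vword l u n (Poly_Mapping.single v 1)) =
    wick l u \<theta> v (\<lambda>A C. ibinom (- of_nat A) (int C - n - 1))"
  using assms
proof (induction u arbitrary: \<theta> v n)
  case Nil
  show ?case by (simp add: V.word_mode_Nil zero_map_single)
next
  case (Cons a u)
  obtain i m where a: "a = (i, m)" by force
  have m: "m \<ge> 1" and u: "proper_word u" using Cons.prems by (auto simp: a proper_word_def)
  obtain B where B: "V.letters_le B (Poly_Mapping.single v 1)" using V.letters_le_ex by metis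
  \<comment> \<open>\<open>K\<close> only has to be large: it bounds the creating modes in
    \<open>vword_Cons\<close> and satisfies the premises of \<open>creation_coeff_sum\<close> for
    every C up to \<open>wt u + wt v\<close>.\<close>
  define K where "K = \<bar>int (length u) * int B - (n + 1 - int (wt (a # u)))\<bar> + int m + int (wt u) + int (wt v) + \<bar>n\<bar>"
  have K: "K \<ge> int (length u) * int B - (n + 1 - int (wt (a # u)))" "K \<ge> int m"
    "K \<ge> int m + int (wt u) + int (wt v) - n" "K \<ge> 1"
    using m unfolding K_def by linarith+
  define c where "c k = ((of_int (- k - 1) :: complex) gchoose (m - 1))" for k
  let ?x = "Poly_Mapping.single v (1::complex)"
  define F where "F k = (if k = 0 then 0 else
     scl (c k) (zero_map \<theta> (if k < 0 then create (i, nat (- k)) (vword l u (n - k - int m) ?x)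
        else vword l u (n - k - int m) (vmode l (i, k) ?x))))" for k
  have eq: "zero_map \<theta> (vword l (a # u) n ?x) = (\<Sum>k=-K..int B. F k)"
    unfolding vword_Cons[OF B K(1)] zero_map_sum
    by (intro sum.cong refl) (auto simp: F_def c_def a zero_map_scale)
  have split: "{-K..int B} = {-K..-1} \<union> {0} \<union> {1..int B}" using K by auto
  have "(\<Sum>k=-K..int B. F k) = (\<Sum>k=-K..-1. F k) + (\<Sum>k=1..int B. F k)"
    unfolding split by (subst sum.union_disjoint; force?)+ (simp add: F_def)
  moreover have "(\<Sum>k=-K..-1. F k) = scl ((-1) ^ (m - 1)) (wick l u (\<lambda>z. \<theta> (i # z)) v (\<lambda>A C. ibinom (- of_nat (A + m)) (int C - n - 1)))"
  proof -
    have "(\<Sum>k=-K..-1. F k) = (\<Sum>k=-K..-1. scl (c k * (-1) ^ (nat (- k) - 1))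
       (wick l u (\<lambda>z. \<theta> (i # z)) v (\<lambda>A C. ibinom (- of_nat A) (int C - (n - k - int m) - 1))))"
      by (intro sum.cong refl) (simp add: F_def zero_map_create Cons.IH[OF u])
    also have "\<dots> = wick l u (\<lambda>z. \<theta> (i # z)) v (\<lambda>A C. \<Sum>k=-K..-1. (c k * (-1) ^ (nat (- k) - 1)) * ibinom (- of_nat A) (int C - (n - k - int m) - 1))"
      by (rule wick_sum[symmetric])
    \<comment> \<open>The sum over a single index is there to let \<open>wick_sum\<close> pull the
      sign out of \<open>wick\<close>.\<close>
    also have "\<dots> = wick l u (\<lambda>z. \<theta> (i # z)) v (\<lambda>A C. \<Sum>k\<in>{0::nat}. (-1) ^ (m - 1) * ibinom (- of_nat (A + m)) (int C - n - 1))"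
    proof (rule wick_cong)
      fix A C assume "C \<le> wt u + wt v"
      then have "K \<ge> int m + (int C - n - 1)" using K by linarith
      then show "(\<Sum>k=-K..-1. (c k * (-1) ^ (nat (- k) - 1)) * ibinom (- of_nat A) (int C - (n - k - int m) - 1)) =
        (\<Sum>k\<in>{0::nat}. (-1) ^ (m - 1) * ibinom (- of_nat (A + m)) (int C - n - 1))"
        using creation_coeff_sum[OF m K(2), of "int C - n - 1" A] by (simp add: c_def algebra_simps)
    qed
    also have "\<dots> = scl ((-1) ^ (m - 1)) (wick l u (\<lambda>z. \<theta> (i # z)) v (\<lambda>A C. ibinom (- of_nat (A + m)) (int C - n - 1)))"
      by (subst wick_sum) simp
    finally show ?thesis .
  qed
  moreover have "(\<Sum>k=1..int B. F k) = (\<Sum>p<length v. scl (contraction l a (v ! p))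
        (wick l u \<theta> (remove_at p v) (\<lambda>A C. ibinom (- of_nat A) (int (C + m + snd (v ! p)) - n - 1))))"
  proof -
    \<comment> \<open>The share of the annihilating mode of index \<open>k\<close> that removes the
      letter at position \<open>p\<close>. It occurs only if \<open>k\<close> is the weight of that
      letter, so the sum over \<open>k\<close> collapses.\<close>
    define G where "G k p = scl (c k * (of_nat (nat k) * hpair i (fst (v ! p)) * l))
        (wick l u \<theta> (remove_at p v) (\<lambda>A C. ibinom (- of_nat A) (int C - (n - k - int m) - 1)))" for k p
    have "vword l w q (\<Sum>p\<in>I. f p) = (\<Sum>p\<in>I. vword l w q (f p))" for w q and f :: "nat \<Rightarrow> fword \<Rightarrow>\<^sub>0 complex" and I
      by (induction I rule: infinite_finite_induct) (simp_all add: V.word_mode_add)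
    then have "F k = (\<Sum>p<length v. if int (snd (v ! p)) = k then G k p else 0)" if "k \<ge> 1" for k
      using that by (auto simp: F_def G_def vmode_pos_single_sum zero_map_sum scale_sum_right vword_single_scale[of l u _ _ "_ * _"] zero_map_scale Cons.IH[OF u]
        if_distrib[of "vword l u _"] if_distrib[of "zero_map \<theta>"] if_distrib[of "scl _"] intro!: sum.cong)
    then have "(\<Sum>k=1..int B. F k) = (\<Sum>k=1..int B. \<Sum>p<length v. if int (snd (v ! p)) = k then G k p else 0)"
      by (intro sum.cong) auto
    also have "\<dots> = (\<Sum>p<length v. \<Sum>k=1..int B. if int (snd (v ! p)) = k then G k p else 0)" by (rule sum.swap)
    also have "\<dots> = (\<Sum>p<length v. G (int (snd (v ! p))) p)"
    proof (rule sum.cong[OF refl])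
      fix p assume "p \<in> {..<length v}"
      then have "snd (v ! p) \<le> B" using B by (simp add: V.letters_le_def)
      then show "(\<Sum>k=1..int B. if int (snd (v ! p)) = k then G k p else 0) = G (int (snd (v ! p))) p"
        by (auto simp: sum.delta' G_def)
    qed
    also have "\<dots> = (\<Sum>p<length v. scl (contraction l a (v ! p))
        (wick l u \<theta> (remove_at p v) (\<lambda>A C. ibinom (- of_nat A) (int (C + m + snd (v ! p)) - n - 1))))"
      by (intro sum.cong refl) (simp add: G_def c_def contraction_def a algebra_simps)
    finally show ?thesis .
  qed
  ultimately show ?case unfolding eq by (simp add: a)
qed

end

section \<open>Charge and weight of words\<close>

definition charge :: "bool list \<Rightarrow> int" where
  "charge z = (\<Sum>i\<leftarrow>z. if i then 1 else - 1)"

lemma charge_Nil [simp]: "charge [] = 0"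
  and charge_Cons [simp]: "charge (i # z) = (if i then 1 else - 1) + charge z"
  and charge_append [simp]: "charge (y @ z) = charge y + charge z"
  by (simp_all add: charge_def)

lemma charge_replicate [simp]: "charge (replicate n i) = (if i then int n else - int n)"
  by (induction n) auto

lemma balanced_iff_charge: "balanced z \<longleftrightarrow> charge z = 0"
proof -
  have "charge z = int (count_list z True) - int (count_list z False)" by (induction z) auto
  then show ?thesis by (simp add: balanced_def)
qed

definition homogeneous :: "int \<Rightarrow> int \<Rightarrow> (fword \<Rightarrow>\<^sub>0 complex) set" where
  "homogeneous h c = {x. \<forall>w\<in>Poly_Mapping.keys x. proper_word w \<and> int (wt w) = h \<and> charge (map fst w) = c}"

lemma homogeneous_0 [simp]: "0 \<in> homogeneous h c"
  by (simp add: homogeneous_def)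

lemma homogeneous_add: "x \<in> homogeneous h c \<Longrightarrow> y \<in> homogeneous h c \<Longrightarrow> x + y \<in> homogeneous h c"
  unfolding homogeneous_def using keys_add[of x y] by blast

lemma homogeneous_sum: "(\<And>i. i \<in> I \<Longrightarrow> x i \<in> homogeneous h c) \<Longrightarrow> (\<Sum>i\<in>I. x i) \<in> homogeneous h c"
  by (induction I rule: infinite_finite_induct) (auto intro: homogeneous_add)

lemma homogeneous_scale: "x \<in> homogeneous h c \<Longrightarrow> pm_scale (*) z x \<in> homogeneous h c"
  by (auto simp: homogeneous_def in_keys_iff lookup_pm_scale)

lemma homogeneous_vmode:
  assumes "x \<in> homogeneous h c"
  shows "vmode l (i, n) x \<in> homogeneous (h - n) (c + (if i then 1 else - 1))"
proof -
  have *: "vmode l (i, n) (Poly_Mapping.single w s) \<in> homogeneous (h - n) (c + (if i then 1 else - 1))"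
    if w: "proper_word w" "int (wt w) = h" "charge (map fst w) = c" for w s
  proof -
    consider "n < 0" | "n = 0" | "n > 0" by linarith
    then show ?thesis
    proof cases
      case 1
      then show ?thesis using w by (auto simp: vmode_neg homogeneous_def proper_word_def)
    next
      case 3
      have "Poly_Mapping.single (remove_at p w) (of_nat (nat n) * hpair i (fst (w ! p)) * l * s) \<in> homogeneous (h - n) (c + (if i then 1 else - 1))"
        if p: "p < length w" "snd (w ! p) = nat n" for p
      proof (cases "i = fst (w ! p)")
        case False
        have "charge (map fst w) = charge [fst (w ! p)] + charge (map fst (remove_at p w))"
          unfolding remove_at_def by (subst id_take_nth_drop[OF p(1)]) simp
        then have "charge (map fst (remove_at p w)) = c + (if i then 1 else - 1)" using w(3) False by auto
        then show ?thesis using w p wt_remove_at[OF p(1)] 3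
          by (auto simp: homogeneous_def proper_word_def dest!: in_set_remove_at)
      qed (simp add: hpair_def)
      then show ?thesis using 3
        by (auto simp: vmode_pos_single V.annihilate_word_eq intro!: homogeneous_sum)
    qed simp
  qed
  have "vmode l (i, n) x = (\<Sum>w\<in>Poly_Mapping.keys x. vmode l (i, n) (Poly_Mapping.single w (Poly_Mapping.lookup x w)))"
    by (subst (1) poly_mapping_eq_sum) (rule V.mode_sum)
  moreover have "\<dots> \<in> homogeneous (h - n) (c + (if i then 1 else - 1))"
    by (rule homogeneous_sum, rule *) (use assms in \<open>auto simp: homogeneous_def\<close>)
  ultimately show ?thesis by simp
qed

lemma homogeneous_vmodes:
  assumes "x \<in> homogeneous h c"
  shows "V.modes l as x \<in> homogeneous (h - sum_list (map snd as)) (c + charge (map fst as))"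
proof (induction as)
  case (Cons a as)
  then show ?case using homogeneous_vmode[OF Cons, of l "fst a" "snd a"] by (simp add: algebra_simps)
qed (use assms in simp)

lemma sum_list_normal_order:
  fixes f :: "bool \<times> int \<Rightarrow> int"
  shows "sum_list (map f (normal_order xs)) = sum_list (map f xs)"
  unfolding normal_order_def by (induction xs) auto

lemma homogeneous_vword:
  assumes x: "x \<in> homogeneous h c"
  shows "vword l u n x \<in> homogeneous (h + int (wt u) - n - 1) (c + charge (map fst u))"
proof -
  obtain B where B: "V.letters_le B x" using V.letters_le_ex by metis
  have "V.op l u ns x \<in> homogeneous (h + int (wt u) - n - 1) (c + charge (map fst u))"
    if ns: "ns \<in> mode_tuples (length u) (n + 1 - int (wt u)) (int B)" for ns
  proof -
    have "sum_list (map snd (normal_order (zip (map fst u) ns))) = n + 1 - int (wt u)"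
      using ns by (simp add: sum_list_normal_order mode_tuples_def)
    moreover have "charge (map fst (normal_order (zip (map fst u) ns))) = charge (map fst u)"
    proof -
      have *: "charge (map fst xs) = (\<Sum>a\<leftarrow>xs. if fst a then 1 else - 1)" for xs :: "(bool \<times> int) list"
        by (simp add: charge_def comp_def)
      have "map fst (zip (map fst u) ns) = map fst u" using ns by (simp add: mode_tuples_def)
      then show ?thesis by (metis * sum_list_normal_order)
    qed
    moreover have "h - (n + 1 - int (wt u)) = h + int (wt u) - n - 1" by simp
    ultimately show ?thesis
      using homogeneous_vmodes[OF x, of l "normal_order (zip (map fst u) ns)"] by metis
  qed
  then show ?thesis
    unfolding V.word_mode_eq[OF B] by (intro homogeneous_sum homogeneous_scale)
qed

section \<open>Modules over the vertex algebra\<close>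

definition good :: "fword \<Rightarrow> bool" where
  "good u \<longleftrightarrow> proper_word u \<and> balanced (map fst u)"

lemma good_Nil [simp]: "good []"
  by (simp add: good_def proper_word_def balanced_def)

lemma single_in_Vsp: "good u \<Longrightarrow> Poly_Mapping.single u c \<in> Vsp"
  by (simp add: good_def Vsp_def)

lemma Vsp_0 [simp]: "0 \<in> Vsp"
  by (simp add: Vsp_def)

lemma Vsp_add: "x \<in> Vsp \<Longrightarrow> y \<in> Vsp \<Longrightarrow> x + y \<in> Vsp"
  unfolding Vsp_def using keys_add[of x y] by blast

lemma Vsp_sum: "(\<And>i. i \<in> I \<Longrightarrow> x i \<in> Vsp) \<Longrightarrow> (\<Sum>i\<in>I. x i) \<in> Vsp"
  by (induction I rule: infinite_finite_induct) (simp_all add: Vsp_add)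

lemma homogeneous_single: "good u \<Longrightarrow> Poly_Mapping.single u c \<in> homogeneous (int (wt u)) 0"
  by (simp add: homogeneous_def good_def balanced_iff_charge)

lemma homogeneous_Vsp: "x \<in> homogeneous h 0 \<Longrightarrow> x \<in> Vsp"
  by (auto simp: homogeneous_def Vsp_def balanced_iff_charge)

lemma vword_homogeneous:
  assumes "good u" "good v"
  shows "vword l u n (Poly_Mapping.single v 1) \<in> homogeneous (int (wt v) + int (wt u) - n - 1) 0"
  using homogeneous_vword[OF homogeneous_single[OF assms(2)], of l u n] assms(1)
  by (simp add: good_def balanced_iff_charge)

locale v_module =
  fixes l :: complex and scl :: "complex \<Rightarrow> 'w \<Rightarrow> 'w::ab_group_add" and gr :: "complex \<Rightarrow> 'w set"
    and Y :: "'w vops" and d D :: "'w \<Rightarrow> 'w"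
  assumes V_module: "V_module l scl gr Y d D"
begin

lemma V_module_facts:
  shows "graded_space scl gr"
    and "\<forall>u\<in>Vsp. \<forall>n. Vector_Spaces.linear scl scl (Y u n)"
    and "\<forall>u\<in>Vsp. \<forall>v\<in>Vsp. \<forall>n w. Y (u + v) n w = Y u n w + Y v n w"
    and "\<forall>u\<in>Vsp. \<forall>c n w. Y (pm_scale (*) c u) n w = scl c (Y u n w)"
    and "Vector_Spaces.linear scl scl d" and "\<forall>m. \<forall>w\<in>gr m. d w = scl m w"
    and "\<exists>N::real. \<forall>m. Re m < N \<longrightarrow> gr m = {0}"
    and "\<forall>u\<in>Vsp. \<forall>n w. d (Y u n w) - Y u n (d w) = Y (dV u) n w + scl (of_int (- n - 1)) (Y u n w)"
    and "\<forall>n w. Y vac n w = (if n = -1 then w else 0)"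
    and "weakly_associative l scl Y"
  using V_module unfolding V_module_def by - (elim conjE; assumption)+

lemma graded_space_facts:
  shows "vector_space scl" and "\<forall>m. module.subspace scl (gr m)" and "module.span scl (\<Union>m. gr m) = UNIV"
    and "\<forall>M u. finite M \<and> (\<forall>m\<in>M. u m \<in> gr m) \<and> (\<Sum>m\<in>M. u m) = 0 \<longrightarrow> (\<forall>m\<in>M. u m = 0)"
  using V_module_facts(1) unfolding graded_space_def by - (elim conjE; assumption)+

sublocale complex_vector_space scl
  by (rule complex_vector_space.intro) (rule graded_space_facts(1))

lemma subspace_gr: "subspace (gr m)"
  using graded_space_facts(2) by blast

lemma span_gr: "span (\<Union>m. gr m) = UNIV"
  by (rule graded_space_facts(3))

lemma gr_independent:
  "finite M \<Longrightarrow> (\<And>m. m \<in> M \<Longrightarrow> u m \<in> gr m) \<Longrightarrow> (\<Sum>m\<in>M. u m) = 0 \<Longrightarrow> m \<in> M \<Longrightarrow> u m = 0"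
  using graded_space_facts(4) by blast

lemma Y_add: "u \<in> Vsp \<Longrightarrow> Y u n (x + y) = Y u n x + Y u n y"
  and Y_scale: "u \<in> Vsp \<Longrightarrow> Y u n (scl c x) = scl c (Y u n x)"
proof -
  assume "u \<in> Vsp"
  then have "Vector_Spaces.linear scl scl (Y u n)" using V_module_facts(2) by blast
  then interpret L: Vector_Spaces.linear scl scl "Y u n" .
  show "Y u n (x + y) = Y u n x + Y u n y" "Y u n (scl c x) = scl c (Y u n x)" by (rule L.add, rule L.scale)
qed

lemma Y_0 [simp]: "u \<in> Vsp \<Longrightarrow> Y u n 0 = 0"
  using Y_add[of u n 0 0] by simp

lemma Y_add_left: "u \<in> Vsp \<Longrightarrow> v \<in> Vsp \<Longrightarrow> Y (u + v) n x = Y u n x + Y v n x"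
  using V_module_facts(3) by blast

lemma Y_scale_left: "u \<in> Vsp \<Longrightarrow> Y (pm_scale (*) c u) n x = scl c (Y u n x)"
  using V_module_facts(4) by blast

lemma Y_0_left [simp]: "Y 0 n x = 0"
  using Y_add_left[of 0 0 n x] by simp

lemma Y_sum_left: "(\<And>i. i \<in> I \<Longrightarrow> v i \<in> Vsp) \<Longrightarrow> Y (\<Sum>i\<in>I. v i) n x = (\<Sum>i\<in>I. Y (v i) n x)"
  by (induction I rule: infinite_finite_induct) (simp_all add: Y_add_left Vsp_sum)

abbreviation Yw :: "fword \<Rightarrow> int \<Rightarrow> 'w \<Rightarrow> 'w" where
  "Yw u \<equiv> Y (Poly_Mapping.single u 1)"

lemma Y_single: "good u \<Longrightarrow> Y (Poly_Mapping.single u c) n x = scl c (Yw u n x)"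
  using Y_scale_left[OF single_in_Vsp[of u 1], of c n x] by (simp add: pm_scale_single)

lemma Y_expand:
  assumes "v \<in> Vsp"
  shows "Y v n x = (\<Sum>w\<in>Poly_Mapping.keys v. scl (Poly_Mapping.lookup v w) (Yw w n x))"
proof -
  have *: "good w" if "w \<in> Poly_Mapping.keys v" for w using assms that by (simp add: Vsp_def good_def)
  have "Y v n x = Y (\<Sum>w\<in>Poly_Mapping.keys v. Poly_Mapping.single w (Poly_Mapping.lookup v w)) n x"
    by (rule arg_cong[where f = "\<lambda>z. Y z n x", OF poly_mapping_eq_sum])
  also have "\<dots> = (\<Sum>w\<in>Poly_Mapping.keys v. scl (Poly_Mapping.lookup v w) (Yw w n x))"
    by (subst Y_sum_left) (auto intro!: sum.cong Y_single single_in_Vsp *)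
  finally show ?thesis .
qed

lemma Yw_Nil: "Yw [] n x = (if n = -1 then x else 0)"
  using V_module_facts(9) unfolding vac_def by blast

lemma gr_decomposition: "\<exists>M u. finite M \<and> (\<forall>m\<in>M. u m \<in> gr m) \<and> x = (\<Sum>m\<in>M. u m)"
proof -
  have "x \<in> span (\<Union>m. gr m)" by (simp add: span_gr)
  then show ?thesis
  proof (induction rule: span_induct_alt)
    case base
    show ?case by (rule exI[of _ "{}"]) simp
  next
    case (step c y x)
    from step(1) obtain m where y: "y \<in> gr m" by auto
    from step(2) obtain M u where M: "finite M" "\<forall>m\<in>M. u m \<in> gr m" "x = (\<Sum>m\<in>M. u m)" by auto
    define u' where "u' k = (if k = m then scl c y + (if m \<in> M then u m else 0) else u k)" for k
    have "(\<Sum>k\<in>insert m M. u' k) = u' m + (\<Sum>k\<in>M - {m}. u k)"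
      using M by (simp add: sum.insert_remove u'_def)
    also have "\<dots> = scl c y + x"
      using M by (cases "m \<in> M") (simp_all add: u'_def sum.remove)
    finally show ?case
      using M y by (intro exI[of _ "insert m M"] exI[of _ u'])
        (auto simp: u'_def intro!: subspace_add[OF subspace_gr] subspace_scale[OF subspace_gr] subspace_0[OF subspace_gr])
  qed
qed

lemma d_linear: "d (x + y) = d x + d y" "d (scl c x) = scl c (d x)" "d 0 = 0"
proof -
  have "Vector_Spaces.linear scl scl d" by (rule V_module_facts(5))
  then interpret d: Vector_Spaces.linear scl scl d .
  show "d (x + y) = d x + d y" "d (scl c x) = scl c (d x)" "d 0 = 0" by (rule d.add, rule d.scale, rule d.zero)
qed

lemma d_sum: "d (\<Sum>i\<in>I. x i) = (\<Sum>i\<in>I. d (x i))"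
  by (induction I rule: infinite_finite_induct) (simp_all add: d_linear)

lemma d_gr: "x \<in> gr m \<Longrightarrow> d x = scl m x"
  using V_module_facts(6) by blast

lemma gr_eq_zero:
  assumes "x \<in> gr m" "x \<in> gr m'" "m \<noteq> m'"
  shows "x = 0"
  using d_gr[OF assms(1)] d_gr[OF assms(2)] assms(3) by simp

lemma d_eigen:
  assumes "d x = scl m x"
  shows "x \<in> gr m"
proof -
  obtain M u where M: "finite M" "\<forall>k\<in>M. u k \<in> gr k" and x: "x = (\<Sum>k\<in>M. u k)" using gr_decomposition by blast
  have "(\<Sum>k\<in>M. scl (k - m) (u k)) = d x - scl m x"
    unfolding x d_sum scale_sum_right sum_subtractf[symmetric]
    using M d_gr by (intro sum.cong refl) (metis scale_left_diff_distrib)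
  then have "scl (k - m) (u k) = 0" if "k \<in> M" for k
    using gr_independent[of M "\<lambda>k. scl (k - m) (u k)" k] M that assms by (simp add: subspace_scale[OF subspace_gr])
  then have "u k = 0" if "k \<in> M - {m}" for k using that scale_eq_0_iff by fastforce
  then have "x = (\<Sum>k\<in>M \<inter> {m}. u k)" unfolding x using M by (intro sum.mono_neutral_right) auto
  also have "\<dots> \<in> gr m" using M by (intro subspace_sum[OF subspace_gr]) auto
  finally show ?thesis .
qed

lemma Yw_gr:
  assumes u: "good u" and x: "x \<in> gr m"
  shows "Yw u n x \<in> gr (m + of_nat (wt u) - of_int n - 1)"
proof (rule d_eigen)
  have "d (Yw u n x) - Yw u n (d x) = Y (dV (Poly_Mapping.single u 1)) n x + scl (of_int (- n - 1)) (Yw u n x)"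
    using V_module_facts(8) single_in_Vsp[OF u] by blast
  moreover have "dV (Poly_Mapping.single u 1) = Poly_Mapping.single u (of_nat (wt u))"
    by (simp add: dV_def lin_ext_single)
  ultimately have "d (Yw u n x) = scl m (Yw u n x) + scl (of_nat (wt u)) (Yw u n x) + scl (of_int (- n - 1)) (Yw u n x)"
    by (simp add: Y_single[OF u, of "of_nat (wt u)"] u d_gr[OF x] Y_scale single_in_Vsp algebra_simps)
  then show "d (Yw u n x) = scl (m + of_nat (wt u) - of_int n - 1) (Yw u n x)"
    by (simp add: algebra_simps)
qed

text \<open>The weight of \<open>Yw u n x\<close> depends on \<open>u\<close> and \<open>n\<close>
  only through \<open>wt u - n\<close>, so the lower bound on the weights of the module gives a
  threshold valid for all words at once.\<close>

lemma Yw_truncation: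
  assumes "x \<in> gr m"
  shows "\<exists>T. \<forall>u n. good u \<longrightarrow> n - int (wt u) \<ge> T \<longrightarrow> Yw u n x = 0"
proof -
  obtain N :: real where N: "\<And>m. Re m < N \<Longrightarrow> gr m = {0}" using V_module_facts(7) by blast
  define T where "T = \<lceil>Re m - N\<rceil>"
  have "Yw u n x = 0" if "good u" "n - int (wt u) \<ge> T" for u n
  proof -
    have "of_int (n - int (wt u)) \<ge> Re m - N" using that(2) unfolding T_def by linarith
    then have "Re (m + of_nat (wt u) - of_int n - 1) < N" by simp
    then show ?thesis using N Yw_gr[OF that(1) assms, of n] by blast
  qed
  then show ?thesis by blast
qed

lemma span_homogeneous:
  assumes H: "\<And>h. h \<in> H \<Longrightarrow> \<exists>k. h \<in> gr k" and y: "y \<in> span H" "y \<in> gr m"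
  shows "y \<in> span (H \<inter> gr m)"
proof -
  have "\<exists>M u. finite M \<and> (\<forall>k\<in>M. u k \<in> gr k \<inter> span (H \<inter> gr k)) \<and> y = (\<Sum>k\<in>M. u k)"
    using y(1)
  proof (induction rule: span_induct_alt)
    case base
    show ?case by (rule exI[of _ "{}"]) simp
  next
    case (step c h x)
    from H[OF step(1)] obtain k where h: "h \<in> gr k" by auto
    from step(2) obtain M u where M: "finite M" "\<forall>k\<in>M. u k \<in> gr k \<inter> span (H \<inter> gr k)" "x = (\<Sum>k\<in>M. u k)" by auto
    have h': "h \<in> span (H \<inter> gr k)" using step(1) h by (intro span_base) auto
    define u' where "u' j = (if j = k then scl c h + (if k \<in> M then u k else 0) else u j)" for j
    have "(\<Sum>j\<in>insert k M. u' j) = u' k + (\<Sum>j\<in>M - {k}. u j)"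
      using M by (simp add: sum.insert_remove u'_def)
    also have "\<dots> = scl c h + x"
      using M by (cases "k \<in> M") (simp_all add: u'_def sum.remove)
    finally show ?case
      using M h h' by (intro exI[of _ "insert k M"] exI[of _ u'])
        (auto simp: u'_def intro!: subspace_add[OF subspace_gr] subspace_scale[OF subspace_gr] subspace_0[OF subspace_gr]
          span_add span_scale span_zero)
  qed
  then obtain M u where M: "finite M" "\<forall>k\<in>M. u k \<in> gr k \<inter> span (H \<inter> gr k)" and ysum: "y = (\<Sum>k\<in>M. u k)" by blast
  define u' where "u' k = (if k \<in> M then u k else 0) - (if k = m then y else 0)" for k
  have "(\<Sum>k\<in>insert m M. u' k) = (\<Sum>k\<in>insert m M. if k \<in> M then u k else 0) - (\<Sum>k\<in>insert m M. if k = m then y else 0)"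
    by (simp add: u'_def sum_subtractf)
  also have "(\<Sum>k\<in>insert m M. if k \<in> M then u k else 0) = y"
    unfolding ysum using M by (intro sum.mono_neutral_cong_right) auto
  finally have "(\<Sum>k\<in>insert m M. u' k) = 0" using M by simp
  then have "u' m = 0"
    using M y(2) by (intro gr_independent[of "insert m M" u' m])
      (auto simp: u'_def intro!: subspace_diff[OF subspace_gr] subspace_neg[OF subspace_gr] subspace_0[OF subspace_gr])
  then have "y = (if m \<in> M then u m else 0)" by (simp add: u'_def)
  then show ?thesis using M by (auto intro: span_zero split: if_splits)
qed

end

context v_module
begin

text \<open>Weak associativity for words, with the exponent \<open>q\<close> exposed, since it has
  to be enlarged later.\<close>

definition assoc_at :: "nat \<Rightarrow> fword \<Rightarrow> 'w \<Rightarrow> bool" where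
  "assoc_at q u x \<longleftrightarrow> (\<forall>v. good v \<longrightarrow> (\<forall>a b :: int.
     Sum_any (\<lambda>k::nat. scl (of_int (a + int k) gchoose k) (Yw u (int q - 1 - int k - a) (Yw v (int k - 1 - b) x))) =
     (\<Sum>j\<le>q. scl (of_nat (q choose j)) (Y (vword l u (int j - 1 - a) (Poly_Mapping.single v 1)) (int q - int j - 1 - b) x))))"

lemma assoc_at_ex: "good u \<Longrightarrow> \<exists>q. assoc_at q u x"
  using V_module_facts(10) single_in_Vsp[of _ 1]
  unfolding weakly_associative_def assoc_at_def YV_single[symmetric] by blast

text \<open>A threshold from which every cut-off is correct allows several such sums to be brought
  to a common length.\<close>

lemma Sum_any_truncated:
  assumes x: "x \<in> gr m" and u: "good u" and v: "good v"
  shows "\<exists>K0. \<forall>K\<ge>K0. Sum_any (\<lambda>k::nat. scl (c k) (Yw u (p k) (Yw v (int k - 1 - b) x)))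
     = (\<Sum>k<K. scl (c k) (Yw u (p k) (Yw v (int k - 1 - b) x)))"
proof -
  obtain T where T: "\<And>u n. good u \<Longrightarrow> n - int (wt u) \<ge> T \<Longrightarrow> Yw u n x = 0" using Yw_truncation[OF x] by blast
  have zero: "Yw v (int k - 1 - b) x = 0" if "k \<ge> nat (T + 1 + b + int (wt v))" for k
    using that by (intro T v) linarith
  have "Sum_any (\<lambda>k::nat. scl (c k) (Yw u (p k) (Yw v (int k - 1 - b) x)))
     = (\<Sum>k<K. scl (c k) (Yw u (p k) (Yw v (int k - 1 - b) x)))" if "K \<ge> nat (T + 1 + b + int (wt v))" for K
    using zero that u by (intro Sum_any.expand_superset) (auto simp: single_in_Vsp not_less[symmetric] intro: ccontr)
  then show ?thesis by blast
qed

text \<open>This is multiplication by \<open>x0 + x2\<close>: the new identity at (a, b) is the sum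
  of the old ones at (a-1, b) and (a, b-1), and Pascal's rule combines the coefficients on either
  side.\<close>

lemma assoc_at_Suc:
  assumes x: "x \<in> gr m" and u: "good u" and q: "assoc_at q u x"
  shows "assoc_at (Suc q) u x"
  unfolding assoc_at_def
proof (intro allI impI)
  fix v and a b :: int assume v: "good v"
  define X where "X n k = Yw u n (Yw v k x)" for n k
  define Z where "Z n k = Y (vword l u n (Poly_Mapping.single v 1)) k x" for n k
  define L where "L q a b = Sum_any (\<lambda>k::nat. scl (of_int (a + int k) gchoose k) (X (int q - 1 - int k - a) (int k - 1 - b)))" for q :: nat and a b :: int
  obtain K1 where K1: "\<forall>K\<ge>K1. L q (a - 1) b = (\<Sum>k<K. scl (of_int (a - 1 + int k) gchoose k) (X (int q - 1 - int k - (a - 1)) (int k - 1 - b)))"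
    unfolding L_def X_def using Sum_any_truncated[OF x u v,
      of "\<lambda>k. of_int (a - 1 + int k) gchoose k" "\<lambda>k. int q - 1 - int k - (a - 1)" b] by blast
  obtain K2 where K2: "\<forall>K\<ge>K2. L q a (b - 1) = (\<Sum>k<K. scl (of_int (a + int k) gchoose k) (X (int q - 1 - int k - a) (int k - 1 - (b - 1))))"
    unfolding L_def X_def using Sum_any_truncated[OF x u v,
      of "\<lambda>k. of_int (a + int k) gchoose k" "\<lambda>k. int q - 1 - int k - a" "b - 1"] by blast
  obtain K3 where K3: "\<forall>K\<ge>K3. L (Suc q) a b = (\<Sum>k<K. scl (of_int (a + int k) gchoose k) (X (int (Suc q) - 1 - int k - a) (int k - 1 - b)))"
    unfolding L_def X_def using Sum_any_truncated[OF x u v,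
      of "\<lambda>k. of_int (a + int k) gchoose k" "\<lambda>k. int (Suc q) - 1 - int k - a" b] by blast
  define K where "K = K1 + K2 + K3"
  have "L (Suc q) a b = (\<Sum>k<Suc K. scl (of_int (a + int k) gchoose k) (X (int q - int k - a) (int k - 1 - b)))"
    using K3[rule_format, of "Suc K"] by (simp add: K_def)
  also have "\<dots> = (\<Sum>k<Suc K. scl (of_int (a - 1 + int k) gchoose k) (X (int q - int k - a) (int k - 1 - b)))
     + (\<Sum>k<K. scl (of_int (a + int k) gchoose k) (X (int q - int (Suc k) - a) (int (Suc k) - 1 - b)))"
  proof -
    have pascal: "(of_int (a + int (Suc k)) :: complex) gchoose (Suc k) = (of_int (a + int k) gchoose k) + (of_int (a - 1 + int (Suc k)) gchoose (Suc k))" for k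
      using gbinomial_Suc_Suc[of "of_int (a + int k) :: complex" k] by (simp add: algebra_simps)
    have "(\<Sum>k<Suc K. scl (of_int (a + int k) gchoose k) (X (int q - int k - a) (int k - 1 - b)))
       = X (int q - a) (- 1 - b) + (\<Sum>k<K. scl (of_int (a + int (Suc k)) gchoose (Suc k)) (X (int q - int (Suc k) - a) (int (Suc k) - 1 - b)))"
      by (subst sum.lessThan_Suc_shift) simp
    also have "\<dots> = (X (int q - a) (- 1 - b) + (\<Sum>k<K. scl (of_int (a - 1 + int (Suc k)) gchoose (Suc k)) (X (int q - int (Suc k) - a) (int (Suc k) - 1 - b))))
       + (\<Sum>k<K. scl (of_int (a + int k) gchoose k) (X (int q - int (Suc k) - a) (int (Suc k) - 1 - b)))"
      unfolding pascal scale_left_distrib sum.distrib by (simp add: add_ac)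
    also have "X (int q - a) (- 1 - b) + (\<Sum>k<K. scl (of_int (a - 1 + int (Suc k)) gchoose (Suc k)) (X (int q - int (Suc k) - a) (int (Suc k) - 1 - b)))
       = (\<Sum>k<Suc K. scl (of_int (a - 1 + int k) gchoose k) (X (int q - int k - a) (int k - 1 - b)))"
      by (subst sum.lessThan_Suc_shift) simp
    finally show ?thesis .
  qed
  also have "(\<Sum>k<Suc K. scl (of_int (a - 1 + int k) gchoose k) (X (int q - int k - a) (int k - 1 - b))) = L q (a - 1) b"
    using K1[rule_format, of "Suc K"] by (simp add: K_def algebra_simps)
  also have "(\<Sum>k<K. scl (of_int (a + int k) gchoose k) (X (int q - int (Suc k) - a) (int (Suc k) - 1 - b))) = L q a (b - 1)"
    using K2[rule_format, of "K"] by (simp add: K_def algebra_simps)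
  also have "L q (a - 1) b = (\<Sum>j\<le>q. scl (of_nat (q choose j)) (Z (int j - a) (int q - int j - 1 - b)))"
    using q[unfolded assoc_at_def, rule_format, OF v, of "a - 1" b] by (simp add: L_def X_def Z_def)
  also have "L q a (b - 1) = (\<Sum>j\<le>q. scl (of_nat (q choose j)) (Z (int j - 1 - a) (int q - int j - b)))"
  proof -
    have e: "int q - int j - 1 - (b - 1) = int q - int j - b" for j by simp
    show ?thesis
      using q[unfolded assoc_at_def, rule_format, OF v, of a "b - 1"] unfolding L_def X_def Z_def e .
  qed
  also have "(\<Sum>j\<le>q. scl (of_nat (q choose j)) (Z (int j - a) (int q - int j - 1 - b)))
      + (\<Sum>j\<le>q. scl (of_nat (q choose j)) (Z (int j - 1 - a) (int q - int j - b)))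
      = (\<Sum>j\<le>Suc q. scl (of_nat (Suc q choose j)) (Z (int j - 1 - a) (int (Suc q) - int j - 1 - b)))"
  proof -
    have "(\<Sum>j\<le>Suc q. scl (of_nat (Suc q choose j)) (Z (int j - 1 - a) (int (Suc q) - int j - 1 - b)))
       = Z (- 1 - a) (int q - b) + (\<Sum>j\<le>q. scl (of_nat (q choose Suc j)) (Z (int j - a) (int q - int j - 1 - b)))
        + (\<Sum>j\<le>q. scl (of_nat (q choose j)) (Z (int j - a) (int q - int j - 1 - b)))"
      by (subst sum.atMost_Suc_shift) (simp add: scale_left_distrib sum.distrib add_ac diff_diff_eq)
    also have "Z (- 1 - a) (int q - b) + (\<Sum>j\<le>q. scl (of_nat (q choose Suc j)) (Z (int j - a) (int q - int j - 1 - b)))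
       = (\<Sum>j\<le>Suc q. scl (of_nat (q choose j)) (Z (int j - 1 - a) (int q - int j - b)))"
      by (subst sum.atMost_Suc_shift) (simp add: diff_diff_eq add_ac)
    finally show ?thesis by (simp add: add_ac)
  qed
  finally show "Sum_any (\<lambda>k::nat. scl (of_int (a + int k) gchoose k) (Yw u (int (Suc q) - 1 - int k - a) (Yw v (int k - 1 - b) x))) =
     (\<Sum>j\<le>Suc q. scl (of_nat (Suc q choose j)) (Y (vword l u (int j - 1 - a) (Poly_Mapping.single v 1)) (int (Suc q) - int j - 1 - b) x))"
    by (simp only: L_def X_def Z_def)
qed

lemma assoc_at_large:
  assumes x: "x \<in> gr m" and u: "good u"
  shows "\<exists>q\<ge>q0. assoc_at q u x"
proof -
  obtain q where "assoc_at q u x" using assoc_at_ex[OF u] by blast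
  then have "assoc_at (q + i) u x" for i by (induction i) (simp_all add: assoc_at_Suc[OF x u])
  then show ?thesis by (intro exI[of _ "q + q0"]) simp
qed

definition orbit :: "'w set \<Rightarrow> 'w set" where
  "orbit X = {Yw z k x | z k x. good z \<and> x \<in> X}"

text \<open>A single application of modes is enough, because \<open>Yw_Yw_in_gen\<close> makes this
  span stable. This keeps the elements of a generated submodule explicit.\<close>

definition gen :: "'w set \<Rightarrow> 'w set" where
  "gen X = span (orbit X)"

lemma subspace_add_cancel: "subspace B \<Longrightarrow> x + y \<in> B \<Longrightarrow> y \<in> B \<Longrightarrow> x \<in> B"
  using subspace_diff[of B "x + y" y] by simp

text \<open>Weak associativity expresses the coefficient of \<open>x\<^sub>1\<^sup>\<alpha> x\<^sub>2\<^sup>\<beta>\<close> through those with smaller \<open>\<beta>\<close>.\<close>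

lemma Yw_Yw_in_gen:
  assumes x: "x \<in> gr m" "x \<in> X" and u: "good u" and v: "good v"
  shows "Yw u n (Yw v k x) \<in> gen X"
proof -
  obtain q where q: "assoc_at q u x" using assoc_at_ex[OF u] by blast
  obtain T where T: "\<And>u n. good u \<Longrightarrow> n - int (wt u) \<ge> T \<Longrightarrow> Yw u n x = 0" using Yw_truncation[OF x(1)] by blast
  define T' where "T' = T + int (wt v)"
  have base: "Yw v (- 1 - b) x = 0" if "b < - T'" for b using that by (intro T v) (auto simp: T'_def)
  have in_gen: "Y w n x \<in> gen X" if "w \<in> Vsp" for w n
    unfolding Y_expand[OF that] gen_def orbit_def using that x(2)
    by (intro span_sum span_scale span_base) (auto simp: Vsp_def good_def)
  \<comment> \<open>Here b is written as \<open>int t - T'\<close>. In weak associativity the term k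
    = 0 has coefficient 1, and the term k has b replaced by b - k: it is covered by induction, or it
    vanishes by \<open>base\<close> once b - k drops below \<open>- T'\<close>.\<close>
  have "\<forall>a. Yw u (int q - 1 - a) (Yw v (- 1 - (int t - T')) x) \<in> gen X" for t
  proof (induction t rule: less_induct)
    case (less t)
    show ?case
    proof
      fix a :: int
      let ?b = "int t - T'"
      obtain K where K: "\<forall>K'\<ge>K. Sum_any (\<lambda>k::nat. scl (of_int (a + int k) gchoose k) (Yw u (int q - 1 - int k - a) (Yw v (int k - 1 - ?b) x)))
        = (\<Sum>k<K'. scl (of_int (a + int k) gchoose k) (Yw u (int q - 1 - int k - a) (Yw v (int k - 1 - ?b) x)))"
        using Sum_any_truncated[OF x(1) u v, of "\<lambda>k. of_int (a + int k) gchoose k" "\<lambda>k. int q - 1 - int k - a" ?b] by blast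
      have "Yw u (int q - 1 - a) (Yw v (- 1 - ?b) x) + (\<Sum>k<K. scl (of_int (a + int (Suc k)) gchoose Suc k) (Yw u (int q - 1 - int (Suc k) - a) (Yw v (int (Suc k) - 1 - ?b) x)))
        = (\<Sum>k<Suc K. scl (of_int (a + int k) gchoose k) (Yw u (int q - 1 - int k - a) (Yw v (int k - 1 - ?b) x)))"
        by (subst sum.lessThan_Suc_shift) simp
      also have "\<dots> = (\<Sum>j\<le>q. scl (of_nat (q choose j)) (Y (vword l u (int j - 1 - a) (Poly_Mapping.single v 1)) (int q - int j - 1 - ?b) x))"
        using K[rule_format, of "Suc K"] q[unfolded assoc_at_def, rule_format, OF v, of a ?b] by simp
      also have "\<dots> \<in> gen X"
        using in_gen[OF homogeneous_Vsp[OF vword_homogeneous[OF u v]]] unfolding gen_def by (intro span_sum span_scale)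
      finally have "Yw u (int q - 1 - a) (Yw v (- 1 - ?b) x) + (\<Sum>k<K. scl (of_int (a + int (Suc k)) gchoose Suc k) (Yw u (int q - 1 - int (Suc k) - a) (Yw v (int (Suc k) - 1 - ?b) x))) \<in> gen X" .
      moreover have "(\<Sum>k<K. scl (of_int (a + int (Suc k)) gchoose Suc k) (Yw u (int q - 1 - int (Suc k) - a) (Yw v (int (Suc k) - 1 - ?b) x))) \<in> gen X"
        unfolding gen_def
      proof (intro span_sum span_scale)
        fix k
        show "Yw u (int q - 1 - int (Suc k) - a) (Yw v (int (Suc k) - 1 - ?b) x) \<in> span (orbit X)"
        proof (cases "Suc k \<le> t")
          case True
          then have "t - Suc k < t" by simp
          from less.IH[OF this, rule_format, of "int (Suc k) + a"]
          have "Yw u (int q - 1 - (int (Suc k) + a)) (Yw v (- 1 - (int (t - Suc k) - T')) x) \<in> gen X" .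
          moreover have "- 1 - (int (t - Suc k) - T') = int (Suc k) - 1 - ?b" using True by (simp add: of_nat_diff)
          ultimately show ?thesis by (simp only: gen_def diff_diff_eq add.assoc)
        next
          case False
          then have "Yw v (int (Suc k) - 1 - ?b) x = 0" using base[of "?b - int (Suc k)"] by (simp add: algebra_simps)
          then show ?thesis using u by (simp add: single_in_Vsp span_zero)
        qed
      qed
      ultimately show "Yw u (int q - 1 - a) (Yw v (- 1 - ?b) x) \<in> gen X"
        unfolding gen_def by (rule subspace_add_cancel[OF subspace_span])
    qed
  qed
  note * = this
  show ?thesis
  proof (cases "- 1 - k + T' \<ge> 0")
    case True
    have "int q - 1 - (int q - 1 - n) = n" "- 1 - (int (nat (- 1 - k + T')) - T') = k" using True by simp_all
    then show ?thesis using *[of "nat (- 1 - k + T')"] by metis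
  next
    case False
    then have "Yw v k x = 0" using base[of "- 1 - k"] by simp
    then show ?thesis using u by (simp add: gen_def span_zero single_in_Vsp)
  qed
qed

lemma orbit_homogeneous:
  assumes "\<And>x. x \<in> X \<Longrightarrow> \<exists>m. x \<in> gr m" "y \<in> orbit X"
  shows "\<exists>m. y \<in> gr m"
  using assms Yw_gr unfolding orbit_def by blast

lemma gen_base: "x \<in> X \<Longrightarrow> x \<in> gen X"
proof -
  assume "x \<in> X"
  moreover have "x = Yw [] (-1) x" by (simp add: Yw_Nil)
  ultimately show ?thesis unfolding gen_def orbit_def by (intro span_base) (auto intro!: exI[of _ "[]"] exI[of _ "- 1 :: int"] exI[of _ x])
qed

lemma submodule_gen:
  assumes X: "\<And>x. x \<in> X \<Longrightarrow> \<exists>m. x \<in> gr m"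
  shows "submodule scl gr Y (gen X)"
  unfolding submodule_def
proof (intro conjI ballI allI)
  show "subspace (gen X)" by (simp add: gen_def)
  have "orbit X \<subseteq> (\<Union>m. gen X \<inter> gr m)"
    using orbit_homogeneous[OF X] unfolding gen_def by (auto intro: span_base)
  then show "gen X \<subseteq> span (\<Union>m. gen X \<inter> gr m)" using span_mono unfolding gen_def by blast
next
  fix v n x assume v: "v \<in> Vsp" and x: "x \<in> gen X"
  have *: "Yw w n y \<in> gen X" if w: "good w" and "y \<in> orbit X" for w y
  proof -
    from that(2) obtain z k x where z: "y = Yw z k x" "good z" "x \<in> X" by (auto simp: orbit_def)
    obtain m where "x \<in> gr m" using X[OF z(3)] by blast
    then show ?thesis unfolding z(1) using Yw_Yw_in_gen[of x m X w z] z w by blast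
  qed
  have "Yw w n x \<in> gen X" if w: "good w" for w
    using x unfolding gen_def
  proof (induction rule: span_induct_alt)
    case base
    show ?case using w by (simp add: single_in_Vsp span_zero)
  next
    case (step c y x)
    then show ?case using *[OF w, of y] w
      by (simp add: Y_add Y_scale single_in_Vsp gen_def span_add span_scale)
  qed
  then show "Y v n x \<in> gen X"
    unfolding Y_expand[OF v] gen_def using v by (intro span_sum span_scale) (auto simp: Vsp_def good_def)
qed

lemma submodule_Y: "submodule scl gr Y B \<Longrightarrow> v \<in> Vsp \<Longrightarrow> x \<in> B \<Longrightarrow> Y v n x \<in> B"
  by (simp add: submodule_def)

lemma submodule_subspace: "submodule scl gr Y B \<Longrightarrow> subspace B"
  by (simp add: submodule_def)

lemma gen_subset:
  assumes "submodule scl gr Y B" "X \<subseteq> B"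
  shows "gen X \<subseteq> B"
  unfolding gen_def
  by (rule span_minimal) (use assms in \<open>auto simp: orbit_def single_in_Vsp submodule_Y submodule_subspace\<close>)

end

section \<open>Matrix coefficients on the lowest weight space\<close>

lemma ibinom_Vandermonde_nat:
  "(\<Sum>k\<le>q. of_nat (q choose k) * ibinom y (i - int k)) = ibinom (of_nat q + y) i"
proof -
  have "(\<Sum>k\<le>q. of_nat (q choose k) * ibinom y (i - int k)) = (\<Sum>k\<le>max q (nat i). (of_nat q gchoose k) * ibinom y (i - int k))"
    by (intro sum.mono_neutral_cong_left) (auto simp: binomial_gbinomial[symmetric])
  also have "\<dots> = ibinom (of_nat q + y) i" by (rule ibinom_Vandermonde) linarith
  finally show ?thesis .
qed

section \<open>From rational functions to coefficients of modes\<close>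

definition letter_fun :: "bool \<times> nat \<Rightarrow> bool \<times> (int \<Rightarrow> complex)" where
  "letter_fun a = (fst a, \<lambda>n. of_int (- n - 1) gchoose (snd a - 1))"

lemma fst_letter_fun [simp]: "fst (letter_fun a) = fst a"
  by (simp add: letter_fun_def)

text \<open>Both sides are p times the multinomial coefficient (n+m-1)! / (p! (n-p)!
  (m-1)!).\<close>

lemma choose_identity:
  assumes "m \<ge> 1" "p \<ge> 1" "p \<le> n"
  shows "((n + m - 1) choose (m - 1)) * (n * ((n - 1) choose (p - 1))) = ((p + m - 1) choose (m - 1)) * p * ((m + n - 1) choose (n - p))"
proof -
  define N where "N = n + m - 1"
  have e1: "n * ((n - 1) choose (p - 1)) = p * (n choose p)"
    using assms times_binomial_minus1_eq[of p n] by simp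
  have e2: "N choose (m - 1) = N choose n"
    using assms binomial_symmetric[of n N] by (simp add: N_def)
  have e3: "(N choose n) * (n choose p) = (N choose p) * ((N - p) choose (n - p))"
    using assms by (intro choose_mult) (auto simp: N_def)
  have e4: "(N choose (m + p - 1)) * ((m + p - 1) choose p) = (N choose p) * ((N - p) choose (m - 1))"
    using assms choose_mult[of p "m + p - 1" N] by (auto simp: N_def)
  have e5: "(N - p) choose (m - 1) = (N - p) choose (n - p)"
    using assms binomial_symmetric[of "n - p" "N - p"] by (simp add: N_def)
  have e6: "N choose (n - p) = N choose (m + p - 1)"
    using assms binomial_symmetric[of "n - p" N] by (simp add: N_def)
  have e7: "(p + m - 1) choose (m - 1) = (m + p - 1) choose p"
    using assms binomial_symmetric[of p "m + p - 1"] by (simp add: add.commute)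
  have "(N choose (m - 1)) * (n * ((n - 1) choose (p - 1))) = p * ((N choose n) * (n choose p))"
    by (simp only: e1 e2 mult_ac)
  also have "\<dots> = p * ((N choose (m + p - 1)) * ((m + p - 1) choose p))"
    by (simp only: e3 e4 e5)
  also have "\<dots> = ((p + m - 1) choose (m - 1)) * p * (N choose (n - p))"
    by (simp only: e6 e7 mult_ac)
  finally show ?thesis by (simp only: N_def add.commute[of m n])
qed

lemma gbinomial_neg_of_nat: "(of_int (- int n - 1) :: complex) gchoose k = (-1) ^ k * of_nat ((n + k) choose k)"
proof -
  have 1: "(of_int (- int n - 1) :: complex) = - of_nat (Suc n)" by simp
  have 2: "(of_nat (Suc n) :: complex) + of_nat k - 1 = of_nat (n + k)" by simp
  show ?thesis by (simp only: 1 gbinomial_minus 2 binomial_gbinomial)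
qed

lemma letter_fun_0: "snd (letter_fun a) 0 = (-1) ^ (snd a - 1)"
  using gbinomial_neg_of_nat[of 0 "snd a - 1"] by (simp add: letter_fun_def)

lemma series_coeff_choose: "C \<ge> 1 \<Longrightarrow> series_coeff C (int t) = of_nat ((C + t - 1) choose t)"
  by (simp add: series_coeff_def ibinom_def gbinomial_minus binomial_gbinomial of_nat_diff power_mult_distrib[symmetric] flip: mult.assoc)

text \<open>The contraction of letters of weights m and p is a multiple of (x1-x2)^(-m-p). On the
  left is the share of the mode n of the first letter paired with the mode -n of the second, on the
  right the corresponding term of the expansion of the power.\<close>

lemma contraction_modes:
  assumes "m \<ge> 1" "p \<ge> 1" "n \<ge> 1"
  shows "(of_int (- int n - 1) gchoose (m - 1)) * of_nat n * (of_int (int n - 1) gchoose (p - 1))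
    = (of_int (- int p - 1) gchoose (m - 1)) * of_nat p * series_coeff (m + p) (int n - int p)"
proof -
  have n1: "(of_int (int n - 1) :: complex) = of_nat (n - 1)" using assms by simp
  show ?thesis
  proof (cases "p \<le> n")
    case True
    then have np: "int n - int p = int (n - p)" by simp
    have "m + p + (n - p) - 1 = m + n - 1" "n + (m - 1) = n + m - 1" "p + (m - 1) = p + m - 1" using True assms by auto
    then have "((of_int (- int n - 1) :: complex) gchoose (m - 1)) * of_nat n * (of_int (int n - 1) gchoose (p - 1))
      = (-1) ^ (m - 1) * of_nat (((n + m - 1) choose (m - 1)) * (n * ((n - 1) choose (p - 1))))"
      unfolding n1 gbinomial_neg_of_nat by (simp add: binomial_gbinomial[symmetric] mult_ac)
    also have "\<dots> = (of_int (- int p - 1) gchoose (m - 1)) * of_nat p * series_coeff (m + p) (int n - int p)"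
      unfolding choose_identity[OF assms(1,2) True] np using assms \<open>m + p + (n - p) - 1 = m + n - 1\<close> \<open>p + (m - 1) = p + m - 1\<close>
      by (simp only: gbinomial_neg_of_nat series_coeff_choose of_nat_mult) (simp add: mult_ac series_coeff_choose)
    finally show ?thesis .
  next
    case False
    then have lt: "n - 1 < p - 1" using assms by linarith
    have "(of_int (int n - 1) :: complex) gchoose (p - 1) = 0"
      by (simp only: n1 binomial_gbinomial[symmetric] binomial_eq_0[OF lt] of_nat_0)
    then show ?thesis using False by simp
  qed
qed

context complex_vector_space
begin

text \<open>The sum over matchings again, with each letter replaced by the function that assigns to a mode index the
  coefficient of that mode; unlike \<open>wick\<close> it makes sense for linear combinations of letters.\<close>

fun mode_sum :: "complex \<Rightarrow> (bool \<times> (int \<Rightarrow> complex)) list \<Rightarrow> (bool list \<Rightarrow> 'w) \<Rightarrow> (bool \<times> (int \<Rightarrow> complex)) list \<Rightarrow> nat \<Rightarrow> 'w" where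
  "mode_sum l [] \<theta> v r = (if r = 0 then scl (\<Prod>b\<leftarrow>v. snd b 0) (\<theta> (map fst v)) else 0)"
| "mode_sum l (a # u) \<theta> v r = scl (snd a 0) (mode_sum l u (\<lambda>z. \<theta> (fst a # z)) v r) +
     (\<Sum>p<length v. \<Sum>n=1..r. scl (snd a (int n) * of_nat n * hpair (fst a) (fst (v ! p)) * l * snd (v ! p) (- int n))
        (mode_sum l u \<theta> (remove_at p v) (r - n)))"

lemma map_remove_at: "map f (remove_at p v) = remove_at p (map f v)"
  by (simp add: remove_at_def take_map drop_map)

text \<open>Instead of the product of all powers of x1-x2, each power is expanded separately. This
  distributes the r units of weight over the matched pairs, n being the index of the modes that meet
  in a pair.\<close>

lemma wick_mode_sum:
  assumes "proper_word u" "proper_word v"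
  shows "wick l u \<theta> v (\<lambda>A C. series_coeff C (int r + int (wt u) - int A - int C))
    = mode_sum l (map letter_fun u) \<theta> (map letter_fun v) r"
  using assms
proof (induction u arbitrary: \<theta> v r)
  case Nil
  have "word_sign v = (\<Prod>b\<leftarrow>map letter_fun v. snd b 0)"
    by (induction v) (simp_all add: letter_fun_0)
  then show ?case by (simp add: comp_def)
next
  case (Cons a u)
  let ?m = "snd a"
  have m: "?m \<ge> 1" and u: "proper_word u" using Cons.prems by (auto simp: proper_word_def)
  have "scl (contraction l a (v ! p)) (wick l u \<theta> (remove_at p v)
       (\<lambda>A C. series_coeff (C + ?m + snd (v ! p)) (int r + int (wt (a # u)) - int A - int (C + ?m + snd (v ! p)))))
    = (\<Sum>n=1..r. scl (snd (letter_fun a) (int n) * of_nat n * hpair (fst a) (fst (v ! p)) * l * snd (letter_fun (v ! p)) (- int n))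
        (mode_sum l (map letter_fun u) \<theta> (map letter_fun (remove_at p v)) (r - n)))" (is "?L = ?R") if p: "p < length v" for p
  proof -
    let ?p = "snd (v ! p)"
    define c where "c n = snd (letter_fun a) (int n) * of_nat n * hpair (fst a) (fst (v ! p)) * l * snd (letter_fun (v ! p)) (- int n)" for n
    have p1: "?p \<ge> 1" using Cons.prems(2) nth_mem[OF p] by (fastforce simp: proper_word_def)
    have "proper_word (remove_at p v)" using Cons.prems(2) by (auto simp: proper_word_def dest!: in_set_remove_at)
    then have "?R = (\<Sum>n=1..r. scl (c n) (wick l u \<theta> (remove_at p v) (\<lambda>A C. series_coeff C (int (r - n) + int (wt u) - int A - int C))))"
      by (simp only: Cons.IH[OF u] c_def)
    also have "\<dots> = wick l u \<theta> (remove_at p v) (\<lambda>A C. \<Sum>n=1..r. c n * series_coeff C (int (r - n) + int (wt u) - int A - int C))"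
      by (rule wick_sum[symmetric])
    also have "\<dots> = wick l u \<theta> (remove_at p v) (\<lambda>A C. \<Sum>k\<in>{0::nat}. contraction l a (v ! p) *
       series_coeff (C + ?m + ?p) (int r + int (wt (a # u)) - int A - int (C + ?m + ?p)))"
    proof (rule wick_cong)
      fix A C assume AC: "wt u \<le> A + C"
      define i where "i = int r - int ?p + int (wt u) - int A - int C"
      have c: "c n = contraction l a (v ! p) * series_coeff (?m + ?p) (int n - int ?p)" if "n \<ge> 1" for n
        using contraction_modes[OF m p1 that] by (simp add: c_def contraction_def letter_fun_def mult_ac)
      have "(\<Sum>n=1..r. c n * series_coeff C (int (r - n) + int (wt u) - int A - int C))
        = (\<Sum>n=1..r. contraction l a (v ! p) * (series_coeff (?m + ?p) (int n - int ?p) * series_coeff C (i - (int n - int ?p))))"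
        by (intro sum.cong refl) (auto simp: c i_def of_nat_diff algebra_simps)
      also have "\<dots> = contraction l a (v ! p) * (\<Sum>n=1..r. series_coeff (?m + ?p) (int n - int ?p) * series_coeff C (i - (int n - int ?p)))"
        by (simp add: sum_distrib_left)
      \<comment> \<open>The series of (1-t)^(-C) is multiplied by that of the new pair; indices n
        below the weight of the partner contribute nothing, so n is shifted by this weight.\<close>
      also have "(\<Sum>n=1..r. series_coeff (?m + ?p) (int n - int ?p) * series_coeff C (i - (int n - int ?p))) = series_coeff (?m + ?p + C) i"
      proof (cases "?p \<le> r")
        case True
        have "(\<Sum>n=1..r. series_coeff (?m + ?p) (int n - int ?p) * series_coeff C (i - (int n - int ?p)))
          = (\<Sum>n\<in>(\<lambda>t. t + ?p) ` {..r - ?p}. series_coeff (?m + ?p) (int n - int ?p) * series_coeff C (i - (int n - int ?p)))"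
        proof (rule sum.mono_neutral_right)
          show "(\<lambda>t. t + ?p) ` {..r - ?p} \<subseteq> {1..r}" using p1 True by auto
          show "\<forall>n\<in>{1..r} - (\<lambda>t. t + ?p) ` {..r - ?p}. series_coeff (?m + ?p) (int n - int ?p) * series_coeff C (i - (int n - int ?p)) = 0"
          proof
            fix n assume n: "n \<in> {1..r} - (\<lambda>t. t + ?p) ` {..r - ?p}"
            have "n < ?p"
            proof (rule ccontr)
              assume "\<not> n < ?p"
              then have "n = (n - ?p) + ?p" "n - ?p \<in> {..r - ?p}" using n by auto
              then show False using n by blast
            qed
            then show "series_coeff (?m + ?p) (int n - int ?p) * series_coeff C (i - (int n - int ?p)) = 0" by simp
          qed
        qed simp
        also have "\<dots> = (\<Sum>t\<le>r - ?p. series_coeff (?m + ?p) (int t) * series_coeff C (i - int t))"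
          by (subst sum.reindex) (auto simp: inj_on_def)
        also have "\<dots> = series_coeff (?m + ?p + C) i"
          using AC True by (intro series_coeff_add) (auto simp: i_def of_nat_diff)
        finally show ?thesis .
      next
        case False
        then have "i < 0" using AC by (simp add: i_def)
        moreover have "series_coeff (?m + ?p) (int n - int ?p) = 0" if "n \<in> {1..r}" for n using that False by simp
        ultimately show ?thesis by simp
      qed
      finally show "(\<Sum>n=1..r. c n * series_coeff C (int (r - n) + int (wt u) - int A - int C)) = (\<Sum>k\<in>{0::nat}. contraction l a (v ! p) *
         series_coeff (C + ?m + ?p) (int r + int (wt (a # u)) - int A - int (C + ?m + ?p)))"
        by (simp add: i_def algebra_simps)
    qed
    also have "\<dots> = ?L" by (subst wick_sum) simp
    finally show ?thesis ..
  qed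
  note 1 = this
  have 2: "wick l u (\<lambda>z. \<theta> (fst a # z)) v (\<lambda>A C. series_coeff C (int r + int (wt (a # u)) - int (A + ?m) - int C))
    = mode_sum l (map letter_fun u) (\<lambda>z. \<theta> (fst a # z)) (map letter_fun v) r"
    using Cons.IH[OF u Cons.prems(2), of "\<lambda>z. \<theta> (fst a # z)" r] by (simp add: algebra_simps)
  have "wick l (a # u) \<theta> v (\<lambda>A C. series_coeff C (int r + int (wt (a # u)) - int A - int C))
    = scl ((- 1) ^ (?m - 1)) (mode_sum l (map letter_fun u) (\<lambda>z. \<theta> (fst a # z)) (map letter_fun v) r)
      + (\<Sum>p<length v. \<Sum>n=1..r. scl (snd (letter_fun a) (int n) * of_nat n * hpair (fst a) (fst (v ! p)) * l * snd (letter_fun (v ! p)) (- int n))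
        (mode_sum l (map letter_fun u) \<theta> (map letter_fun (remove_at p v)) (r - n)))"
    unfolding wick.simps 2 by (intro arg_cong2[of _ _ _ _ "(+)"] refl sum.cong 1) simp
  then show ?case by (simp add: letter_fun_0 map_remove_at)
qed

end

locale lw_module = v_module l scl gr Y d D
  for l :: complex and scl :: "complex \<Rightarrow> 'w \<Rightarrow> 'w::ab_group_add" and gr :: "complex \<Rightarrow> 'w set"
    and Y :: "'w vops" and d D :: "'w \<Rightarrow> 'w" +
  fixes K :: real and \<mu> :: complex and \<rho> :: "tensor \<Rightarrow> 'w \<Rightarrow> 'w"
  assumes lowest_weight: "lowest_weight_module scl gr Y \<mu>"
    and zero_modes: "zero_mode_module scl gr Y \<mu> \<rho>"
    and cov_deriv_condition: "covariant_derivative_condition K (gr \<mu>) \<rho>"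
begin

text \<open>The value 0 on unbalanced words is a default. Only letters of opposite sign have a
  nonzero pairing, so unbalanced words enter the matrix coefficients of balanced words with
  coefficient 0.\<close>

definition eval_word :: "'w \<Rightarrow> bool list \<Rightarrow> 'w" where
  "eval_word x z = (if balanced z then \<rho> (Poly_Mapping.single z 1) x else 0)"

lemma gr_outside: "(\<And>n::nat. m \<noteq> \<mu> + of_nat n) \<Longrightarrow> gr m = {0}"
  using lowest_weight unfolding lowest_weight_module_def by blast

lemma gr_below: "r < 0 \<Longrightarrow> gr (\<mu> + of_int r) = {0}"
proof (rule gr_outside)
  fix n :: nat assume "r < 0"
  then have "r \<noteq> int n" by linarith
  then have "(of_int r :: complex) \<noteq> of_int (int n)" by (simp only: of_int_eq_iff not_False_eq_True)
  then show "\<mu> + of_int r \<noteq> \<mu> + of_nat n" by (metis add_left_cancel of_int_of_nat_eq)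
qed

lemma raised_gr: "good v \<Longrightarrow> x \<in> gr \<mu> \<Longrightarrow> Yw v (int (wt v) - 1 - r) x \<in> gr (\<mu> + of_int r)"
  using Yw_gr[of v x \<mu> "int (wt v) - 1 - r"] by simp

lemma zero_mode_word:
  assumes "good v" "x \<in> gr \<mu>"
  shows "Yw v (int (wt v) - 1) x = scl (word_sign v) (eval_word x (map fst v))"
proof -
  have "\<forall>v. proper_word v \<and> balanced (map fst v) \<longrightarrow> (\<forall>x\<in>gr \<mu>.
        Y (Poly_Mapping.single v 1) (int (wt v) - 1) x =
        scl (\<Prod>(i, m)\<leftarrow>v. (-1) ^ (m - 1)) (\<rho> (Poly_Mapping.single (map fst v) 1) x))"
    using zero_modes unfolding zero_mode_module_def by (elim conjE) assumption
  then show ?thesis using assms by (auto simp: good_def word_sign_def eval_word_def)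
qed

lemma zero_mode_homogeneous:
  assumes v: "v \<in> homogeneous h 0" and x: "x \<in> gr \<mu>"
  shows "Y v (h - 1) x = zero_map (eval_word x) v"
proof -
  have "good w \<and> int (wt w) = h" if "w \<in> Poly_Mapping.keys v" for w
    using v that by (auto simp: homogeneous_def good_def balanced_iff_charge)
  then have "Yw w (h - 1) x = scl (word_sign w) (eval_word x (map fst w))" if "w \<in> Poly_Mapping.keys v" for w
    using zero_mode_word[of w x] x that by auto
  then show ?thesis
    unfolding Y_expand[OF homogeneous_Vsp[OF v]] zero_map_def lin_ext_def by (intro sum.cong refl) simp
qed

text \<open>Weak associativity equates a combination of the wanted value and those for smaller r
  with zero modes of vectors of \<open>V\<close>, which \<open>zero_map_vword\<close> evaluates. The
  matching sums satisfy the same triangular relation, so induction on r isolates the term k = 0,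
  whose coefficient is 1.\<close>

lemma matrix_coefficient_wick:
  assumes u: "good u" and v: "good v" and x: "x \<in> gr \<mu>"
  shows "Yw u (int (wt u) - 1 + int r) (Yw v (int (wt v) - 1 - int r) x) =
    wick l u (eval_word x) v (\<lambda>A C. series_coeff C (int r + int (wt u) - int A - int C))"
proof (induction r rule: less_induct)
  case (less r)
  \<comment> \<open>For \<open>q \<ge> wt u\<close> the function (x0+x2)^(q-A) is a polynomial for
    every A that occurs.\<close>
  obtain q where q: "q \<ge> wt u" "assoc_at q u x" using assoc_at_large[OF x u] by blast
  \<comment> \<open>With these values of \<open>a\<close> and \<open>b\<close> the wanted
    coefficient is \<open>X 0\<close>, and the other side of weak associativity consists of zero
    modes on \<open>x\<close>.\<close>
  define a where "a = int q - int r - int (wt u)"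
  define b where "b = int r - int (wt v)"
  define W where "W k = wick l u (eval_word x) v (\<lambda>A C. series_coeff C (int r + int (wt u) - int A - int C - int k))" for k
  define c where "c k = ((of_int (a + int k) :: complex) gchoose k)" for k
  define X where "X k = Yw u (int q - 1 - int k - a) (Yw v (int k - 1 - b) x)" for k
  have X: "X k = Yw u (int (wt u) - 1 + (int r - int k)) (Yw v (int (wt v) - 1 - (int r - int k)) x)" for k
    by (simp add: X_def a_def b_def algebra_simps)
  \<comment> \<open>The inner mode would land below the lowest weight.\<close>
  have X0: "X k = 0" if "k > r" for k
    using raised_gr[OF v x, of "int r - int k"] gr_below[of "int r - int k"] that u by (simp add: X single_in_Vsp)
  have XW: "X k = W k" if "1 \<le> k" "k \<le> r" for k
    using less.IH[of "r - k"] that unfolding X W_def by (simp add: of_nat_diff algebra_simps)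
  have "(\<Sum>k\<le>r. scl (c k) (X k)) = Sum_any (\<lambda>k. scl (c k) (X k))"
    by (rule Sum_any.expand_superset[symmetric]) (simp_all add: subset_iff, metis X0 not_le)
  also have "\<dots> = (\<Sum>j\<le>q. scl (of_nat (q choose j)) (Y (vword l u (int j - 1 - a) (Poly_Mapping.single v 1)) (int q - int j - 1 - b) x))"
    using q(2)[unfolded assoc_at_def, rule_format, OF v, of a b] by (simp only: c_def X_def)
  also have "\<dots> = (\<Sum>j\<le>q. scl (of_nat (q choose j)) (wick l u (eval_word x) v (\<lambda>A C. ibinom (- of_nat A) (int C - (int j - 1 - a) - 1))))"
  proof (intro sum.cong refl arg_cong[where f = "scl _"])
    fix j
    have "vword l u (int j - 1 - a) (Poly_Mapping.single v 1) \<in> homogeneous (int q - int j - b) 0"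
      using vword_homogeneous[OF u v, of l "int j - 1 - a"] by (simp add: a_def b_def algebra_simps)
    from zero_mode_homogeneous[OF this x]
    show "Y (vword l u (int j - 1 - a) (Poly_Mapping.single v 1)) (int q - int j - 1 - b) x
      = wick l u (eval_word x) v (\<lambda>A C. ibinom (- of_nat A) (int C - (int j - 1 - a) - 1))"
      using zero_map_vword[of u "eval_word x" l "int j - 1 - a" v] u by (simp add: good_def algebra_simps)
  qed
  also have "\<dots> = wick l u (eval_word x) v (\<lambda>A C. \<Sum>j\<le>q. of_nat (q choose j) * ibinom (- of_nat A) (int C - (int j - 1 - a) - 1))"
    by (rule wick_sum[symmetric])
  \<comment> \<open>For each pair (A, C) both sums are the same coefficient of (x0+x2)^(q-A)
    x0^(-C): Vandermonde's identity collects the first sum, and \<open>rational_expansion\<close>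
    produces the second.\<close>
  also have "\<dots> = wick l u (eval_word x) v (\<lambda>A C. \<Sum>k\<le>r. c k * series_coeff C (int r + int (wt u) - int A - int C - int k))"
  proof (rule wick_cong)
    fix A C assume A: "A \<le> wt u" "wt u \<le> A + C"
    define i where "i = int r + int (wt u) - int A - int C"
    have "(\<Sum>j\<le>q. of_nat (q choose j) * ibinom (- of_nat A) (int C - (int j - 1 - a) - 1))
      = (\<Sum>j\<le>q. of_nat (q choose j) * ibinom (- of_nat A) ((int C + a) - int j))"
      by (simp add: algebra_simps)
    also have "\<dots> = ibinom (of_nat (q - A)) (int C + a)"
      unfolding ibinom_Vandermonde_nat using A q(1) by (simp add: of_nat_diff)
    also have "int C + a = int (q - A) - i" using A q(1) by (simp add: i_def a_def of_nat_diff)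
    also have "ibinom (of_nat (q - A)) (int (q - A) - i) = (\<Sum>k\<le>r. (of_int (int (q - A) - i - int C + int k) gchoose k) * series_coeff C (i - int k))"
      using A by (intro rational_expansion[symmetric]) (simp add: i_def)
    also have "int (q - A) - i - int C = a" using A q(1) by (simp add: i_def a_def of_nat_diff)
    finally show "(\<Sum>j\<le>q. of_nat (q choose j) * ibinom (- of_nat A) (int C - (int j - 1 - a) - 1))
      = (\<Sum>k\<le>r. c k * series_coeff C (int r + int (wt u) - int A - int C - int k))"
      by (simp only: c_def i_def)
  qed
  also have "\<dots> = (\<Sum>k\<le>r. scl (c k) (W k))"
    unfolding W_def by (rule wick_sum)
  finally have eq: "(\<Sum>k\<le>r. scl (c k) (X k)) = (\<Sum>k\<le>r. scl (c k) (W k))" .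
  have split: "(\<Sum>k\<le>r. scl (c k) (F k)) = F 0 + (\<Sum>k=1..r. scl (c k) (F k))" for F :: "nat \<Rightarrow> 'w"
    by (simp add: atMost_atLeast0 sum.atLeast_Suc_atMost c_def)
  have "(\<Sum>k=1..r. scl (c k) (X k)) = (\<Sum>k=1..r. scl (c k) (W k))"
    using XW by (intro sum.cong) auto
  then have "X 0 = W 0" using eq unfolding split by simp
  then show ?case unfolding X W_def by simp
qed

theorem matrix_coefficient:
  assumes "good u" "good v" "x \<in> gr \<mu>"
  shows "Yw u (int (wt u) - 1 + int r) (Yw v (int (wt v) - 1 - int r) x) =
    mode_sum l (map letter_fun u) (eval_word x) (map letter_fun v) r"
  unfolding matrix_coefficient_wick[OF assms]
  by (rule wick_mode_sum) (use assms in \<open>simp_all add: good_def\<close>)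

end

section \<open>The covariant derivative condition\<close>

lemma PiT_single: "balanced z \<Longrightarrow> Poly_Mapping.single z c \<in> PiT"
  by (simp add: PiT_def)

lemma PiT_add: "s \<in> PiT \<Longrightarrow> t \<in> PiT \<Longrightarrow> s + t \<in> PiT"
  unfolding PiT_def using keys_add[of s t] by blast

lemma single_sum: "Poly_Mapping.single k (\<Sum>i\<in>I. f i) = (\<Sum>i\<in>I. Poly_Mapping.single k (f i))"
  by (induction I rule: infinite_finite_induct) (simp_all add: single_add)

lemma swap_at_middle: "swap_at (length pre) (pre @ a # b # post) = pre @ b # a # post"
  by (simp add: swap_at_def list_update_append nth_append)

text \<open>The curvature operator is diagonal in \<open>h+\<close>, \<open>h-\<close> with opposite
  eigenvalues, so as a derivation on the suffix it multiplies by a number proportional to the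
  charge.\<close>

lemma sum_curv:
  assumes "a \<noteq> b"
  shows "(\<Sum>k\<in>{length pre + 2..<length (pre @ a # b # post)}. curv K a b ((pre @ a # b # post) ! k))
    = (if a then 1 else - 1) * of_real (2 * K) * of_int (charge post)"
proof -
  have "(\<Sum>k\<in>{length pre + 2..<length (pre @ a # b # post)}. curv K a b ((pre @ a # b # post) ! k))
    = (\<Sum>i<length post. curv K a b (post ! i))"
    by (rule sum.reindex_bij_witness[of _ "\<lambda>i. i + (length pre + 2)" "\<lambda>k. k - (length pre + 2)"])
       (auto simp: nth_append)
  also have "\<dots> = (\<Sum>c\<leftarrow>post. curv K a b c)"
    by (simp add: sum_list_sum_nth atLeast0LessThan)
  also have "\<dots> = (if a then 1 else - 1) * of_real (2 * K) * of_int (charge post)"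
    using assms by (induction post) (simp_all add: curv_def algebra_simps)
  finally show ?thesis .
qed

text \<open>The walk of charges of the suffixes of a word is followed from the right end. A step from height \<open>\<plusminus>p\<close> towards
  \<open>0\<close> contributes \<open>p\<close>, which stands for a factor \<open>\<Delta> + p(p-1)K\<close> by \<open>act_descents\<close>.\<close>

fun descents :: "bool list \<Rightarrow> nat list" where
  "descents [] = []"
| "descents (a # y) = (if (charge y < 0 \<and> a) \<or> (charge y > 0 \<and> \<not> a) then nat \<bar>charge y\<bar> # descents y else descents y)"

text \<open>A discrete intermediate value argument: the height changes by one at each step, so the
  absolute height passes from P to P-1 somewhere in \<open>y\<close>.\<close>

lemma descents_crossing:
  assumes "\<bar>charge (y @ z)\<bar> < int P" "int P \<le> \<bar>charge z\<bar>"
  shows "P \<in> set (descents (y @ z))"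
  using assms
proof (induction y)
  case (Cons a y)
  show ?case
  proof (cases "\<bar>charge (y @ z)\<bar> < int P")
    case False
    then have "\<bar>charge (y @ z)\<bar> = int P" "(charge (y @ z) < 0 \<and> a) \<or> (charge (y @ z) > 0 \<and> \<not> a)"
      using Cons.prems by (auto split: if_splits)
    then show ?thesis by auto
  qed (use Cons in auto)
qed simp

context lw_module
begin

lemma zero_mode_facts:
  shows "\<forall>t\<in>PiT. \<forall>x\<in>gr \<mu>. \<rho> t x \<in> gr \<mu>"
    and "\<forall>t\<in>PiT. \<forall>x\<in>gr \<mu>. \<forall>y\<in>gr \<mu>. \<rho> t (x + y) = \<rho> t x + \<rho> t y"
    and "\<forall>t\<in>PiT. \<forall>x\<in>gr \<mu>. \<forall>c. \<rho> t (scl c x) = scl c (\<rho> t x)"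
    and "\<forall>s\<in>PiT. \<forall>t\<in>PiT. \<forall>x\<in>gr \<mu>. \<rho> (s + t) x = \<rho> s x + \<rho> t x"
    and "\<forall>t\<in>PiT. \<forall>x\<in>gr \<mu>. \<forall>c. \<rho> (pm_scale (*) c t) x = scl c (\<rho> t x)"
    and "\<forall>x\<in>gr \<mu>. \<rho> (Poly_Mapping.single [] 1) x = x"
    and "\<forall>s\<in>PiT. \<forall>t\<in>PiT. \<forall>x\<in>gr \<mu>. \<rho> (tensor_mult s t) x = \<rho> s (\<rho> t x)"
  using zero_modes unfolding zero_mode_module_def by - (elim conjE; assumption)+

abbreviation act :: "bool list \<Rightarrow> 'w \<Rightarrow> 'w" where
  "act z \<equiv> \<rho> (Poly_Mapping.single z 1)"

lemma act_gr: "balanced z \<Longrightarrow> x \<in> gr \<mu> \<Longrightarrow> act z x \<in> gr \<mu>"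
  using zero_mode_facts(1) PiT_single by blast

lemma act_add: "balanced z \<Longrightarrow> x \<in> gr \<mu> \<Longrightarrow> y \<in> gr \<mu> \<Longrightarrow> act z (x + y) = act z x + act z y"
  using zero_mode_facts(2) PiT_single by blast

lemma act_scale: "balanced z \<Longrightarrow> x \<in> gr \<mu> \<Longrightarrow> act z (scl c x) = scl c (act z x)"
  using zero_mode_facts(3) PiT_single by blast

lemma rho_single: "balanced z \<Longrightarrow> x \<in> gr \<mu> \<Longrightarrow> \<rho> (Poly_Mapping.single z c) x = scl c (act z x)"
  using zero_mode_facts(5)[rule_format, OF PiT_single[of z 1], of x c] by (simp add: pm_scale_single)

lemma act_Nil: "x \<in> gr \<mu> \<Longrightarrow> act [] x = x"
  using zero_mode_facts(6) by blast

lemma act_append: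
  assumes "balanced y" "balanced z" "x \<in> gr \<mu>"
  shows "act (y @ z) x = act y (act z x)"
proof -
  have "tensor_mult (Poly_Mapping.single y 1) (Poly_Mapping.single z 1) = Poly_Mapping.single (y @ z) 1"
    by (simp add: tensor_mult_def lin_ext_single)
  then show ?thesis
    using zero_mode_facts(7)[rule_format, OF PiT_single[OF assms(1), of 1] PiT_single[OF assms(2), of 1] assms(3)] by simp
qed

text \<open>Both forms of the covariant derivative condition at once: at the right end of a word,
  where there is no curvature term, the suffix is empty and has charge 0.\<close>

lemma act_swap:
  assumes ab: "a \<noteq> b" and bal: "balanced (pre @ a # b # post)" and x: "x \<in> gr \<mu>"
  shows "act (pre @ a # b # post) x = act (pre @ b # a # post) x
    - scl ((if a then 1 else - 1) * of_real (2 * K) * of_int (charge post)) (act (pre @ post) x)"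
proof -
  let ?z = "pre @ a # b # post" and ?z' = "pre @ b # a # post"
  define \<kappa> where "\<kappa> = (if a then 1 else - 1) * complex_of_real (2 * K) * of_int (charge post)"
  have bal': "balanced ?z'" "balanced (pre @ post)" using ab bal by (auto simp: balanced_iff_charge)
  have keys: "\<forall>w\<in>Poly_Mapping.keys (Poly_Mapping.single ?z 1 :: tensor). length w = length ?z" by simp
  have "2 \<le> length ?z" by simp
  from cov_deriv_condition[unfolded covariant_derivative_condition_def, THEN spec, THEN mp, OF this,
      THEN bspec, OF PiT_single[OF bal, of 1], THEN mp, OF keys, THEN bspec, OF x]
  have cdc: "\<rho> (cdc_last (length ?z) (Poly_Mapping.single ?z 1)) x = 0"
    "\<forall>j. j + 2 < length ?z \<longrightarrow> \<rho> (cdc_inner K (length ?z) j (Poly_Mapping.single ?z 1)) x = 0"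
    by blast+
  have "\<rho> (Poly_Mapping.single ?z 1 + Poly_Mapping.single ?z' (- 1) + Poly_Mapping.single (pre @ post) \<kappa>) x = 0"
  proof (cases "post = []")
    case True
    have "cdc_last (length ?z) (Poly_Mapping.single ?z 1) = Poly_Mapping.single ?z 1 - Poly_Mapping.single (swap_at (length pre) ?z) 1"
      by (simp add: cdc_last_def lin_ext_single True)
    then show ?thesis using cdc(1) True by (simp add: swap_at_middle \<kappa>_def single_uminus)
  next
    case False
    then have lt: "length pre + 2 < length ?z" by simp
    have inner: "cdc_inner K (length ?z) (length pre) (Poly_Mapping.single ?z 1)
      = Poly_Mapping.single ?z 1 - Poly_Mapping.single ?z' 1 + Poly_Mapping.single (pre @ post) \<kappa>"
    proof -
      have "cdc_inner K (length ?z) (length pre) (Poly_Mapping.single ?z 1) = Poly_Mapping.single ?z 1 - Poly_Mapping.single (swap_at (length pre) ?z) 1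
        + (\<Sum>k\<in>{length pre + 2..<length ?z}. Poly_Mapping.single (take (length pre) ?z @ drop (length pre + 2) ?z)
           (1 * curv K (?z ! length pre) (?z ! Suc (length pre)) (?z ! k)))"
        unfolding cdc_inner_def by (rule lin_ext_single) simp
      also have "(\<Sum>k\<in>{length pre + 2..<length ?z}. Poly_Mapping.single (take (length pre) ?z @ drop (length pre + 2) ?z)
           (1 * curv K (?z ! length pre) (?z ! Suc (length pre)) (?z ! k)))
         = Poly_Mapping.single (pre @ post) (\<Sum>k\<in>{length pre + 2..<length ?z}. curv K a b (?z ! k))"
      proof -
        have "take (length pre) ?z @ drop (length pre + 2) ?z = pre @ post" "?z ! length pre = a" "?z ! Suc (length pre) = b"
          by (simp_all add: nth_append)
        then show ?thesis by (simp only: single_sum mult_1)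
      qed
      finally show ?thesis unfolding sum_curv[OF ab] swap_at_middle \<kappa>_def .
    qed
    have "\<rho> (cdc_inner K (length ?z) (length pre) (Poly_Mapping.single ?z 1)) x = 0" using cdc(2) lt by blast
    then show ?thesis unfolding inner by (simp add: single_uminus)
  qed
  moreover have "\<rho> (Poly_Mapping.single ?z 1 + Poly_Mapping.single ?z' (- 1) + Poly_Mapping.single (pre @ post) \<kappa>) x
    = act ?z x + scl (- 1) (act ?z' x) + scl \<kappa> (act (pre @ post) x)"
    using zero_mode_facts(4) bal bal' x by (simp add: PiT_add PiT_single rho_single[of _ x "- 1"] rho_single[of _ x \<kappa>])
  ultimately have "act ?z x - act ?z' x + scl \<kappa> (act (pre @ post) x) = 0" by simp
  then show ?thesis unfolding \<kappa>_def by (simp add: algebra_simps eq_neg_iff_add_eq_0)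
qed

definition Lap :: "'w \<Rightarrow> 'w" where
  "Lap = act [True, False]"

definition shifted_Lap :: "nat \<Rightarrow> 'w \<Rightarrow> 'w" where
  "shifted_Lap p x = Lap x + scl (of_real (real p * (real p - 1) * K)) x"

lemma Lap_gr: "x \<in> gr \<mu> \<Longrightarrow> Lap x \<in> gr \<mu>"
  unfolding Lap_def by (rule act_gr) (simp_all add: balanced_def)

lemma Lap_add: "x \<in> gr \<mu> \<Longrightarrow> y \<in> gr \<mu> \<Longrightarrow> Lap (x + y) = Lap x + Lap y"
  unfolding Lap_def by (rule act_add) (simp_all add: balanced_def)

lemma Lap_scale: "x \<in> gr \<mu> \<Longrightarrow> Lap (scl c x) = scl c (Lap x)"
  unfolding Lap_def by (rule act_scale) (simp_all add: balanced_def)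

lemma shifted_Lap_gr: "x \<in> gr \<mu> \<Longrightarrow> shifted_Lap p x \<in> gr \<mu>"
  unfolding shifted_Lap_def by (intro subspace_add[OF subspace_gr] subspace_scale[OF subspace_gr] Lap_gr)

lemma foldr_shifted_Lap_gr: "x \<in> gr \<mu> \<Longrightarrow> foldr shifted_Lap ps x \<in> gr \<mu>"
  by (induction ps) (simp_all add: shifted_Lap_gr)

text \<open>The letter \<open>s\<close> is moved to the right past p opposite letters. The curvature
  terms add up to 2K(1 + ... + p) = (p+1)pK, and the pair left at the end is the Laplacian.\<close>

lemma act_descend:
  assumes "balanced (pre @ s # replicate (Suc p) (\<not> s))" "x \<in> gr \<mu>"
  shows "act (pre @ s # replicate (Suc p) (\<not> s)) x = act (pre @ replicate p (\<not> s)) (shifted_Lap (Suc p) x)"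
  using assms
proof (induction p arbitrary: pre)
  case 0
  have "act [s, \<not> s] x = Lap x"
    using act_swap[of False True "[]" "[]" x] 0 by (cases s) (simp_all add: Lap_def balanced_def)
  moreover have "balanced pre" "balanced [s, \<not> s]" using 0 by (auto simp: balanced_iff_charge split: if_splits)
  ultimately show ?case using act_append[of pre "[s, \<not> s]" x] 0 by (simp add: shifted_Lap_def)
next
  case (Suc p)
  have bal: "balanced ((pre @ [\<not> s]) @ s # replicate (Suc p) (\<not> s))" "balanced (pre @ replicate (Suc p) (\<not> s))"
    using Suc.prems(1) by (auto simp: balanced_iff_charge)
  have "act (pre @ s # replicate (Suc (Suc p)) (\<not> s)) x = act ((pre @ [\<not> s]) @ s # replicate (Suc p) (\<not> s)) x
     + scl (of_real (2 * K) * of_nat (Suc p)) (act (pre @ replicate (Suc p) (\<not> s)) x)"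
  proof -
    have e: "(if s then 1 else - 1) * complex_of_real (2 * K) * of_int (charge (replicate (Suc p) (\<not> s)))
      = - (of_real (2 * K) * of_nat (Suc p))"
      by (cases s) (simp_all add: algebra_simps)
    have "balanced (pre @ s # (\<not> s) # replicate (Suc p) (\<not> s))" using Suc.prems(1) by simp
    from act_swap[OF _ this Suc.prems(2)] show ?thesis unfolding e by (simp add: algebra_simps)
  qed
  also have "act ((pre @ [\<not> s]) @ s # replicate (Suc p) (\<not> s)) x = act ((pre @ [\<not> s]) @ replicate p (\<not> s)) (shifted_Lap (Suc p) x)"
    by (rule Suc.IH[OF bal(1) Suc.prems(2)])
  also have "(pre @ [\<not> s]) @ replicate p (\<not> s) = pre @ replicate (Suc p) (\<not> s)" by simp
  also have "act (pre @ replicate (Suc p) (\<not> s)) (shifted_Lap (Suc p) x) + scl (of_real (2 * K) * of_nat (Suc p)) (act (pre @ replicate (Suc p) (\<not> s)) x)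
    = act (pre @ replicate (Suc p) (\<not> s)) (shifted_Lap (Suc p) x + scl (of_real (2 * K) * of_nat (Suc p)) x)"
    using bal(2) Suc.prems(2) by (simp only: act_add act_scale shifted_Lap_gr subspace_scale[OF subspace_gr])
  also have "shifted_Lap (Suc p) x + scl (of_real (2 * K) * of_nat (Suc p)) x = shifted_Lap (Suc (Suc p)) x"
  proof -
    have "complex_of_real (real (Suc p) * (real (Suc p) - 1) * K) + of_real (2 * K) * of_nat (Suc p) = of_real (real (Suc (Suc p)) * (real (Suc (Suc p)) - 1) * K)"
      by (simp add: algebra_simps)
    then show ?thesis unfolding shifted_Lap_def by (simp only: add.assoc scale_left_distrib[symmetric])
  qed
  finally show ?case .
qed

text \<open>The suffix processed so far is kept in normal form, a run of equal letters with the same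
  charge. A step away from 0 lengthens the run, and a step towards 0 shortens it by
  \<open>act_descend\<close> at the cost of one factor.\<close>

lemma act_descents:
  assumes "balanced (pre @ y)" "x \<in> gr \<mu>"
  shows "act (pre @ y) x = act (pre @ replicate (nat \<bar>charge y\<bar>) (charge y > 0)) (foldr shifted_Lap (descents y) x)"
  using assms
proof (induction y arbitrary: pre)
  case (Cons a y)
  let ?q = "charge y" and ?x = "foldr shifted_Lap (descents y) x"
  have bal: "balanced ((pre @ [a]) @ y)" using Cons.prems(1) by simp
  have IH: "act (pre @ a # y) x = act (pre @ a # replicate (nat \<bar>?q\<bar>) (?q > 0)) ?x"
    using Cons.IH[OF bal Cons.prems(2)] by simp
  show ?case
  proof (cases "(?q < 0 \<and> a) \<or> (?q > 0 \<and> \<not> a)")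
    case True
    then obtain p where p: "nat \<bar>?q\<bar> = Suc p" by (cases "nat \<bar>?q\<bar>") auto
    have s: "(?q > 0) = (\<not> a)" using True by auto
    have R: "replicate p (\<not> a) = replicate (nat \<bar>charge (a # y)\<bar>) (charge (a # y) > 0)"
    proof (cases "p = 0")
      case True then show ?thesis using p \<open>_ \<or> _\<close> by auto
    next
      case False then show ?thesis using p \<open>_ \<or> _\<close> by (intro arg_cong2[of _ _ _ _ replicate]) auto
    qed
    have bal': "balanced (pre @ a # replicate (Suc p) (\<not> a))"
      using Cons.prems(1) p True by (auto simp: balanced_iff_charge)
    have F: "foldr shifted_Lap (descents (a # y)) x = shifted_Lap (Suc p) ?x" using True p by simp
    show ?thesis
      unfolding IH p s act_descend[OF bal' foldr_shifted_Lap_gr[OF Cons.prems(2)]] F R[symmetric] ..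
  next
    case False
    have R: "a # replicate (nat \<bar>?q\<bar>) (?q > 0) = replicate (nat \<bar>charge (a # y)\<bar>) (charge (a # y) > 0)"
    proof -
      have "nat \<bar>charge (a # y)\<bar> = Suc (nat \<bar>?q\<bar>)" "(charge (a # y) > 0) = a" using False by auto
      moreover have "?q = 0 \<or> (?q > 0) = a" using False by auto
      ultimately show ?thesis by auto
    qed
    have F: "descents (a # y) = descents y" using False by (simp only: descents.simps if_False)
    show ?thesis unfolding IH R F ..
  qed
qed simp

lemma act_eq_foldr: "balanced z \<Longrightarrow> x \<in> gr \<mu> \<Longrightarrow> act z x = foldr shifted_Lap (descents z) x"
  using act_descents[of "[]" z x] by (simp add: balanced_iff_charge act_Nil foldr_shifted_Lap_gr)

lemma eval_word_in_submodule:
  assumes "submodule scl gr Y B" "x \<in> B" "x \<in> gr \<mu>"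
  shows "eval_word x z \<in> B"
proof (cases "balanced z")
  case True
  \<comment> \<open>Letters of weight 1 realise the word as a zero mode without a sign.\<close>
  define v where "v = map (\<lambda>i. (i, 1::nat)) z"
  have v: "good v" "map fst v = z" "word_sign v = 1" using True
    by (auto simp: v_def good_def proper_word_def comp_def word_sign_def map_replicate_const)
  then have "eval_word x z = Yw v (int (wt v) - 1) x" using zero_mode_word[OF v(1) assms(3)] by simp
  then show ?thesis using submodule_Y[OF assms(1) single_in_Vsp[OF v(1)] assms(2)] by simp
qed (simp add: eval_word_def subspace_0[OF submodule_subspace[OF assms(1)]])

lemma act_in_submodule: "submodule scl gr Y B \<Longrightarrow> x \<in> B \<Longrightarrow> x \<in> gr \<mu> \<Longrightarrow> balanced z \<Longrightarrow> act z x \<in> B"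
  using eval_word_in_submodule[of B x z] by (simp add: eval_word_def)

lemma shifted_Lap_in_submodule: "submodule scl gr Y B \<Longrightarrow> x \<in> B \<Longrightarrow> x \<in> gr \<mu> \<Longrightarrow> shifted_Lap p x \<in> B"
  unfolding shifted_Lap_def Lap_def
  by (intro subspace_add[OF submodule_subspace] subspace_scale[OF submodule_subspace] act_in_submodule) (simp_all add: balanced_def)

text \<open>The scalar by which \<open>shifted_Lap p\<close> acts on the kernel of
  \<open>shifted_Lap P\<close>.\<close>

definition gap :: "nat \<Rightarrow> nat \<Rightarrow> complex" where
  "gap P p = of_real (real p * (real p - 1) * K) - of_real (real P * (real P - 1) * K)"

lemma gap_self [simp]: "gap P P = 0"
  by (simp add: gap_def)

lemma shifted_Lap_eq: "shifted_Lap p x = shifted_Lap P x + scl (gap P p) x"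
  by (simp add: shifted_Lap_def gap_def algebra_simps)

lemma foldr_shifted_Lap_mod:
  assumes B: "submodule scl gr Y B" and x: "x \<in> gr \<mu>" and eig: "shifted_Lap P x \<in> B"
  shows "foldr shifted_Lap ps x - scl (\<Prod>p\<leftarrow>ps. gap P p) x \<in> B"
proof (induction ps)
  case Nil
  show ?case by (simp add: subspace_0[OF submodule_subspace[OF B]])
next
  case (Cons p ps)
  define c where "c = (\<Prod>p\<leftarrow>ps. gap P p)"
  define y where "y = foldr shifted_Lap ps x - scl c x"
  have y: "y \<in> B" "y \<in> gr \<mu>"
    using Cons x by (auto simp: y_def c_def intro!: subspace_diff[OF subspace_gr] subspace_scale[OF subspace_gr] foldr_shifted_Lap_gr)
  have cx: "scl c x \<in> gr \<mu>" by (intro subspace_scale[OF subspace_gr] x)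
  have "foldr shifted_Lap ps x = y + scl c x" by (simp add: y_def)
  then have "foldr shifted_Lap (p # ps) x = shifted_Lap p y + scl c (shifted_Lap p x)"
    using y cx x by (simp add: shifted_Lap_def Lap_add Lap_scale algebra_simps)
  also have "\<dots> = shifted_Lap p y + scl c (shifted_Lap P x) + scl (gap P p * c) x"
    unfolding shifted_Lap_eq[of p x P] by (simp add: algebra_simps)
  finally have "foldr shifted_Lap (p # ps) x - scl (\<Prod>p\<leftarrow>(p # ps). gap P p) x = shifted_Lap p y + scl c (shifted_Lap P x)"
    by (simp add: c_def)
  also have "\<dots> \<in> B"
    by (intro subspace_add[OF submodule_subspace[OF B]] subspace_scale[OF submodule_subspace[OF B]]
        shifted_Lap_in_submodule[OF B y] eig)
  finally show ?case .
qed

text \<open>Modulo \<open>B\<close> the vector is an eigenvector, so each factor acts by a gap. A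
  balanced word with such a suffix has to come back through height P, where the gap is 0.\<close>

lemma act_crossing_in_submodule:
  assumes B: "submodule scl gr Y B" and x: "x \<in> gr \<mu>" and eig: "shifted_Lap P x \<in> B"
    and z: "P \<ge> 1" "int P \<le> \<bar>charge z\<bar>"
  shows "eval_word x (y @ z) \<in> B"
proof (cases "balanced (y @ z)")
  case True
  then have "P \<in> set (descents (y @ z))" using z by (intro descents_crossing) (auto simp: balanced_iff_charge)
  then have "(\<Prod>p\<leftarrow>descents (y @ z). gap P p) = 0"
    by (auto simp: prod_list_zero_iff intro!: image_eqI[of 0 "gap P" P])
  then show ?thesis
    using foldr_shifted_Lap_mod[OF B x eig, of "descents (y @ z)"] True x by (simp add: act_eq_foldr eval_word_def)
qed (simp add: eval_word_def subspace_0[OF submodule_subspace[OF B]])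

text \<open>Read from the right, the walk goes to height -p and straight back, so each of the
  factors 1 to p occurs once.\<close>

lemma act_diamond:
  assumes "x \<in> gr \<mu>" "shifted_Lap P x = 0"
  shows "act (replicate p True @ replicate p False) x = scl (\<Prod>i=1..p. gap P i) x"
  using assms
proof (induction p)
  case 0
  then show ?case by (simp add: act_Nil)
next
  case (Suc p)
  have bal: "balanced (replicate p True @ True # replicate (Suc p) (\<not> True))" "balanced (replicate p True @ replicate p False)"
    by (simp_all add: balanced_iff_charge)
  have "act (replicate (Suc p) True @ replicate (Suc p) False) x = act (replicate p True @ True # replicate (Suc p) (\<not> True)) x"
    by (simp add: replicate_app_Cons_same)
  also have "\<dots> = act (replicate p True @ replicate p False) (shifted_Lap (Suc p) x)"
    using act_descend[OF bal(1) Suc.prems(1)] by simp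
  also have "shifted_Lap (Suc p) x = scl (gap P (Suc p)) x"
    using shifted_Lap_eq[of "Suc p" x P] Suc.prems(2) by simp
  finally show ?case using Suc bal(2) by (simp add: act_scale mult_ac)
qed

text \<open>The first step back, from height -P, contributes \<open>shifted_Lap P\<close> itself;
  the remaining factors act on an eigenvector.\<close>

lemma act_diamond_Jordan:
  assumes "x \<in> gr \<mu>" "shifted_Lap P (shifted_Lap P x) = 0" "P \<ge> 1"
  shows "act (replicate P True @ replicate P False) x = scl (\<Prod>i=1..P-1. gap P i) (shifted_Lap P x)"
proof -
  obtain p where P: "P = Suc p" using assms(3) by (cases P) auto
  have bal: "balanced (replicate p True @ True # replicate (Suc p) (\<not> True))"
    by (simp_all add: balanced_iff_charge)
  have "act (replicate P True @ replicate P False) x = act (replicate p True @ True # replicate (Suc p) (\<not> True)) x"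
    by (simp add: replicate_app_Cons_same P)
  also have "\<dots> = act (replicate p True @ replicate p False) (shifted_Lap P x)"
    using act_descend[OF bal assms(1)] by (simp add: P)
  finally show ?thesis
    using act_diamond[OF shifted_Lap_gr[OF assms(1)] assms(2), of p] by (simp add: P)
qed

end

section \<open>Combinations of letters with prescribed modes\<close>

text \<open>Letters are combined linearly: \<open>(i, cs)\<close> stands for the combination of the letters \<open>h\<^sub>i(-m)\<close> with
  coefficients \<open>c\<close>, for the entries \<open>(c, m)\<close> of \<open>cs\<close>.\<close>

fun expand :: "(bool \<times> (complex \<times> nat) list) list \<Rightarrow> (complex \<times> fword) list" where
  "expand [] = [(1, [])]"
| "expand (a # ps) = concat (map (\<lambda>(c, m). map (\<lambda>(c', w). (c * c', (fst a, m) # w)) (expand ps)) (snd a))"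

definition comb_fun :: "bool \<times> (complex \<times> nat) list \<Rightarrow> bool \<times> (int \<Rightarrow> complex)" where
  "comb_fun a = (fst a, \<lambda>n. \<Sum>(c, m)\<leftarrow>snd a. c * snd (letter_fun (fst a, m)) n)"

lemma fst_comb_fun [simp]: "fst (comb_fun a) = fst a"
  by (simp add: comb_fun_def)

lemma expand_letters:
  "(c, w) \<in> set (expand ps) \<Longrightarrow> (\<And>a c m. a \<in> set ps \<Longrightarrow> (c, m) \<in> set (snd a) \<Longrightarrow> m \<ge> 1) \<Longrightarrow>
    proper_word w \<and> map fst w = map fst ps"
proof (induction ps arbitrary: c w)
  case (Cons a ps)
  from Cons.prems(1) obtain c1 m c' w' where *: "(c1, m) \<in> set (snd a)" "(c', w') \<in> set (expand ps)" "w = (fst a, m) # w'"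
    by auto
  have "proper_word w' \<and> map fst w' = map fst ps" by (rule Cons.IH[OF *(2)]) (use Cons.prems(2) in auto)
  moreover have "m \<ge> 1" using Cons.prems(2)[of a c1 m] * by simp
  ultimately show ?case using * by (auto simp: proper_word_def)
qed (simp add: proper_word_def)

lemma sum_list_sum_swap: "(\<Sum>x\<leftarrow>xs. \<Sum>p\<in>I. f x p) = (\<Sum>p\<in>I. \<Sum>x\<leftarrow>xs. (f x p :: 'a::comm_monoid_add))"
  by (induction xs) (simp_all add: sum.distrib)

context complex_vector_space
begin

lemma scale_sum_list_right: "scl c (\<Sum>x\<leftarrow>xs. f x) = (\<Sum>x\<leftarrow>xs. scl c (f x))"
  by (induction xs) (simp_all add: scale_right_distrib)

lemma mode_sum_Cons_list:
  "(\<Sum>(c, u)\<leftarrow>E. scl c (mode_sum l (a # f u) \<theta> v r)) =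
   scl (snd a 0) (\<Sum>(c, u)\<leftarrow>E. scl c (mode_sum l (f u) (\<lambda>z. \<theta> (fst a # z)) v r)) +
     (\<Sum>p<length v. \<Sum>n=1..r. scl (snd a (int n) * of_nat n * hpair (fst a) (fst (v ! p)) * l * snd (v ! p) (- int n))
        (\<Sum>(c, u)\<leftarrow>E. scl c (mode_sum l (f u) \<theta> (remove_at p v) (r - n))))"
  by (simp add: case_prod_unfold scale_right_distrib sum_list_addf scale_sum_right sum_list_sum_swap scale_sum_list_right mult.commute)

lemma mode_sum_first_linear:
  "mode_sum l ((i, \<lambda>n. c * \<phi> n + \<psi> n) # u) \<theta> v r = scl c (mode_sum l ((i, \<phi>) # u) \<theta> v r) + mode_sum l ((i, \<psi>) # u) \<theta> v r"
  by (simp add: scale_left_distrib scale_right_distrib sum.distrib distrib_right scale_sum_right mult.assoc add_ac)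

theorem mode_sum_expand:
  "(\<Sum>(c, w)\<leftarrow>expand ps. scl c (mode_sum l (map letter_fun w) \<theta> v r)) = mode_sum l (map comb_fun ps) \<theta> v r"
proof (induction ps arbitrary: \<theta> v r)
  case (Cons a ps)
  obtain i cs where a: "a = (i, cs)" by force
  have 1: "(\<Sum>(c', w)\<leftarrow>map (\<lambda>(c', w). (c * c', (i, m) # w)) (expand ps). scl c' (mode_sum l (map letter_fun w) \<theta> v r))
    = scl c (mode_sum l (letter_fun (i, m) # map comb_fun ps) \<theta> v r)" for c m
  proof -
    have "(\<Sum>(c', w)\<leftarrow>map (\<lambda>(c', w). (c * c', (i, m) # w)) (expand ps). scl c' (mode_sum l (map letter_fun w) \<theta> v r))
      = scl c (\<Sum>(c', w)\<leftarrow>expand ps. scl c' (mode_sum l (letter_fun (i, m) # map letter_fun w) \<theta> v r))"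
      unfolding scale_sum_list_right by (simp add: comp_def case_prod_unfold del: mode_sum.simps)
    also have "(\<Sum>(c', w)\<leftarrow>expand ps. scl c' (mode_sum l (letter_fun (i, m) # map letter_fun w) \<theta> v r))
      = mode_sum l (letter_fun (i, m) # map comb_fun ps) \<theta> v r"
      unfolding mode_sum_Cons_list Cons.IH by simp
    finally show ?thesis .
  qed
  have "(\<Sum>(c, w)\<leftarrow>concat (map (\<lambda>(c, m). map (\<lambda>(c', w). (c * c', (i, m) # w)) (expand ps)) cs). scl c (mode_sum l (map letter_fun w) \<theta> v r))
    = mode_sum l ((i, \<lambda>n. \<Sum>(c, m)\<leftarrow>cs. c * snd (letter_fun (i, m)) n) # map comb_fun ps) \<theta> v r"
  proof (induction cs)
    case Nil
    show ?case by simp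
  next
    case (Cons b cs)
    obtain c m where b: "b = (c, m)" by force
    have "(i, snd (letter_fun (i, m))) = letter_fun (i, m)" by (simp add: letter_fun_def)
    then show ?case
      using Cons 1[of c m] mode_sum_first_linear[of l i c "snd (letter_fun (i, m))" "\<lambda>n. \<Sum>(c, m)\<leftarrow>cs. c * snd (letter_fun (i, m)) n" "map comb_fun ps" \<theta> v r]
      by (simp add: b del: mode_sum.simps)
  qed
  moreover have "comb_fun a = (i, \<lambda>n. \<Sum>(c, m)\<leftarrow>cs. c * snd (letter_fun (i, m)) n)" by (simp add: a comb_fun_def)
  ultimately show ?case by (simp add: a del: mode_sum.simps)
qed simp

text \<open>If the letters in the last block of \<open>v\<close> have no creating modes of weight at most \<open>r\<close>, they are never
  contracted, so they stay at the right end of each word.\<close>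

lemma mode_sum_in_subspace:
  assumes B: "subspace B" and \<psi>: "\<And>n. 1 \<le> n \<Longrightarrow> n \<le> r \<Longrightarrow> \<psi> (- int n) = 0"
    and \<theta>: "\<And>y. \<theta> (y @ replicate Q s) \<in> B"
  shows "mode_sum l u \<theta> (vs @ replicate Q (s, \<psi>)) r \<in> B"
  using assms(2,3)
proof (induction u arbitrary: \<theta> vs r)
  case Nil
  then show ?case by (auto intro!: subspace_scale[OF B] subspace_0[OF B])
next
  case (Cons a u)
  let ?v = "vs @ replicate Q (s, \<psi>)"
  have 1: "mode_sum l u (\<lambda>z. \<theta> (fst a # z)) ?v r \<in> B"
    using Cons.prems(2)[of "fst a # _"] by (intro Cons.IH Cons.prems(1)) auto
  have 2: "scl (snd a (int n) * of_nat n * hpair (fst a) (fst (?v ! p)) * l * snd (?v ! p) (- int n))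
        (mode_sum l u \<theta> (remove_at p ?v) (r - n)) \<in> B" if p: "p < length ?v" and n: "n \<in> {1..r}" for p n
  proof (cases "p < length vs")
    case True
    then have "remove_at p ?v = remove_at p vs @ replicate Q (s, \<psi>)" by (simp add: remove_at_def)
    then show ?thesis using n Cons.prems by (auto intro!: subspace_scale[OF B] Cons.IH)
  next
    case False
    then have "?v ! p = (s, \<psi>)" using p by (simp add: nth_append)
    then show ?thesis using Cons.prems(1)[of n] n by (simp add: subspace_0[OF B])
  qed
  show ?case
    unfolding mode_sum.simps
    by (rule subspace_add[OF B], rule subspace_scale[OF B], rule 1, rule subspace_sum[OF B], rule subspace_sum[OF B], rule 2) auto
qed

lemma mode_sum_eq_0:
  assumes "\<And>z. \<theta> z = 0"
  shows "mode_sum l u \<theta> v r = 0"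
  using mode_sum_in_subspace[of "{0}" r "\<lambda>n. 0" \<theta> 0 True l u v] assms by simp

text \<open>Letters without annihilating modes of index 1 to r cannot be matched, so they are merely
  prepended.\<close>

lemma mode_sum_zero_modes_only:
  assumes "\<phi> 0 = 1" "\<And>n. 1 \<le> n \<Longrightarrow> n \<le> r \<Longrightarrow> \<phi> (int n) = 0"
  shows "mode_sum l (replicate k (s, \<phi>) @ u) \<theta> v r = mode_sum l u (\<lambda>z. \<theta> (replicate k s @ z)) v r"
proof (induction k arbitrary: \<theta>)
  case (Suc k)
  show ?case by (simp add: assms Suc)
qed simp

text \<open>Without a zero mode each of the k letters must be matched, and each match uses up at
  least one unit of r.\<close>

lemma mode_sum_few_annihilators:
  assumes "\<phi> 0 = 0" "r < k"
  shows "mode_sum l (replicate k (s, \<phi>)) \<theta> v r = 0"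
  using assms(2)
proof (induction k arbitrary: v r)
  case (Suc k)
  have "mode_sum l (replicate k (s, \<phi>)) \<theta> (remove_at p v) (r - n) = 0" if "n \<in> {1..r}" for p n
    using that Suc.prems by (intro Suc.IH) auto
  then show ?case by (simp add: assms(1))
qed simp

lemma remove_at_replicate: "p < Suc k \<Longrightarrow> remove_at p (replicate (Suc k) a @ w) = replicate k a @ w"
proof -
  assume "p < Suc k"
  then have "Suc k = p + Suc (k - p)" by simp
  then show ?thesis
    unfolding remove_at_def using \<open>p < Suc k\<close>
    by (simp add: min_def replicate_add[symmetric] del: replicate_Suc)
qed

text \<open>With k letters and k units of weight every match has index exactly 1. Since
  \<open>h-\<close> pairs to zero with itself, the partners are the k letters \<open>h+\<close>, in
  any of k! orders, each pairing contributing a factor 2; the Q letters at the end keep their zero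
  modes.\<close>

lemma mode_sum_full_contraction:
  assumes "\<phi> 0 = 0"
  shows "mode_sum l (replicate k (False, \<phi>)) \<theta> (replicate k (True, \<eta>) @ replicate Q (False, \<psi>)) k
    = scl (fact k * (2 * l * \<phi> 1 * \<eta> (- 1)) ^ k * \<psi> 0 ^ Q) (\<theta> (replicate Q False))"
proof (induction k)
  case 0
  show ?case by (simp add: prod_list_replicate map_replicate)
next
  case (Suc k)
  let ?v = "replicate (Suc k) (True, \<eta>) @ replicate Q (False, \<psi>)"
  let ?S = "mode_sum l (replicate k (False, \<phi>)) \<theta> (replicate k (True, \<eta>) @ replicate Q (False, \<psi>)) k"
  define t where "t p = (\<Sum>n=1..Suc k. scl (\<phi> (int n) * of_nat n * hpair False (fst (?v ! p)) * l * snd (?v ! p) (- int n))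
        (mode_sum l (replicate k (False, \<phi>)) \<theta> (remove_at p ?v) (Suc k - n)))" for p
  have few: "mode_sum l (replicate k (False, \<phi>)) \<theta> w (Suc k - n) = 0" if "n \<in> {2..Suc k}" for w n
    using that by (intro mode_sum_few_annihilators assms) auto
  have t1: "t p = scl (2 * l * \<phi> 1 * \<eta> (- 1)) ?S" if "p < Suc k" for p
  proof -
    have v: "?v ! p = (True, \<eta>)" using that by (simp add: nth_append del: replicate_Suc)
    have "{1..Suc k} = insert 1 {2..Suc k}" by auto
    then have "t p = scl (\<phi> 1 * 2 * l * \<eta> (- 1)) (mode_sum l (replicate k (False, \<phi>)) \<theta> (remove_at p ?v) k)"
      unfolding t_def v using few by (simp add: hpair_def del: replicate_Suc)
    then show ?thesis unfolding remove_at_replicate[OF that] by (simp add: mult_ac)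
  qed
  have t2: "t p = 0" if "p \<in> {Suc k..<Suc k + Q}" for p
  proof -
    have "?v ! p = (False, \<psi>)" using that by (auto simp: nth_append simp del: replicate_Suc)
    then show ?thesis by (simp add: t_def hpair_def del: replicate_Suc)
  qed
  have "mode_sum l (replicate (Suc k) (False, \<phi>)) \<theta> ?v (Suc k) = (\<Sum>p<length ?v. t p)"
    unfolding t_def replicate_Suc[of k "(False, \<phi>)"] mode_sum.simps by (simp add: assms del: replicate_Suc)
  also have "{..<length ?v} = {..<Suc k} \<union> {Suc k..<Suc k + Q}" by auto
  also have "(\<Sum>p\<in>{..<Suc k} \<union> {Suc k..<Suc k + Q}. t p) = (\<Sum>p<Suc k. t p) + (\<Sum>p\<in>{Suc k..<Suc k + Q}. t p)"
    by (rule sum.union_disjoint) auto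
  also have "\<dots> = (\<Sum>p<Suc k. scl (2 * l * \<phi> 1 * \<eta> (- 1)) ?S)" using t1 t2 by simp
  also have "\<dots> = scl (of_nat (Suc k) * (2 * l * \<phi> 1 * \<eta> (- 1))) ?S"
    by (simp only: sum_constant_scale card_lessThan scale_scale)
  finally show ?case unfolding Suc.IH by (simp add: mult_ac)
qed

end

text \<open>The coefficients are chosen so that the first combination loses its modes of index \<open>1,\<dots>,P\<close> and the second
  one its zero mode.\<close>

definition plus_letter :: "nat \<Rightarrow> bool \<times> (complex \<times> nat) list" where
  "plus_letter P = (True, map (\<lambda>k. (of_nat (Suc P choose (P - k)), Suc k)) [0..<Suc P])"

definition minus_letter :: "bool \<times> (complex \<times> nat) list" where
  "minus_letter = (False, [(1, 2), (1, 1)])"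

text \<open>The coefficients of \<open>plus_letter\<close> are those for which Vandermonde's
  identity sums the mode coefficients to binomial(P-n, P). This is 1 for n = 0 and vanishes for 1
  \<le> n \<le> P.\<close>

lemma comb_fun_plus_letter: "snd (comb_fun (plus_letter P)) (int n) = of_int (int P - int n) gchoose P"
proof -
  have "snd (comb_fun (plus_letter P)) (int n) = (\<Sum>k\<le>P. (of_int (- int n - 1) gchoose k) * (of_nat (Suc P) gchoose (P - k)))"
    unfolding comb_fun_def plus_letter_def letter_fun_def
    by (simp add: comp_def interv_sum_list_conv_sum_set_nat atLeast0LessThan lessThan_Suc_atMost binomial_gbinomial[symmetric] mult.commute
        del: upt_Suc of_nat_Suc)
  also have "\<dots> = (of_int (- int n - 1) + of_nat (Suc P)) gchoose P"
    using gbinomial_Vandermonde[of "of_int (- int n - 1) :: complex" "of_nat (Suc P)" P] by (simp add: atLeast0AtMost)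
  also have "(of_int (- int n - 1) :: complex) + of_nat (Suc P) = of_int (int P - int n)" by simp
  finally show ?thesis .
qed

lemma comb_fun_plus_letter_0: "snd (comb_fun (plus_letter P)) 0 = 1"
  using comb_fun_plus_letter[of P 0] by (simp add: binomial_gbinomial[symmetric])

lemma comb_fun_plus_letter_pos: "1 \<le> n \<Longrightarrow> n \<le> P \<Longrightarrow> snd (comb_fun (plus_letter P)) (int n) = 0"
proof -
  assume "1 \<le> n" "n \<le> P"
  then have "(of_int (int P - int n) :: complex) = of_nat (P - n)" "P - n < P" by (simp_all add: of_nat_diff)
  then show ?thesis by (metis comb_fun_plus_letter binomial_gbinomial binomial_eq_0 of_nat_0)
qed

text \<open>The letter of weight 2 has the mode coefficient -n-1, and adding the letter of weight 1
  cancels the constant, hence the zero mode.\<close>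

lemma comb_fun_minus_letter: "snd (comb_fun minus_letter) n = - of_int n"
  by (simp add: comb_fun_def minus_letter_def letter_fun_def)

section \<open>Splitting off a lowest weight vector\<close>

context v_module
begin

lemma submodule_decomposition:
  assumes B: "submodule scl gr Y B" and x: "x \<in> B"
  shows "\<exists>M u. finite M \<and> (\<forall>m\<in>M. u m \<in> gr m \<and> u m \<in> B) \<and> x = (\<Sum>m\<in>M. u m)"
proof -
  have sub: "subspace B" by (rule submodule_subspace[OF B])
  have "x \<in> span (\<Union>m. B \<inter> gr m)" using B x unfolding submodule_def by blast
  then show ?thesis
  proof (induction rule: span_induct_alt)
    case base
    show ?case by (rule exI[of _ "{}"]) simp
  next
    case (step c y x)
    from step(1) obtain k where y: "y \<in> gr k" "y \<in> B" by auto
    from step(2) obtain M u where M: "finite M" "\<forall>m\<in>M. u m \<in> gr m \<and> u m \<in> B" "x = (\<Sum>m\<in>M. u m)" by auto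
    define u' where "u' j = (if j = k then scl c y + (if k \<in> M then u k else 0) else u j)" for j
    have "(\<Sum>j\<in>insert k M. u' j) = u' k + (\<Sum>j\<in>M - {k}. u j)"
      using M by (simp add: sum.insert_remove u'_def)
    also have "\<dots> = scl c y + x"
      using M by (cases "k \<in> M") (simp_all add: u'_def sum.remove)
    finally show ?case
      using M y by (intro exI[of _ "insert k M"] exI[of _ u'])
        (auto simp: u'_def intro!: subspace_add[OF subspace_gr] subspace_scale[OF subspace_gr] subspace_0[OF subspace_gr]
          subspace_add[OF sub] subspace_scale[OF sub] subspace_0[OF sub])
  qed
qed

lemma decomposition_unique:
  assumes "finite M" "\<And>m. m \<in> M \<Longrightarrow> u m \<in> gr m" "finite M'" "\<And>m. m \<in> M' \<Longrightarrow> u' m \<in> gr m"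
    and eq: "(\<Sum>m\<in>M. u m) = (\<Sum>m\<in>M'. u' m)" and k: "k \<in> M"
  shows "u k = (if k \<in> M' then u' k else 0)"
proof -
  define t where "t m = (if m \<in> M then u m else 0) - (if m \<in> M' then u' m else 0)" for m
  have "(\<Sum>m\<in>M \<union> M'. if m \<in> M then u m else 0) = (\<Sum>m\<in>M. u m)"
    using assms(1,3) by (intro sum.mono_neutral_cong_right) auto
  moreover have "(\<Sum>m\<in>M \<union> M'. if m \<in> M' then u' m else 0) = (\<Sum>m\<in>M'. u' m)"
    using assms(1,3) by (intro sum.mono_neutral_cong_right) auto
  ultimately have "(\<Sum>m\<in>M \<union> M'. t m) = 0" using eq by (simp add: t_def sum_subtractf)
  moreover have "t m \<in> gr m" for m
    unfolding t_def using assms(2,4) by (auto intro!: subspace_diff[OF subspace_gr] subspace_neg[OF subspace_gr] subspace_0[OF subspace_gr])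
  ultimately have "t k = 0" using assms(1,3) k by (intro gr_independent[of "M \<union> M'" t k]) auto
  then show ?thesis using k by (simp add: t_def)
qed

lemma submodule_components:
  assumes B: "submodule scl gr Y B" and M: "finite M" "\<And>m. m \<in> M \<Longrightarrow> u m \<in> gr m"
    and x: "(\<Sum>m\<in>M. u m) \<in> B" and k: "k \<in> M"
  shows "u k \<in> B"
proof -
  obtain M' u' where M': "finite M'" "\<forall>m\<in>M'. u' m \<in> gr m \<and> u' m \<in> B" "(\<Sum>m\<in>M. u m) = (\<Sum>m\<in>M'. u' m)"
    using submodule_decomposition[OF B x] by blast
  have u': "u' m \<in> gr m" if "m \<in> M'" for m using M'(2) that by blast
  have "u k = (if k \<in> M' then u' k else 0)"
    by (rule decomposition_unique[OF M M'(1) u' M'(3) k])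
  then show ?thesis using M'(2) subspace_0[OF submodule_subspace[OF B]] by auto
qed

lemma submoduleI:
  assumes "subspace B" and dec: "\<And>x. x \<in> B \<Longrightarrow> \<exists>M u. finite M \<and> (\<forall>m\<in>M. u m \<in> gr m \<and> u m \<in> B) \<and> x = (\<Sum>m\<in>M. u m)"
    and "\<And>v n x. v \<in> Vsp \<Longrightarrow> x \<in> B \<Longrightarrow> Y v n x \<in> B"
  shows "submodule scl gr Y B"
  unfolding submodule_def
proof (intro conjI subsetI)
  fix x assume "x \<in> B"
  then obtain M u where M: "\<forall>m\<in>M. u m \<in> gr m \<and> u m \<in> B" and x: "x = (\<Sum>m\<in>M. u m)" using dec by blast
  show "x \<in> span (\<Union>m. B \<inter> gr m)" unfolding x by (rule span_sum, rule span_base) (use M in auto)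
qed (use assms in auto)

lemma submodule_Int:
  assumes A: "submodule scl gr Y A" and B: "submodule scl gr Y B"
  shows "submodule scl gr Y (A \<inter> B)"
proof (rule submoduleI)
  show "subspace (A \<inter> B)" using A B by (intro subspace_inter submodule_subspace)
  fix x assume x: "x \<in> A \<inter> B"
  then obtain M u where M: "finite M" "\<forall>m\<in>M. u m \<in> gr m \<and> u m \<in> A" "x = (\<Sum>m\<in>M. u m)"
    using submodule_decomposition[OF A] by blast
  have "u m \<in> B" if "m \<in> M" for m
    by (rule submodule_components[OF B M(1) _ _ that]) (use M x in auto)
  then show "\<exists>M u. finite M \<and> (\<forall>m\<in>M. u m \<in> gr m \<and> u m \<in> A \<inter> B) \<and> x = (\<Sum>m\<in>M. u m)"
    using M by (intro exI[of _ M] exI[of _ u]) auto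
qed (use A B submodule_Y in auto)

lemma submodule_sum:
  assumes A: "submodule scl gr Y A" and B: "submodule scl gr Y B"
  shows "submodule scl gr Y {a + b | a b. a \<in> A \<and> b \<in> B}"
proof -
  note sA = submodule_subspace[OF A] and sB = submodule_subspace[OF B]
  define N where "N = {a + b | a b. a \<in> A \<and> b \<in> B}"
  have N: "x \<in> N \<longleftrightarrow> (\<exists>a\<in>A. \<exists>b\<in>B. x = a + b)" for x unfolding N_def by blast
  have sub: "subspace N" unfolding N_def by (rule subspace_sums[OF sA sB])
  have AN: "A \<subseteq> N" and BN: "B \<subseteq> N" using N subspace_0[OF sA] subspace_0[OF sB] by force+
  have "submodule scl gr Y N"
    unfolding submodule_def
  proof (intro conjI ballI allI subsetI)
    show "subspace N" by (rule sub)
    fix x assume "x \<in> N"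
    then obtain a b where x: "x = a + b" "a \<in> A" "b \<in> B" using N by blast
    have ab: "a \<in> span (\<Union>m. A \<inter> gr m)" "b \<in> span (\<Union>m. B \<inter> gr m)" using A B x(2,3) unfolding submodule_def by blast+
    have "(\<Union>m. A \<inter> gr m) \<subseteq> (\<Union>m. N \<inter> gr m)" "(\<Union>m. B \<inter> gr m) \<subseteq> (\<Union>m. N \<inter> gr m)" using AN BN by auto
    from subsetD[OF span_mono[OF this(1)] ab(1)] subsetD[OF span_mono[OF this(2)] ab(2)]
    show "x \<in> span (\<Union>m. N \<inter> gr m)" unfolding x(1) by (rule span_add)
  next
    fix v n x assume v: "v \<in> Vsp" and "x \<in> N"
    then obtain a b where x: "x = a + b" "a \<in> A" "b \<in> B" using N by blast
    then show "Y v n x \<in> N"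
      using v submodule_Y[OF A v x(2), of n] submodule_Y[OF B v x(3), of n] N by (auto simp: Y_add)
  qed
  then show ?thesis unfolding N_def .
qed

lemma submodule_sum_component:
  assumes A: "submodule scl gr Y A" and B: "submodule scl gr Y B"
    and x: "x \<in> gr k" "x = a + b" "a \<in> A" "b \<in> B"
  shows "\<exists>a' b'. a' \<in> A \<inter> gr k \<and> b' \<in> B \<inter> gr k \<and> x = a' + b'"
proof -
  obtain M u where M: "finite M" "\<forall>m\<in>M. u m \<in> gr m \<and> u m \<in> A" "a = (\<Sum>m\<in>M. u m)"
    using submodule_decomposition[OF A x(3)] by blast
  obtain M' u' where M': "finite M'" "\<forall>m\<in>M'. u' m \<in> gr m \<and> u' m \<in> B" "b = (\<Sum>m\<in>M'. u' m)"
    using submodule_decomposition[OF B x(4)] by blast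
  define U where "U m = (if m \<in> M then u m else 0)" for m
  define U' where "U' m = (if m \<in> M' then u' m else 0)" for m
  have U: "U m \<in> gr m" "U m \<in> A" "U' m \<in> gr m" "U' m \<in> B" for m
    using M(2) M'(2) by (auto simp: U_def U'_def subspace_0[OF subspace_gr] subspace_0[OF submodule_subspace[OF A]] subspace_0[OF submodule_subspace[OF B]])
  let ?N = "insert k (M \<union> M')"
  have fin: "finite ?N" using M M' by simp
  have "a = (\<Sum>m\<in>?N. U m)" unfolding M(3) U_def using fin by (intro sum.mono_neutral_cong_left) auto
  moreover have "b = (\<Sum>m\<in>?N. U' m)" unfolding M'(3) U'_def using fin by (intro sum.mono_neutral_cong_left) auto
  ultimately have eq: "(\<Sum>m\<in>?N. U m + U' m) = (\<Sum>m\<in>{k}. x)" using x(2) by (simp add: sum.distrib)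
  have "U k + U' k = (if k \<in> {k} then x else 0)"
    by (rule decomposition_unique[OF fin _ _ _ eq, of k]) (use U x(1) in \<open>auto intro: subspace_add[OF subspace_gr]\<close>)
  then show ?thesis using U[of k] by (intro exI[of _ "U k"] exI[of _ "U' k"]) auto
qed

lemma span_orbit_gr:
  assumes X: "\<And>x. x \<in> X \<Longrightarrow> \<exists>m. x \<in> gr m" and y: "y \<in> gen X" "y \<in> gr m"
  shows "y \<in> span (orbit X \<inter> gr m)"
  using span_homogeneous[of "orbit X" y m] orbit_homogeneous[OF X] y unfolding gen_def by blast

text \<open>For reasons of weight only one mode of a word can lead between two given
  degrees.\<close>

lemma orbit_gr_cases:
  assumes "good z" "x \<in> gr (m + of_int i)" "Yw z k x \<in> gr (m + of_int j)"
  shows "Yw z k x = 0 \<or> k = int (wt z) - 1 + i - j"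
proof (cases "k = int (wt z) - 1 + i - j")
  case False
  have "Yw z k x \<in> gr (m + of_int (i + int (wt z) - k - 1))"
    using Yw_gr[OF assms(1,2), of k] by (simp add: algebra_simps)
  moreover have "m + of_int (i + int (wt z) - k - 1) \<noteq> m + (of_int j :: complex)"
    using False unfolding add_left_cancel of_int_eq_iff by linarith
  ultimately show ?thesis using gr_eq_zero assms(3) by blast
qed simp

end

section \<open>Modules filtered by simple factors with one common eigenvalue\<close>

text \<open>Of the factors W(\<lambda>,[\<mu>]) only two properties are kept: each is simple, and
  each contains a nonzero lowest weight vector that \<open>shifted_Lap P\<close> kills.\<close>

locale eigen_series = lw_module l scl gr Y d D K \<mu> \<rho>
  for l :: complex and scl :: "complex \<Rightarrow> 'w \<Rightarrow> 'w::ab_group_add" and gr :: "complex \<Rightarrow> 'w set"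
    and Y :: "'w vops" and d D :: "'w \<Rightarrow> 'w" and K :: real and \<mu> :: complex and \<rho> :: "tensor \<Rightarrow> 'w \<Rightarrow> 'w" +
  fixes P n :: nat and Ws :: "nat \<Rightarrow> 'w set"
  assumes P: "P \<ge> 1" and n: "n \<ge> 2" and l: "l \<noteq> 0" and K: "K \<noteq> 0"
    and Ws: "\<And>i. i \<in> {1..n+1} \<Longrightarrow> submodule scl gr Y (Ws i)" "Ws 1 = UNIV" "Ws (n + 1) = {0}"
      "\<And>i. i \<in> {1..n} \<Longrightarrow> Ws (i + 1) \<subseteq> Ws i"
    and simple: "\<And>i B. i \<in> {1..n} \<Longrightarrow> submodule scl gr Y B \<Longrightarrow> Ws (i + 1) \<subseteq> B \<Longrightarrow> B \<subseteq> Ws i \<Longrightarrow> B = Ws (i + 1) \<or> B = Ws i"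
    and generator: "\<And>i. i \<in> {1..n} \<Longrightarrow> \<exists>f. f \<in> Ws i \<and> f \<in> gr \<mu> \<and> f \<notin> Ws (i + 1) \<and> shifted_Lap P f \<in> Ws (i + 1)"
begin

text \<open>Induction up the series. If \<open>M'\<close> has a nonzero image in a factor, it fills
  the factor by simplicity and so contains a lowest weight vector that is nonzero there. This vector
  lies in \<open>M\<close>, so \<open>M\<close> fills the factor too, and the difference of two
  representatives lies one step further down.\<close>

lemma submodule_subset:
  assumes M: "submodule scl gr Y M" and M': "submodule scl gr Y M'" and sub: "M \<subseteq> M'" and low: "M' \<inter> gr \<mu> \<subseteq> M"
  shows "M' \<subseteq> M"
proof -
  have "M' \<inter> Ws (n + 1 - j) \<subseteq> M" if "j \<le> n" for j
    using that
  proof (induction j)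
    case 0
    then show ?case using Ws(3) subspace_0[OF submodule_subspace[OF M]] by auto
  next
    case (Suc j)
    define i where "i = n - j"
    have i: "i \<in> {1..n}" "n + 1 - Suc j = i" "n + 1 - j = i + 1" using Suc.prems by (auto simp: i_def)
    have IH: "M' \<inter> Ws (i + 1) \<subseteq> M" using Suc i by simp
    have W: "submodule scl gr Y (Ws i)" "submodule scl gr Y (Ws (i + 1))" using Ws(1) i by auto
    \<comment> \<open>By simplicity a submodule either vanishes in the factor \<open>i\<close> or
      fills it.\<close>
    have key: "Ws i = {a + b | a b. a \<in> Ws (i + 1) \<and> b \<in> B \<inter> Ws i}"
      if B: "submodule scl gr Y B" "\<not> B \<inter> Ws i \<subseteq> Ws (i + 1)" for B
    proof -
      let ?N = "{a + b | a b. a \<in> Ws (i + 1) \<and> b \<in> B \<inter> Ws i}"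
      note BI = submodule_Int[OF B(1) W(1)]
      have N: "submodule scl gr Y ?N" by (rule submodule_sum[OF W(2) BI])
      have "Ws (i + 1) \<subseteq> ?N" using subspace_0[OF submodule_subspace[OF BI]] by force
      moreover have "?N \<subseteq> Ws i" using Ws(4)[OF i(1)] subspace_add[OF submodule_subspace[OF W(1)]] by auto
      ultimately consider "?N = Ws (i + 1)" | "?N = Ws i" using simple[OF i(1) N] by blast
      then show ?thesis
      proof cases
        case 1
        have "B \<inter> Ws i \<subseteq> ?N" using subspace_0[OF submodule_subspace[OF W(2)]] by force
        then show ?thesis using B(2) unfolding 1 by contradiction
      qed (rule sym)
    qed
    show ?case
    proof (cases "M' \<inter> Ws i \<subseteq> Ws (i + 1)")
      case True
      then show ?thesis using IH i by auto
    next
      case False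
      obtain f where f: "f \<in> Ws i" "f \<in> gr \<mu>" "f \<notin> Ws (i + 1)" using generator[OF i(1)] by blast
      then obtain a b where "f = a + b" "a \<in> Ws (i + 1)" "b \<in> M' \<inter> Ws i" using key[OF M' False] by blast
      then obtain a' b' where ab: "a' \<in> Ws (i + 1)" "b' \<in> M' \<inter> Ws i" "b' \<in> gr \<mu>" "f = a' + b'"
        using submodule_sum_component[OF W(2) submodule_Int[OF M' W(1)] f(2)] by blast
      then have "b' \<in> M \<inter> Ws i" "b' \<notin> Ws (i + 1)"
        using low f(3) subspace_add[OF submodule_subspace[OF W(2)]] by auto
      then have eq: "Ws i = {a + b | a b. a \<in> Ws (i + 1) \<and> b \<in> M \<inter> Ws i}" using key[OF M] by blast
      show ?thesis
      proof
        fix y assume y: "y \<in> M' \<inter> Ws (n + 1 - Suc j)"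
        then have "y \<in> Ws i" unfolding i by blast
        then obtain a b where ab: "y = a + b" "a \<in> Ws (i + 1)" "b \<in> M \<inter> Ws i"
          using subsetD[OF equalityD1[OF eq]] by blast
        have "y - b \<in> M'" by (rule subspace_diff[OF submodule_subspace[OF M']]) (use y ab sub in auto)
        then have "a \<in> M'" using ab(1) by simp
        then have "a \<in> M" using IH ab by blast
        then show "y \<in> M" using ab subspace_add[OF submodule_subspace[OF M]] by auto
      qed
    qed
  qed
  from this[of n] show ?thesis using Ws(2) by simp
qed

text \<open>Only zero modes lead from \<open>gr \<mu>\<close> back to it, and they are products of
  shifted Laplacians, which act on \<open>X\<close> by scalars modulo \<open>B\<close>.\<close>

lemma gen_gr_eigen:
  assumes B: "submodule scl gr Y B" and X: "X \<subseteq> gr \<mu>" "\<And>x. x \<in> X \<Longrightarrow> shifted_Lap P x \<in> B"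
    and y: "y \<in> gen X" "y \<in> gr \<mu>"
  shows "\<exists>x\<in>span X. y - x \<in> B"
proof -
  note sB = submodule_subspace[OF B]
  have "y \<in> span (orbit X \<inter> gr \<mu>)" using span_orbit_gr[of X y \<mu>] X(1) y by blast
  then show ?thesis
  proof (induction rule: span_induct_alt)
    case base
    show ?case using subspace_0[OF sB] by (intro bexI[of _ 0]) (auto simp: span_zero)
  next
    case (step c h y')
    from step(2) obtain x' where x': "x' \<in> span X" "y' - x' \<in> B" by blast
    from step(1) obtain z k x where h: "h = Yw z k x" "good z" "x \<in> X" "Yw z k x \<in> gr \<mu>" by (auto simp: orbit_def)
    then have xg: "x \<in> gr \<mu>" using X by blast
    have "\<exists>x1\<in>span X. h - x1 \<in> B"
    proof -
      from orbit_gr_cases[of z x \<mu> 0 k 0] h xg consider "h = 0" | "k = int (wt z) - 1" by auto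
      then show ?thesis
      proof cases
        case 1
        then show ?thesis using subspace_0[OF sB] by (intro bexI[of _ 0]) (auto simp: span_zero)
      next
        case 2
        let ?z = "map fst z"
        have bal: "balanced ?z" using h by (simp add: good_def)
        define \<kappa> where "\<kappa> = (\<Prod>p\<leftarrow>descents ?z. gap P p)"
        have "h = scl (word_sign z) (foldr shifted_Lap (descents ?z) x)"
          using zero_mode_word[OF h(2) xg] bal act_eq_foldr[OF bal xg] h 2 by (simp add: eval_word_def)
        then have "h - scl (word_sign z * \<kappa>) x = scl (word_sign z) (foldr shifted_Lap (descents ?z) x - scl \<kappa> x)"
          by (simp add: algebra_simps)
        also have "\<dots> \<in> B"
          using foldr_shifted_Lap_mod[OF B xg X(2)[OF h(3)], of "descents ?z"] unfolding \<kappa>_def by (rule subspace_scale[OF sB])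
        finally show ?thesis using h(3) by (intro bexI[of _ "scl (word_sign z * \<kappa>) x"]) (auto intro: span_scale span_base)
      qed
    qed
    then obtain x1 where x1: "x1 \<in> span X" "h - x1 \<in> B" by blast
    have "(scl c h + y') - (scl c x1 + x') = scl c (h - x1) + (y' - x')" by (simp add: algebra_simps)
    also have "\<dots> \<in> B" using x1 x' by (intro subspace_add[OF sB] subspace_scale[OF sB])
    finally show ?case using x1 x' by (intro bexI[of _ "scl c x1 + x'"]) (auto intro: span_add span_scale)
  qed
qed

lemma shifted_Lap_linear:
  "x \<in> gr \<mu> \<Longrightarrow> y \<in> gr \<mu> \<Longrightarrow> shifted_Lap p (x + y) = shifted_Lap p x + shifted_Lap p y"
  "x \<in> gr \<mu> \<Longrightarrow> shifted_Lap p (scl c x) = scl c (shifted_Lap p x)"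
  by (simp_all add: shifted_Lap_def Lap_add Lap_scale algebra_simps)

text \<open>Modulo \<open>Ws (i + 1)\<close> the given vector \<open>f\<close> generates
  \<open>Ws i\<close>, so by \<open>gen_gr_eigen\<close> all lowest weight vectors there are
  multiples of \<open>f\<close>.\<close>

lemma shifted_Lap_descends:
  assumes i: "i \<in> {1..n}" and y: "y \<in> Ws i" "y \<in> gr \<mu>"
  shows "shifted_Lap P y \<in> Ws (i + 1)"
proof -
  obtain f where f: "f \<in> Ws i" "f \<in> gr \<mu>" "f \<notin> Ws (i + 1)" "shifted_Lap P f \<in> Ws (i + 1)" using generator[OF i] by blast
  have W: "submodule scl gr Y (Ws i)" "submodule scl gr Y (Ws (i + 1))" using Ws(1) i by auto
  note sW = submodule_subspace[OF W(2)]
  have G: "submodule scl gr Y (gen {f})" by (rule submodule_gen) (use f in blast)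
  let ?N = "{a + b | a b. a \<in> Ws (i + 1) \<and> b \<in> gen {f}}"
  have fN: "f \<in> ?N" using gen_base[of f "{f}"] subspace_0[OF sW] by force
  have "Ws (i + 1) \<subseteq> ?N" using subspace_0[OF submodule_subspace[OF G]] by force
  moreover have "?N \<subseteq> Ws i" using Ws(4)[OF i] gen_subset[OF W(1), of "{f}"] f(1) subspace_add[OF submodule_subspace[OF W(1)]] by blast
  ultimately consider "?N = Ws (i + 1)" | "?N = Ws i" using simple[OF i submodule_sum[OF W(2) G]] by blast
  then have "?N = Ws i"
  proof cases
    case 1
    show ?thesis using fN f(3) unfolding 1 by contradiction
  qed
  then obtain a b where "y = a + b" "a \<in> Ws (i + 1)" "b \<in> gen {f}" using y by blast
  then obtain a b where ab: "a \<in> Ws (i + 1)" "a \<in> gr \<mu>" "b \<in> gen {f}" "b \<in> gr \<mu>" "y = a + b"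
    using submodule_sum_component[OF W(2) G y(2)] by blast
  obtain x where x: "x \<in> span {f}" "b - x \<in> Ws (i + 1)"
    using gen_gr_eigen[OF W(2), of "{f}" b] f ab by auto
  then obtain c where c: "x = scl c f" by (auto simp: span_singleton)
  have xg: "scl c f \<in> gr \<mu>" using f(2) by (rule subspace_scale[OF subspace_gr])
  define r where "r = a + (b - scl c f)"
  have "b - scl c f \<in> Ws (i + 1)" using x(2) by (simp only: c)
  then have r1: "r \<in> Ws (i + 1)" unfolding r_def by (rule subspace_add[OF sW ab(1)])
  have r2: "r \<in> gr \<mu>"
    unfolding r_def by (rule subspace_add[OF subspace_gr ab(2) subspace_diff[OF subspace_gr ab(4) xg]])
  note r = r1 r2
  have "y = r + scl c f" by (simp add: r_def ab)
  then have "shifted_Lap P y = shifted_Lap P r + scl c (shifted_Lap P f)"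
    using r xg f by (simp add: shifted_Lap_linear)
  also have "\<dots> \<in> Ws (i + 1)"
    by (intro subspace_add[OF sW] subspace_scale[OF sW] f shifted_Lap_in_submodule[OF W(2) r])
  finally show ?thesis .
qed

lemma gap_nonzero: "i \<in> {1..P-1} \<Longrightarrow> gap P i \<noteq> 0"
proof -
  assume i: "i \<in> {1..P-1}"
  have "real i * (real i - 1) \<noteq> real P * (real P - 1)"
  proof
    assume "real i * (real i - 1) = real P * (real P - 1)"
    then have "(real P - real i) * (real P + real i - 1) = 0" by (simp add: algebra_simps)
    then show False using i by auto
  qed
  then have "real i * (real i - 1) * K \<noteq> real P * (real P - 1) * K" using K by simp
  then show ?thesis unfolding gap_def using of_real_eq_iff[where ?'a = complex] by (metis right_minus_eq)
qed

definition lowering :: "'w \<Rightarrow> 'w" where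
  "lowering x = (\<Sum>(c, u)\<leftarrow>expand (replicate P (plus_letter P) @ replicate P minus_letter).
     scl c (Yw u (int (wt u) - 1 + int P) x))"

lemma expand_good:
  "(c, u) \<in> set (expand (replicate P (plus_letter P) @ replicate P minus_letter)) \<Longrightarrow> good u"
proof -
  assume "(c, u) \<in> set (expand (replicate P (plus_letter P) @ replicate P minus_letter))"
  then have "proper_word u \<and> map fst u = map fst (replicate P (plus_letter P) @ replicate P minus_letter)"
    by (rule expand_letters) (auto simp: plus_letter_def minus_letter_def split: if_splits)
  then show ?thesis
    by (simp add: good_def balanced_iff_charge plus_letter_def minus_letter_def)
qed

lemma lowering_add: "lowering (x + y) = lowering x + lowering y"
proof -
  have "(\<Sum>(c, u)\<leftarrow>E. scl c (Yw u (int (wt u) - 1 + int P) (x + y))) =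
    (\<Sum>(c, u)\<leftarrow>E. scl c (Yw u (int (wt u) - 1 + int P) x)) + (\<Sum>(c, u)\<leftarrow>E. scl c (Yw u (int (wt u) - 1 + int P) y))"
    if "\<forall>p\<in>set E. good (snd p)" for E
    using that by (induction E) (auto simp: Y_add single_in_Vsp scale_right_distrib)
  from this[of "expand (replicate P (plus_letter P) @ replicate P minus_letter)"]
  show ?thesis unfolding lowering_def using expand_good by fastforce
qed

lemma lowering_scale: "lowering (scl k x) = scl k (lowering x)"
proof -
  have "(\<Sum>(c, u)\<leftarrow>E. scl c (Yw u (int (wt u) - 1 + int P) (scl k x))) =
    scl k (\<Sum>(c, u)\<leftarrow>E. scl c (Yw u (int (wt u) - 1 + int P) x))"
    if "\<forall>p\<in>set E. good (snd p)" for E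
    using that by (induction E) (auto simp: Y_scale single_in_Vsp scale_right_distrib mult.commute)
  from this[of "expand (replicate P (plus_letter P) @ replicate P minus_letter)"]
  show ?thesis unfolding lowering_def using expand_good by fastforce
qed

text \<open>In each combination \<open>plus_letter P\<close> only the zero mode can contribute at
  this depth, so these letters put \<open>h+\<close> P times in front of every word.\<close>

lemma lowering_raised:
  assumes v: "good v" and x: "x \<in> gr \<mu>"
  shows "lowering (Yw v (int (wt v) - 1 - int P) x) =
    mode_sum l (replicate P (False, \<lambda>n. - of_int n)) (\<lambda>z. eval_word x (replicate P True @ z)) (map letter_fun v) P"
proof -
  let ?E = "expand (replicate P (plus_letter P) @ replicate P minus_letter)"
  have "lowering (Yw v (int (wt v) - 1 - int P) x) = (\<Sum>(c, u)\<leftarrow>?E. scl c (mode_sum l (map letter_fun u) (eval_word x) (map letter_fun v) P))"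
    unfolding lowering_def
    by (intro arg_cong[where f = sum_list] map_cong refl) (auto simp: matrix_coefficient[OF expand_good v x])
  also have "\<dots> = mode_sum l (map comb_fun (replicate P (plus_letter P) @ replicate P minus_letter)) (eval_word x) (map letter_fun v) P"
    by (rule mode_sum_expand)
  also have "map comb_fun (replicate P (plus_letter P) @ replicate P minus_letter)
    = replicate P (True, snd (comb_fun (plus_letter P))) @ replicate P (False, \<lambda>n. - of_int n)"
  proof -
    have "comb_fun (plus_letter P) = (True, snd (comb_fun (plus_letter P)))" by (simp add: prod_eq_iff plus_letter_def)
    moreover have "comb_fun minus_letter = (False, \<lambda>n. - of_int n)"
      by (simp add: prod_eq_iff fun_eq_iff comb_fun_minus_letter) (simp add: minus_letter_def)
    ultimately show ?thesis by simp
  qed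
  also have "mode_sum l \<dots> (eval_word x) (map letter_fun v) P =
    mode_sum l (replicate P (False, \<lambda>n. - of_int n)) (\<lambda>z. eval_word x (replicate P True @ z)) (map letter_fun v) P"
    by (rule mode_sum_zero_modes_only) (simp_all add: comb_fun_plus_letter_0 comb_fun_plus_letter_pos)
  finally show ?thesis .
qed

text \<open>The weight \<open>Suc P\<close> is chosen because the mode -k of such a letter has the
  coefficient binomial(k-1, P), which is 0 for 1 \<le> k \<le> P: at depth P these letters act by
  their zero modes only.\<close>

definition raising_word :: fword where
  "raising_word = replicate P (True, 1) @ replicate P (False, Suc P)"

lemma good_raising_word: "good raising_word"
  by (auto simp: good_def raising_word_def proper_word_def balanced_iff_charge)

lemma letters_raising_word:
  "map letter_fun raising_word = replicate P (True, \<lambda>n. 1) @ replicate P (False, \<lambda>n. of_int (- n - 1) gchoose P)"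
  by (simp add: raising_word_def letter_fun_def)

text \<open>The vector \<open>X\<close> plays the role of \<open>h\<^sub>+(-1)\<^sup>P h\<^sub>-(0)\<^sup>P w\<close>, and \<open>lowering\<close> that of \<open>h\<^sub>-(1)\<^sup>P h\<^sub>+(0)\<^sup>P\<close>.\<close>

lemma no_Jordan_block:
  assumes w: "w \<in> gr \<mu>" and w0: "shifted_Lap P (shifted_Lap P w) = 0"
  shows "shifted_Lap P w = 0"
proof (rule ccontr)
  define w\<^sub>0 where "w\<^sub>0 = shifted_Lap P w"
  define X where "X = Yw raising_word (int (wt raising_word) - 1 - int P) w"
  assume "shifted_Lap P w \<noteq> 0"
  then have nz: "w\<^sub>0 \<noteq> 0" by (simp add: w\<^sub>0_def)
  have w0g: "w\<^sub>0 \<in> gr \<mu>" unfolding w\<^sub>0_def by (rule shifted_Lap_gr[OF w])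
  have Xg: "X \<in> gr (\<mu> + of_int (int P))" unfolding X_def by (rule raised_gr[OF good_raising_word w])
  have hom: "\<And>x. x \<in> {w\<^sub>0} \<Longrightarrow> \<exists>m. x \<in> gr m" "\<And>x. x \<in> {w\<^sub>0, X} \<Longrightarrow> \<exists>m. x \<in> gr m" using w0g Xg by auto
  have M: "submodule scl gr Y (gen {w\<^sub>0})" and M': "submodule scl gr Y (gen {w\<^sub>0, X})"
    by (rule submodule_gen[OF hom(1)], assumption, rule submodule_gen[OF hom(2)])
  note sM = submodule_subspace[OF M]
  have w0M: "w\<^sub>0 \<in> gen {w\<^sub>0}" by (rule gen_base) simp
  \<comment> \<open>Modulo the submodule of \<open>w\<^sub>0\<close> the vector \<open>w\<close> is
    an eigenvector, and the suffix makes every balanced word of this form cross height P.\<close>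
  have eval_M: "eval_word w (y @ replicate P False) \<in> gen {w\<^sub>0}" for y
    by (rule act_crossing_in_submodule[OF M w _ P]) (use w0M in \<open>simp_all add: w\<^sub>0_def\<close>)
  \<comment> \<open>Adjoining \<open>X\<close> produces no new lowest weight vectors, hence nothing
    new at all.\<close>
  have "gen {w\<^sub>0, X} \<subseteq> gen {w\<^sub>0}"
  proof (rule submodule_subset[OF M M'])
    show "gen {w\<^sub>0} \<subseteq> gen {w\<^sub>0, X}" by (rule gen_subset[OF M']) (auto intro: gen_base)
    show "gen {w\<^sub>0, X} \<inter> gr \<mu> \<subseteq> gen {w\<^sub>0}"
    proof
      fix y assume "y \<in> gen {w\<^sub>0, X} \<inter> gr \<mu>"
      then have "y \<in> span (orbit {w\<^sub>0, X} \<inter> gr \<mu>)" using span_orbit_gr[of "{w\<^sub>0, X}" y \<mu>, OF hom(2)] by blast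
      moreover have "orbit {w\<^sub>0, X} \<inter> gr \<mu> \<subseteq> gen {w\<^sub>0}"
      proof
        fix h assume "h \<in> orbit {w\<^sub>0, X} \<inter> gr \<mu>"
        then obtain z k x where h: "h = Yw z k x" "good z" "x = w\<^sub>0 \<or> x = X" "Yw z k x \<in> gr \<mu>" by (auto simp: orbit_def)
        show "h \<in> gen {w\<^sub>0}"
        proof (cases "x = X")
          case False
          then show ?thesis using h submodule_Y[OF M single_in_Vsp[OF h(2)] w0M] by simp
        next
          case True
          from orbit_gr_cases[of z X \<mu> "int P" k 0] h Xg True consider "h = 0" | "k = int (wt z) - 1 + int P" by auto
          then show ?thesis
          proof cases
            case 1
            show ?thesis unfolding 1 by (rule subspace_0[OF sM])
          next
            case 2
            have "h = mode_sum l (map letter_fun z) (eval_word w) (map letter_fun raising_word) P"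
              using matrix_coefficient[OF h(2) good_raising_word w, of P] h(1) True 2 by (simp add: X_def)
            \<comment> \<open>The letters of weight \<open>Suc P\<close> are not contracted, so
              every word that occurs still ends in P letters \<open>h-\<close>, as
              \<open>eval_M\<close> requires.\<close>
            also have "\<dots> \<in> gen {w\<^sub>0}"
              unfolding letters_raising_word
            proof (rule mode_sum_in_subspace[OF sM])
              show "eval_word w (y @ replicate P False) \<in> gen {w\<^sub>0}" for y by (rule eval_M)
              fix n :: nat assume "1 \<le> n" "n \<le> P"
              then have "(of_int (- (- int n) - 1) :: complex) = of_nat (n - 1)" "n - 1 < P" by auto
              then show "(of_int (- (- int n) - 1) :: complex) gchoose P = 0"
                by (metis binomial_gbinomial binomial_eq_0 of_nat_0)
            qed
            finally show ?thesis .
          qed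
        qed
      qed
      ultimately show "y \<in> gen {w\<^sub>0}" using span_minimal[OF _ sM] by blast
    qed
  qed
  then have "X \<in> gen {w\<^sub>0}" using gen_base[of X "{w\<^sub>0, X}"] by blast
  then have "X \<in> span (orbit {w\<^sub>0} \<inter> gr (\<mu> + of_int (int P)))" using span_orbit_gr[of "{w\<^sub>0}" X, OF hom(1)] Xg by blast
  then have "lowering X = 0"
  proof (induction rule: span_induct_alt)
    case base
    show ?case using lowering_scale[of 0 0] by simp
  next
    case (step c h x)
    from step(1) obtain z k where h: "h = Yw z k w\<^sub>0" "good z" "Yw z k w\<^sub>0 \<in> gr (\<mu> + of_int (int P))" by (auto simp: orbit_def)
    \<comment> \<open>The vector \<open>w\<^sub>0\<close> is a true eigenvector, so the crossing
      argument applies modulo 0; in a balanced word of this form the suffix \<open>y\<close> has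
      charge -P.\<close>
    have "eval_word w\<^sub>0 (replicate P True @ y) \<in> {0}" for y
    proof (cases "balanced (replicate P True @ y)")
      case True
      have "submodule scl gr Y {0}" using Ws(1)[of "n + 1"] Ws(3) by simp
      then show ?thesis
        by (rule act_crossing_in_submodule[OF _ w0g _ P]) (use w0 True in \<open>auto simp: w\<^sub>0_def balanced_iff_charge\<close>)
    qed (simp add: eval_word_def)
    then have 0: "eval_word w\<^sub>0 (replicate P True @ y) = 0" for y by blast
    from orbit_gr_cases[of z w\<^sub>0 \<mu> 0 k "int P"] h w0g consider "h = 0" | "k = int (wt z) - 1 - int P" by auto
    then have "lowering h = 0"
    proof cases
      case 1
      then show ?thesis using lowering_scale[of 0 0] by simp
    next
      case 2
      then show ?thesis using lowering_raised[OF h(2) w0g] mode_sum_eq_0[OF 0] by (simp add: h(1))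
    qed
    then show ?case using step(2) by (simp add: lowering_add lowering_scale)
  qed
  moreover
  \<comment> \<open>From the full contraction: -1 is the coefficient of mode 1 in
    \<open>minus_letter\<close>, 1 that of the letter of weight 1, and the last power comes from the
    zero modes of the letters of weight \<open>Suc P\<close>.\<close>
  define c\<^sub>1 where "c\<^sub>1 = fact P * (2 * l * (- 1) * 1) ^ P * ((of_int (- 0 - 1) :: complex) gchoose P) ^ P"
  define c\<^sub>2 where "c\<^sub>2 = (\<Prod>i=1..P-1. gap P i)"
  have "lowering X = scl c\<^sub>1 (eval_word w (replicate P True @ replicate P False))"
    unfolding X_def c\<^sub>1_def lowering_raised[OF good_raising_word w] letters_raising_word
    by (subst mode_sum_full_contraction) simp_all
  moreover have "eval_word w (replicate P True @ replicate P False) = scl c\<^sub>2 w\<^sub>0"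
    using act_diamond_Jordan[OF w w0 P] by (simp add: eval_word_def balanced_iff_charge w\<^sub>0_def c\<^sub>2_def)
  ultimately have "scl c\<^sub>1 (scl c\<^sub>2 w\<^sub>0) = 0" by (simp only:)
  moreover have "c\<^sub>1 \<noteq> 0" using l gbinomial_neg_of_nat[of 0 P] by (simp add: c\<^sub>1_def)
  moreover have "c\<^sub>2 \<noteq> 0" unfolding c\<^sub>2_def using gap_nonzero by (simp add: prod_zero_iff)
  ultimately show False using nz by (simp only: scale_eq_0_iff) blast
qed

lemma shifted_Lap_0 [simp]: "shifted_Lap p 0 = 0"
  using shifted_Lap_linear(2)[of 0 p 0] subspace_0[OF subspace_gr] by simp

text \<open>The series makes the operator nilpotent, and \<open>no_Jordan_block\<close> lowers the
  order of nilpotency one by one down to 1.\<close>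

lemma shifted_Lap_eq_0:
  assumes x: "x \<in> gr \<mu>"
  shows "shifted_Lap P x = 0"
proof -
  have g: "(shifted_Lap P ^^ k) x \<in> gr \<mu>" for k by (induction k) (simp_all add: x shifted_Lap_gr)
  have "(shifted_Lap P ^^ k) x \<in> Ws (k + 1)" if "k \<le> n" for k
    using that by (induction k) (use Ws(2) shifted_Lap_descends g in auto)
  from this[of n] have "(shifted_Lap P ^^ n) x = 0" using Ws(3) by simp
  moreover have "shifted_Lap P x = 0" if "(shifted_Lap P ^^ Suc k) x = 0" for k
    using that
  proof (induction k)
    case (Suc k)
    then show ?case using no_Jordan_block[OF g[of k]] by simp
  qed simp
  ultimately show ?thesis using n by (cases n) auto
qed

lemma lowest_weight_generates:
  assumes "submodule scl gr Y B" "gr \<mu> \<subseteq> B"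
  shows "B = UNIV"
proof -
  have "\<forall>B. submodule scl gr Y B \<and> gr \<mu> \<subseteq> B \<longrightarrow> B = UNIV"
    using lowest_weight unfolding lowest_weight_module_def by (elim conjE) assumption
  from this[THEN spec, THEN mp, OF conjI[OF assms]] show ?thesis .
qed

text \<open>As every lowest weight vector is now an eigenvector, the submodule generated by a set of
  them has just the span as its lowest weight space. A line and a complement in
  \<open>gr \<mu>\<close> therefore generate complementary submodules.\<close>

theorem decomposable: "\<not> indecomposable scl gr Y"
proof -
  have zero: "submodule scl gr Y {0}" using Ws(1)[of "n + 1"] Ws(3) by simp
  have gen_low: "gen X \<inter> gr \<mu> \<subseteq> span X" if "X \<subseteq> gr \<mu>" for X
    using gen_gr_eigen[OF zero that] shifted_Lap_eq_0 that by fastforce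
  \<comment> \<open>The vector \<open>w\<close> is taken from the last nonzero submodule and
    \<open>f\<close> from outside the second one, so \<open>f\<close> is no multiple of
    \<open>w\<close> and the complement of the line is not zero.\<close>
  obtain w where w: "w \<in> Ws n" "w \<in> gr \<mu>" "w \<notin> Ws (n + 1)" using generator[of n] n by auto
  obtain f where f: "f \<in> gr \<mu>" "f \<notin> Ws 2" using generator[of 1] n by (auto simp: numeral_2_eq_2)
  have "Ws n \<subseteq> Ws (n - j)" if "j < n" for j
    using that
  proof (induction j)
    case (Suc j)
    then have "Ws (n - j) \<subseteq> Ws (n - Suc j)" using Ws(4)[of "n - Suc j"] by (simp add: Suc_diff_Suc)
    then show ?case using Suc by simp
  qed simp
  from this[of "n - 2"] have W2: "Ws n \<subseteq> Ws 2" using n by simp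
  have w_nz: "w \<noteq> 0" using w(3) Ws(3) by simp
  then have "independent {w}" by simp
  then obtain Bs where Bs: "{w} \<subseteq> Bs" "Bs \<subseteq> gr \<mu>" "independent Bs" "gr \<mu> \<subseteq> span Bs"
    using maximal_independent_subset_extend[of "{w}" "gr \<mu>"] w(2) by blast
  define C where "C = Bs - {w}"
  have C: "C \<subseteq> gr \<mu>" "Bs = insert w C" using Bs by (auto simp: C_def)
  have wC: "w \<notin> span C" using Bs(1,3) unfolding C_def dependent_def by blast
  have hom: "\<exists>m. x \<in> gr m" if "x \<in> {w} \<or> x \<in> C" for x using that w C by blast
  have A: "submodule scl gr Y (gen {w})" and B: "submodule scl gr Y (gen C)"
    by (rule submodule_gen; use hom in blast)+
  have low: "gen {w} \<inter> gr \<mu> \<subseteq> span {w}" "gen C \<inter> gr \<mu> \<subseteq> span C" using gen_low w C by auto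
  \<comment> \<open>A submodule without nonzero lowest weight vectors is zero.\<close>
  have "gen {w} \<inter> gen C \<subseteq> {0}"
  proof (rule submodule_subset[OF zero submodule_Int[OF A B]])
    show "{0} \<subseteq> gen {w} \<inter> gen C" using subspace_0 submodule_subspace A B by blast
    show "gen {w} \<inter> gen C \<inter> gr \<mu> \<subseteq> {0}"
    proof
      fix x assume "x \<in> gen {w} \<inter> gen C \<inter> gr \<mu>"
      then have "x \<in> span {w}" "x \<in> span C" using low by auto
      then obtain c where c: "x = scl c w" by (auto simp: span_singleton)
      have "c = 0"
      proof (rule ccontr)
        assume "c \<noteq> 0"
        then have "w = scl (inverse c) x" by (simp add: c)
        then show False using wC span_scale[OF \<open>x \<in> span C\<close>, of "inverse c"] by simp
      qed
      then show "x \<in> {0}" by (simp add: c)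
    qed
  qed
  then have int: "gen {w} \<inter> gen C = {0}" using subspace_0 submodule_subspace A B by blast
  have "gr \<mu> \<subseteq> {a + b | a b. a \<in> gen {w} \<and> b \<in> gen C}"
  proof
    fix x assume "x \<in> gr \<mu>"
    then have "x \<in> span (insert w C)" using Bs(4) C(2) by blast
    then obtain k where k: "x - scl k w \<in> span C" by (auto simp: span_breakdown_eq)
    have "span C \<subseteq> gen C" using gen_base submodule_subspace[OF B] by (intro span_minimal) auto
    then have "x - scl k w \<in> gen C" using k by blast
    moreover have "scl k w \<in> gen {w}" using gen_base[of w "{w}"] submodule_subspace[OF A] by (intro subspace_scale) auto
    moreover have "x = scl k w + (x - scl k w)" by simp
    ultimately show "x \<in> {a + b | a b. a \<in> gen {w} \<and> b \<in> gen C}" by blast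
  qed
  then have sum: "{a + b | a b. a \<in> gen {w} \<and> b \<in> gen C} = UNIV"
    by (rule lowest_weight_generates[OF submodule_sum[OF A B]])
  have "gen {w} \<noteq> {0}" using gen_base[of w "{w}"] w_nz by blast
  moreover have "gen C \<noteq> {0}"
  proof
    assume "gen C = {0}"
    then have "C \<subseteq> {0}" using gen_base by blast
    then have "span C \<subseteq> {0}" by (intro span_minimal) auto
    have "f \<in> span (insert w C)" using Bs(4) C(2) f by blast
    then obtain k where k: "f - scl k w \<in> span C" by (auto simp: span_breakdown_eq)
    then have "f = scl k w" using \<open>span C \<subseteq> {0}\<close> by auto
    then have "f \<in> Ws 2" using w W2 n submodule_subspace[OF Ws(1)[of 2]] by (auto intro: subspace_scale)
    then show False using f by blast
  qed
  ultimately show ?thesis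
    unfolding indecomposable_def using A B int sum by blast
qed

end

section \<open>The modules attached to eigenfunctions\<close>

lemma vector_space_tfun_scale: "vector_space (tfun_scale :: complex \<Rightarrow> 'm tfun \<Rightarrow> 'm tfun)"
  by (intro vector_space_pm_scale, unfold_locales) (auto simp: fun_eq_iff algebra_simps)

lemma tfun_act_single: "tfun_act i (Poly_Mapping.single w g) = Poly_Mapping.single (i # w) g"
  by (simp add: tfun_act_def lin_ext_single)

interpretation T: fock_module "tfun_scale :: complex \<Rightarrow> 'm tfun \<Rightarrow> 'm tfun" tfun_act l for l
proof (rule fock_module.intro)
  interpret tv: vector_space "tfun_scale :: complex \<Rightarrow> 'm tfun \<Rightarrow> 'm tfun" by (rule vector_space_tfun_scale)
  show "vector_space (tfun_scale :: complex \<Rightarrow> 'm tfun \<Rightarrow> 'm tfun)" by (rule vector_space_tfun_scale)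
  show "tfun_act i (s + t) = tfun_act i s + tfun_act i t" for i and s t :: "'m tfun"
    unfolding tfun_act_def by (rule lin_ext_add) (simp_all add: single_add)
  show "tfun_act i (tfun_scale c s) = tfun_scale c (tfun_act i s)" for i c and s :: "'m tfun"
    unfolding tfun_act_def
    by (rule lin_ext_pm_scale)
      (simp_all add: pm_scale_single tv.scale_right_distrib, simp_all flip: zero_fun_def)
qed

lemma ffun_vop_add: "ffun_vop l v k (x + y) = ffun_vop l v k x + ffun_vop l v k y"
  unfolding ffun_vop_def by (rule T.fock_vop_add)

lemma ffun_vop_diff: "ffun_vop l v k (x - y) = ffun_vop l v k x - ffun_vop l v k y"
  using ffun_vop_add[of l v k "x - y" y] by (simp add: algebra_simps)

definition vacuum_tensor :: "('m \<Rightarrow> complex) \<Rightarrow> 'm ffun" where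
  "vacuum_tensor f = Poly_Mapping.single [] (Poly_Mapping.single [] f)"

lemma ffun_vop_vac: "ffun_vop l vac (-1) x = x"
  by (simp add: ffun_vop_def vac_def T.fock_vop_single T.word_mode_Nil)

lemma ffun_vop_two_letters:
  "ffun_vop l (Poly_Mapping.single [(i, 1), (j, 1)] 1) 1 (vacuum_tensor f) = Poly_Mapping.single [] (Poly_Mapping.single [i, j] f)"
proof -
  have le: "T.letters_le 0 (vacuum_tensor f)" by (simp add: T.letters_le_def vacuum_tensor_def)
  \<comment> \<open>Without letters to remove, all mode numbers are at most 0; as their sum is 0,
    only zero modes remain.\<close>
  have tuples: "mode_tuples 2 0 0 = {[0, 0]}"
  proof
    show "mode_tuples 2 0 0 \<subseteq> {[0, 0]}"
    proof
      fix ns assume "ns \<in> mode_tuples 2 0 0"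
      then obtain a b where "ns = [a, b]" "a + b = 0" "a \<le> 0" "b \<le> 0"
        by (auto simp: mode_tuples_def numeral_2_eq_2 length_Suc_conv)
      then show "ns \<in> {[0, 0]}" by auto
    qed
  qed (auto simp: mode_tuples_def)
  have "ffun_vop l (Poly_Mapping.single [(i, 1), (j, 1)] 1) 1 (vacuum_tensor f) =
     (\<Sum>ns\<in>mode_tuples 2 0 0. ffun_scale (mode_coeff [(i, 1), (j, 1)] ns) (T.op l [(i, 1), (j, 1)] ns (vacuum_tensor f)))"
    unfolding ffun_vop_def T.fock_vop_single T.word_mode_eq[OF le] by (simp add: numeral_2_eq_2)
  also have "\<dots> = T.op l [(i, 1), (j, 1)] [0, 0] (vacuum_tensor f)"
  proof -
    have "mode_coeff [(i, 1), (j, 1)] [0, 0] = 1" by simp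
    then show ?thesis unfolding tuples by (simp only: sum.insert finite.emptyI sum.empty empty_iff not_False_eq_True T.F.scale_one add_0_right)
  qed
  also have "\<dots> = Poly_Mapping.single [] (Poly_Mapping.single [i, j] f)"
    by (simp add: normal_order_def mode_def vacuum_tensor_def lin_ext_single T.e_0 tfun_act_single)
  finally show ?thesis .
qed

text \<open>The projection to degree \<open>\<mu>\<close>, as the empty word is the only proper word
  of weight 0.\<close>

definition lowest_part :: "'m ffun \<Rightarrow> 'm ffun" where
  "lowest_part x = Poly_Mapping.single [] (Poly_Mapping.lookup x [])"

lemma lowest_part_add: "lowest_part (x + y) = lowest_part x + lowest_part y"
  by (simp add: lowest_part_def lookup_add single_add)

lemma lowest_part_sum: "lowest_part (\<Sum>i\<in>I. x i) = (\<Sum>i\<in>I. lowest_part (x i))"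
  by (induction I rule: infinite_finite_induct) (simp_all add: lowest_part_add, simp_all add: lowest_part_def)

lemma lowest_part_diff: "lowest_part (x - y) = lowest_part x - lowest_part y"
  using lowest_part_add[of "x - y" y] by (simp add: algebra_simps)

lemma lowest_part_scale: "lowest_part (ffun_scale c x) = ffun_scale c (lowest_part x)"
  unfolding lowest_part_def by (simp add: lookup_pm_scale)

lemma wt_eq_0: "proper_word w \<Longrightarrow> wt w = 0 \<Longrightarrow> w = []"
  by (cases w) (auto simp: proper_word_def)

lemma lowest_part_gr:
  assumes "x \<in> ffun_gr \<mu> m"
  shows "lowest_part x = (if m = \<mu> then x else 0)"
proof (rule poly_mapping_eqI)
  fix w
  have keys: "proper_word w \<and> m = \<mu> + of_nat (wt w)" if "Poly_Mapping.lookup x w \<noteq> 0" for w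
    using assms that by (simp add: ffun_gr_def in_keys_iff)
  show "Poly_Mapping.lookup (lowest_part x) w = Poly_Mapping.lookup (if m = \<mu> then x else 0) w"
    using keys[of w] keys[of "[]"] wt_eq_0[of w]
    by (cases "Poly_Mapping.lookup x w = 0"; cases "w = []") (auto simp: lowest_part_def lookup_single)
qed

lemma subspace_fock_rel: "T.F.subspace (fock_rel S U)"
proof -
  have t: "T.S.subspace (tensor_rel S U)" unfolding tensor_rel_def by (rule T.S.subspace_span)
  show ?thesis
    unfolding T.F.subspace_def
  proof (intro conjI ballI allI)
    show "0 \<in> fock_rel S U" by (simp add: fock_rel_def)
    fix x y assume x: "x \<in> fock_rel S U" and y: "y \<in> fock_rel S U"
    have zero: "0 \<in> tensor_rel S U" by (rule T.S.subspace_0[OF t])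
    have in_rel: "Poly_Mapping.lookup z w \<in> tensor_rel S U" if "z \<in> fock_rel S U" for z w
      using that zero by (cases "w \<in> Poly_Mapping.keys z") (auto simp: fock_rel_def in_keys_iff)
    show "x + y \<in> fock_rel S U"
      using x y keys_add[of x y] T.S.subspace_add[OF t in_rel[OF x] in_rel[OF y]]
      unfolding fock_rel_def by (auto simp: lookup_add)
  next
    fix c x assume x: "x \<in> fock_rel S U"
    show "ffun_scale c x \<in> fock_rel S U"
      using x T.S.subspace_scale[OF t] T.S.scale_zero_right unfolding fock_rel_def by (auto simp: lookup_pm_scale in_keys_iff)
  qed
qed

lemma subspace_VU: "T.F.subspace (VU l S U f)"
proof -
  have "VU l S U f = {x + y | x y. x \<in> T.F.span {ffun_vop l v n (vacuum_tensor f) | v n. v \<in> Vsp} \<and> y \<in> fock_rel S U}"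
    unfolding VU_def vacuum_tensor_def by blast
  then show ?thesis using T.F.subspace_sums[OF T.F.subspace_span subspace_fock_rel] by simp
qed

lemma iso_W_obtain:
  assumes "iso_W l S scl gr Y A B lam \<mu>"
  obtains U f N \<phi> where "eigenfunction S U lam f"
    "submodule ffun_scale (ffun_gr \<mu>) (ffun_vop l) N" "fock_rel S U \<subseteq> N" "N \<subset> VU l S U f"
    "\<And>N'. submodule ffun_scale (ffun_gr \<mu>) (ffun_vop l) N' \<Longrightarrow> fock_rel S U \<subseteq> N' \<Longrightarrow> N' \<subset> VU l S U f \<Longrightarrow> N \<subseteq> N' \<Longrightarrow> N' = N"
    "\<And>x. x \<in> A \<Longrightarrow> \<phi> x \<in> VU l S U f"
    "\<And>x y. x \<in> A \<Longrightarrow> y \<in> A \<Longrightarrow> \<phi> (x + y) - (\<phi> x + \<phi> y) \<in> N"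
    "\<And>x c. x \<in> A \<Longrightarrow> \<phi> (scl c x) - ffun_scale c (\<phi> x) \<in> N"
    "\<And>x. x \<in> A \<Longrightarrow> \<phi> x \<in> N \<longleftrightarrow> x \<in> B"
    "\<And>y. y \<in> VU l S U f \<Longrightarrow> \<exists>x\<in>A. y - \<phi> x \<in> N"
    "\<And>m x. x \<in> A \<Longrightarrow> x \<in> gr m \<Longrightarrow> \<exists>y\<in>VU l S U f \<inter> ffun_gr \<mu> m. \<phi> x - y \<in> N"
    "\<And>v n x. v \<in> Vsp \<Longrightarrow> x \<in> A \<Longrightarrow> \<phi> (Y v n x) - ffun_vop l v n (\<phi> x) \<in> N"
proof -
  from assms obtain U f N where N: "eigenfunction S U lam f" "maximal_proper_submodule l S U f \<mu> N"
    "subquotient_iso scl gr Y A B ffun_scale (ffun_gr \<mu>) (ffun_vop l) (VU l S U f) N"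
    unfolding iso_W_def by (elim exE conjE)
  from N(3) obtain \<phi> where \<phi>: "(\<forall>x\<in>A. \<phi> x \<in> VU l S U f)"
     "(\<forall>x\<in>A. \<forall>y\<in>A. \<phi> (x + y) - (\<phi> x + \<phi> y) \<in> N)"
     "(\<forall>x\<in>A. \<forall>c. \<phi> (scl c x) - ffun_scale c (\<phi> x) \<in> N)"
     "(\<forall>x\<in>A. \<phi> x \<in> N \<longleftrightarrow> x \<in> B)"
     "(\<forall>y\<in>VU l S U f. \<exists>x\<in>A. y - \<phi> x \<in> N)"
     "(\<forall>m. \<forall>x\<in>A \<inter> gr m. \<exists>y\<in>VU l S U f \<inter> ffun_gr \<mu> m. \<phi> x - y \<in> N)"
     "(\<forall>v\<in>Vsp. \<forall>n. \<forall>x\<in>A. \<phi> (Y v n x) - ffun_vop l v n (\<phi> x) \<in> N)"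
    unfolding subquotient_iso_def by (elim exE conjE)
  from N(2) have max: "submodule ffun_scale (ffun_gr \<mu>) (ffun_vop l) N" "fock_rel S U \<subseteq> N" "N \<subset> VU l S U f"
    "\<forall>N'. (submodule ffun_scale (ffun_gr \<mu>) (ffun_vop l) N' \<and> fock_rel S U \<subseteq> N' \<and> N' \<subset> VU l S U f) \<and> N \<subseteq> N' \<longrightarrow> N' = N"
    unfolding maximal_proper_submodule_def Let_def by - (elim conjE; assumption)+
  show thesis
  proof (rule that[OF N(1) max(1-3), where \<phi> = \<phi>])
    show "N' = N" if "submodule ffun_scale (ffun_gr \<mu>) (ffun_vop l) N'" "fock_rel S U \<subseteq> N'" "N' \<subset> VU l S U f" "N \<subseteq> N'" for N'
      by (rule mp[OF spec[OF max(4)]]) (intro conjI that)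
    show "\<exists>y\<in>VU l S U f \<inter> ffun_gr \<mu> m. \<phi> x - y \<in> N" if "x \<in> A" "x \<in> gr m" for m x
      using that by (intro bspec[OF spec[OF \<phi>(6)]] IntI)
  qed (rule \<phi>[rule_format], assumption+)+
qed

context v_module
begin

text \<open>The map \<open>\<phi>\<close> is linear and compatible with the vertex operators only
  modulo \<open>N\<close>, so everything is a congruence modulo \<open>N\<close>. Simplicity is the
  maximality of \<open>N\<close> transported along \<open>\<phi>\<close>, and the eigenvalue comes
  from \<open>laplacian_tensor_rel\<close>.\<close>

lemma iso_W_facts:
  fixes S :: "'m::topological_space framed_surface"
  assumes S: "riemannian_surface S" and fr: "orthonormal_frame S"
    and A: "submodule scl gr Y A" and B: "submodule scl gr Y B" and BA: "B \<subseteq> A"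
    and iso: "iso_W l S scl gr Y A B lam \<mu>"
  shows iso_W_simple: "\<And>M. submodule scl gr Y M \<Longrightarrow> B \<subseteq> M \<Longrightarrow> M \<subseteq> A \<Longrightarrow> M = B \<or> M = A"
    and iso_W_generator: "\<exists>f. f \<in> A \<and> f \<in> gr \<mu> \<and> f \<notin> B \<and>
      scl (1/2) (Yw [(True, 1), (False, 1)] 1 f + Yw [(False, 1), (True, 1)] 1 f) + scl lam f \<in> B"
    and iso_W_weights: "\<And>m x. x \<in> A \<Longrightarrow> x \<in> gr m \<Longrightarrow> x \<notin> B \<Longrightarrow> \<exists>n::nat. m = \<mu> + of_nat n"
proof -
  obtain U f N \<phi> where f: "eigenfunction S U lam f"
    and N: "submodule ffun_scale (ffun_gr \<mu>) (ffun_vop l) N" "fock_rel S U \<subseteq> N" "N \<subset> VU l S U f"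
    and max: "\<And>N'. submodule ffun_scale (ffun_gr \<mu>) (ffun_vop l) N' \<Longrightarrow> fock_rel S U \<subseteq> N' \<Longrightarrow> N' \<subset> VU l S U f \<Longrightarrow> N \<subseteq> N' \<Longrightarrow> N' = N"
    and \<phi>_VU: "\<And>x. x \<in> A \<Longrightarrow> \<phi> x \<in> VU l S U f"
    and \<phi>_add: "\<And>x y. x \<in> A \<Longrightarrow> y \<in> A \<Longrightarrow> \<phi> (x + y) - (\<phi> x + \<phi> y) \<in> N"
    and \<phi>_scale: "\<And>x c. x \<in> A \<Longrightarrow> \<phi> (scl c x) - ffun_scale c (\<phi> x) \<in> N"
    and \<phi>_N: "\<And>x. x \<in> A \<Longrightarrow> \<phi> x \<in> N \<longleftrightarrow> x \<in> B"
    and \<phi>_surj: "\<And>y. y \<in> VU l S U f \<Longrightarrow> \<exists>x\<in>A. y - \<phi> x \<in> N"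
    and \<phi>_gr: "\<And>m x. x \<in> A \<Longrightarrow> x \<in> gr m \<Longrightarrow> \<exists>y\<in>VU l S U f \<inter> ffun_gr \<mu> m. \<phi> x - y \<in> N"
    and \<phi>_vop: "\<And>v n x. v \<in> Vsp \<Longrightarrow> x \<in> A \<Longrightarrow> \<phi> (Y v n x) - ffun_vop l v n (\<phi> x) \<in> N"
    by (fact iso_W_obtain[OF iso])
  have sN: "T.F.subspace N" and N_span: "N \<subseteq> T.F.span (\<Union>m. N \<inter> ffun_gr \<mu> m)"
    and N_vop: "\<And>v n x. v \<in> Vsp \<Longrightarrow> x \<in> N \<Longrightarrow> ffun_vop l v n x \<in> N"
    using N(1) unfolding submodule_def by blast+
  note sA = submodule_subspace[OF A] and sB = submodule_subspace[OF B] and sVU = subspace_VU[of l S U f]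
  note N_add = T.F.subspace_add[OF sN] and N_diff = T.F.subspace_diff[OF sN] and N_scale = T.F.subspace_scale[OF sN]
    and N_0 = T.F.subspace_0[OF sN] and N_sum = T.F.subspace_sum[OF sN]
  have \<phi>_0: "\<phi> 0 \<in> N" using \<phi>_N[of 0] subspace_0[OF sA] subspace_0[OF sB] by simp
  have \<phi>_sum: "\<phi> (\<Sum>m\<in>I. u m) - (\<Sum>m\<in>I. \<phi> (u m)) \<in> N" if "\<And>m. m \<in> I \<Longrightarrow> u m \<in> A" for u :: "complex \<Rightarrow> 'w" and I
    using that
  proof (induction I rule: infinite_finite_induct)
    case (insert k I)
    have "(\<phi> (u k + (\<Sum>m\<in>I. u m)) - (\<phi> (u k) + \<phi> (\<Sum>m\<in>I. u m))) + (\<phi> (\<Sum>m\<in>I. u m) - (\<Sum>m\<in>I. \<phi> (u m))) \<in> N"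
      using insert by (intro N_add \<phi>_add subspace_sum[OF sA]) auto
    then show ?case using insert by (simp add: algebra_simps)
  qed (simp_all add: \<phi>_0)
  have trans: "a - c \<in> N" if "a - b \<in> N" "b - c \<in> N" for a b c
    using N_add[OF that] by simp

  show "\<exists>n::nat. m = \<mu> + of_nat n" if x: "x \<in> A" "x \<in> gr m" "x \<notin> B" for m x
  proof (rule ccontr)
    assume none: "\<not> (\<exists>n::nat. m = \<mu> + of_nat n)"
    obtain y where y: "y \<in> ffun_gr \<mu> m" "\<phi> x - y \<in> N" using \<phi>_gr[OF x(1,2)] by blast
    then have "Poly_Mapping.keys y = {}" using none unfolding ffun_gr_def by blast
    then have "y = 0" by simp
    then show False using y(2) \<phi>_N[OF x(1)] x(3) by simp
  qed

  let ?f = "vacuum_tensor f"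
  have f_VU: "?f \<in> VU l S U f"
  proof -
    have "vac \<in> Vsp" unfolding vac_def by (rule single_in_Vsp) simp
    then have "ffun_vop l vac (-1) ?f \<in> T.F.span {ffun_vop l v n ?f | v n. v \<in> Vsp}" by (intro T.F.span_base) blast
    then have "?f \<in> T.F.span {ffun_vop l v n ?f | v n. v \<in> Vsp}" by (simp only: ffun_vop_vac)
    moreover have "?f = ?f + 0" by simp
    ultimately show ?thesis unfolding VU_def vacuum_tensor_def[symmetric] using T.F.subspace_0[OF subspace_fock_rel] by blast
  qed
  have f_N: "?f \<notin> N"
  proof
    assume "?f \<in> N"
    then have "T.F.span {ffun_vop l v n ?f | v n. v \<in> Vsp} \<subseteq> N" using N_vop by (intro T.F.span_minimal sN) blast
    then have "VU l S U f \<subseteq> N" unfolding VU_def vacuum_tensor_def[symmetric] using N(2) N_add by blast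
    then show False using N(3) by blast
  qed
  have f_low: "lowest_part ?f = ?f" by (simp add: lowest_part_def vacuum_tensor_def)
  have N_low: "lowest_part x \<in> N" if "x \<in> N" for x
  proof -
    have "x \<in> T.F.span (\<Union>m. N \<inter> ffun_gr \<mu> m)" using that N_span by blast
    then show ?thesis
    proof (induction rule: T.F.span_induct_alt)
      case base
      show ?case using N_0 by (simp add: lowest_part_def)
    next
      case (step c y x)
      then obtain m where "y \<in> N" "y \<in> ffun_gr \<mu> m" by blast
      then have "lowest_part y \<in> N" using lowest_part_gr[of y \<mu> m] N_0 by simp
      then show ?case unfolding lowest_part_add lowest_part_scale using step by (intro N_add N_scale)
    qed
  qed
  \<comment> \<open>A preimage of \<open>f\<close> need not be homogeneous, so its component of
    degree \<open>\<mu>\<close> is taken: \<open>lowest_part\<close> removes the representatives of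
    the other degrees and preserves \<open>N\<close>, which is graded.\<close>
  obtain g where g: "g \<in> A" "g \<in> gr \<mu>" "\<phi> g - ?f \<in> N"
  proof -
    obtain x where x: "x \<in> A" "?f - \<phi> x \<in> N" using \<phi>_surj[OF f_VU] by blast
    obtain M u where M: "finite M" "\<forall>m\<in>M. u m \<in> gr m \<and> u m \<in> A" "x = (\<Sum>m\<in>M. u m)" using submodule_decomposition[OF A x(1)] by blast
    have "\<forall>m\<in>M. \<exists>y. y \<in> ffun_gr \<mu> m \<and> \<phi> (u m) - y \<in> N" using \<phi>_gr M(2) by blast
    then obtain y where y: "\<And>m. m \<in> M \<Longrightarrow> y m \<in> ffun_gr \<mu> m" "\<And>m. m \<in> M \<Longrightarrow> \<phi> (u m) - y m \<in> N" by metis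
    have "\<phi> x - (\<Sum>m\<in>M. \<phi> (u m)) \<in> N" unfolding M(3) by (rule \<phi>_sum) (use M(2) in blast)
    moreover have "(\<Sum>m\<in>M. \<phi> (u m)) - (\<Sum>m\<in>M. y m) \<in> N" unfolding sum_subtractf[symmetric] by (rule N_sum) (rule y(2))
    ultimately have "?f - (\<Sum>m\<in>M. y m) \<in> N" using trans x(2) by blast
    then have "lowest_part (?f - (\<Sum>m\<in>M. y m)) \<in> N" by (rule N_low)
    then have "?f - (\<Sum>m\<in>M. if m = \<mu> then y m else 0) \<in> N"
      unfolding lowest_part_diff lowest_part_sum f_low using lowest_part_gr[OF y(1)] by simp
    then have low: "?f - (if \<mu> \<in> M then y \<mu> else 0) \<in> N" using M(1) by (simp add: sum.delta)
    show ?thesis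
    proof (cases "\<mu> \<in> M")
      case True
      have "\<phi> (u \<mu>) - ?f = (\<phi> (u \<mu>) - y \<mu>) - (?f - y \<mu>)" by simp
      also have "\<dots> \<in> N" using y(2)[OF True] low True by (intro N_diff[OF y(2)[OF True]]) simp
      finally show ?thesis using that[of "u \<mu>"] M(2) True by blast
    next
      case False
      then show ?thesis using low f_N by simp
    qed
  qed
  have g_B: "g \<notin> B"
  proof
    assume "g \<in> B"
    then have "\<phi> g \<in> N" using \<phi>_N g(1) by blast
    then have "\<phi> g - (\<phi> g - ?f) \<in> N" using g(3) by (rule N_diff)
    then show False using f_N by simp
  qed
  have "scl (1/2) (Yw [(True, 1), (False, 1)] 1 g + Yw [(False, 1), (True, 1)] 1 g) + scl lam g \<in> B"
  proof -
    let ?u = "Poly_Mapping.single [(True, 1), (False, 1)] 1 :: fword \<Rightarrow>\<^sub>0 complex"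
    let ?v = "Poly_Mapping.single [(False, 1), (True, 1)] 1 :: fword \<Rightarrow>\<^sub>0 complex"
    have uv: "?u \<in> Vsp" "?v \<in> Vsp"
      by (rule single_in_Vsp, simp add: good_def proper_word_def balanced_def)+
    have YA: "Y ?u 1 g \<in> A" "Y ?v 1 g \<in> A" using uv g(1) submodule_Y[OF A] by blast+
    define s where "s = Y ?u 1 g + Y ?v 1 g"
    have sA': "s \<in> A" unfolding s_def by (rule subspace_add[OF sA YA])
    have vop: "\<phi> (Y w 1 g) - ffun_vop l w 1 ?f \<in> N" if "w \<in> Vsp" for w
    proof -
      have "ffun_vop l w 1 (\<phi> g - ?f) \<in> N" by (rule N_vop[OF that g(3)])
      from trans[OF \<phi>_vop[OF that g(1)] this[unfolded ffun_vop_diff]] show ?thesis .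
    qed
    have "\<phi> s - (\<phi> (Y ?u 1 g) + \<phi> (Y ?v 1 g)) \<in> N" unfolding s_def by (rule \<phi>_add[OF YA])
    moreover have "(\<phi> (Y ?u 1 g) + \<phi> (Y ?v 1 g)) - (ffun_vop l ?u 1 ?f + ffun_vop l ?v 1 ?f) \<in> N"
      using N_add[OF vop[OF uv(1)] vop[OF uv(2)]] by (simp add: algebra_simps)
    ultimately have s: "\<phi> s - (ffun_vop l ?u 1 ?f + ffun_vop l ?v 1 ?f) \<in> N" by (rule trans)
    define r where "r = ffun_scale (1/2) (ffun_vop l ?u 1 ?f + ffun_vop l ?v 1 ?f) + ffun_scale lam ?f"
    have "\<phi> (scl (1/2) s) - ffun_scale (1/2) (ffun_vop l ?u 1 ?f + ffun_vop l ?v 1 ?f) \<in> N"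
      using trans[OF \<phi>_scale[OF sA', of "1/2"]] N_scale[OF s, of "1/2"] by (simp only: T.F.scale_right_diff_distrib)
    moreover have "\<phi> (scl lam g) - ffun_scale lam ?f \<in> N"
      using trans[OF \<phi>_scale[OF g(1), of lam]] N_scale[OF g(3), of lam] by (simp only: T.F.scale_right_diff_distrib)
    ultimately have "(\<phi> (scl (1/2) s) - ffun_scale (1/2) (ffun_vop l ?u 1 ?f + ffun_vop l ?v 1 ?f)) + (\<phi> (scl lam g) - ffun_scale lam ?f) \<in> N"
      by (rule N_add)
    then have "(\<phi> (scl (1/2) s) + \<phi> (scl lam g)) - r \<in> N" unfolding r_def by (simp only: add_diff_add)
    moreover have "\<phi> (scl (1/2) s + scl lam g) - (\<phi> (scl (1/2) s) + \<phi> (scl lam g)) \<in> N"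
      by (rule \<phi>_add[OF subspace_scale[OF sA sA'] subspace_scale[OF sA g(1)]])
    ultimately have "\<phi> (scl (1/2) s + scl lam g) - r \<in> N" by (rule trans[rotated])
    \<comment> \<open>Both words act on \<open>f\<close> by prepending letters, so \<open>r\<close>
      is the relation of \<open>laplacian_tensor_rel\<close> placed on the empty word.\<close>
    moreover have "r \<in> N"
    proof -
      let ?t = "Poly_Mapping.single [True, False] (\<lambda>q. 1/2 * f q) + Poly_Mapping.single [False, True] (\<lambda>q. 1/2 * f q)
        - Poly_Mapping.single [] (\<lambda>q. - lam * f q)"
      have "?t \<in> tensor_rel S U" by (rule laplacian_tensor_rel[OF S fr f])
      then have "Poly_Mapping.single [] ?t \<in> fock_rel S U" by (auto simp: fock_rel_def proper_word_def)
      moreover have "r = Poly_Mapping.single [] ?t"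
      proof -
        have sc: "ffun_scale c (Poly_Mapping.single [] (Poly_Mapping.single w f)) = Poly_Mapping.single [] (Poly_Mapping.single w (\<lambda>q. c * f q))" for c w
          by (simp add: pm_scale_single zero_fun_def)
        have neg: "- Poly_Mapping.single [] (\<lambda>q. - lam * f q) = Poly_Mapping.single [] (\<lambda>q. lam * f q)"
          by (simp add: single_uminus[symmetric] fun_Compl_def)
        show ?thesis
          unfolding r_def ffun_vop_two_letters
          unfolding T.F.scale_right_distrib sc vacuum_tensor_def
          unfolding single_add[symmetric] diff_conv_add_uminus neg ..
      qed
      ultimately show ?thesis using N(2) by blast
    qed
    ultimately have "(\<phi> (scl (1/2) s + scl lam g) - r) + r \<in> N" by (rule N_add)
    then have "\<phi> (scl (1/2) s + scl lam g) \<in> N" by simp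
    moreover have "scl (1/2) s + scl lam g \<in> A" by (intro subspace_add[OF sA] subspace_scale[OF sA] sA' g(1))
    ultimately show ?thesis using \<phi>_N unfolding s_def by blast
  qed
  then show "\<exists>f. f \<in> A \<and> f \<in> gr \<mu> \<and> f \<notin> B \<and>
      scl (1/2) (Yw [(True, 1), (False, 1)] 1 f + Yw [(False, 1), (True, 1)] 1 f) + scl lam f \<in> B"
    using g g_B by blast

  show "M = B \<or> M = A" if M: "submodule scl gr Y M" "B \<subseteq> M" "M \<subseteq> A" for M
  proof -
    note sM = submodule_subspace[OF M(1)]
    \<comment> \<open>The image of \<open>M\<close>, completed by \<open>N\<close>. By maximality it
      is either \<open>N\<close>, which gives \<open>M = B\<close>, or all of
      \<open>VU l S U f\<close>, which gives \<open>M = A\<close>.\<close>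
    define N' where "N' = {y. \<exists>x\<in>M. y - \<phi> x \<in> N}"
    have NN': "N \<subseteq> N'" using subspace_0[OF sM] N_diff[OF _ \<phi>_0] unfolding N'_def by blast
    have sN': "T.F.subspace N'"
      unfolding T.F.subspace_def
    proof (intro conjI ballI allI)
      show "0 \<in> N'" using NN' N_0 by blast
      fix y y' assume "y \<in> N'" "y' \<in> N'"
      then obtain x x' where x: "x \<in> M" "x' \<in> M" "y - \<phi> x \<in> N" "y' - \<phi> x' \<in> N" unfolding N'_def by blast
      have "(y - \<phi> x) + (y' - \<phi> x') - (\<phi> (x + x') - (\<phi> x + \<phi> x')) \<in> N"
        by (rule N_diff[OF N_add[OF x(3,4)] \<phi>_add[OF subsetD[OF M(3) x(1)] subsetD[OF M(3) x(2)]]])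
      then have "(y + y') - \<phi> (x + x') \<in> N" by (simp add: algebra_simps)
      then show "y + y' \<in> N'" unfolding N'_def using subspace_add[OF sM x(1,2)] by blast
    next
      fix c y assume "y \<in> N'"
      then obtain x where x: "x \<in> M" "y - \<phi> x \<in> N" unfolding N'_def by blast
      have "ffun_scale c (y - \<phi> x) - (\<phi> (scl c x) - ffun_scale c (\<phi> x)) \<in> N"
        by (rule N_diff[OF N_scale[OF x(2)] \<phi>_scale[OF subsetD[OF M(3) x(1)]]])
      then have "ffun_scale c y - \<phi> (scl c x) \<in> N" by (simp add: T.F.scale_right_diff_distrib)
      then show "ffun_scale c y \<in> N'" unfolding N'_def using subspace_scale[OF sM x(1)] by blast
    qed
    have N': "submodule ffun_scale (ffun_gr \<mu>) (ffun_vop l) N'"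
      unfolding submodule_def
    proof (intro conjI ballI allI subsetI)
      show "T.F.subspace N'" by (rule sN')
      fix y assume "y \<in> N'"
      then obtain x where x: "x \<in> M" "y - \<phi> x \<in> N" unfolding N'_def by blast
      obtain I u where I: "finite I" "\<forall>m\<in>I. u m \<in> gr m \<and> u m \<in> M" "x = (\<Sum>m\<in>I. u m)" using submodule_decomposition[OF M(1) x(1)] by blast
      have "\<forall>m\<in>I. \<exists>y. y \<in> ffun_gr \<mu> m \<and> \<phi> (u m) - y \<in> N" using \<phi>_gr I(2) M(3) by blast
      then obtain y' where y': "\<And>m. m \<in> I \<Longrightarrow> y' m \<in> ffun_gr \<mu> m" "\<And>m. m \<in> I \<Longrightarrow> \<phi> (u m) - y' m \<in> N" by metis
      have y'_N': "y' m \<in> N'" if "m \<in> I" for m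
      proof -
        have "y' m - \<phi> (u m) = 0 - (\<phi> (u m) - y' m)" by simp
        also have "\<dots> \<in> N" by (rule N_diff[OF N_0 y'(2)[OF that]])
        finally show ?thesis unfolding N'_def using I(2) that by blast
      qed
      have "\<phi> x - (\<Sum>m\<in>I. \<phi> (u m)) \<in> N" unfolding I(3) by (rule \<phi>_sum) (use I(2) M(3) in blast)
      moreover have "(\<Sum>m\<in>I. \<phi> (u m)) - (\<Sum>m\<in>I. y' m) \<in> N" unfolding sum_subtractf[symmetric] by (rule N_sum) (rule y'(2))
      ultimately have "\<phi> x - (\<Sum>m\<in>I. y' m) \<in> N" by (rule trans)
      from trans[OF x(2) this] have rest: "y - (\<Sum>m\<in>I. y' m) \<in> N" .
      have sub: "(\<Union>m. N \<inter> ffun_gr \<mu> m) \<subseteq> (\<Union>m. N' \<inter> ffun_gr \<mu> m)" using NN' by auto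
      have 1: "y - (\<Sum>m\<in>I. y' m) \<in> T.F.span (\<Union>m. N' \<inter> ffun_gr \<mu> m)"
        by (rule subsetD[OF T.F.span_mono[OF sub] subsetD[OF N_span rest]])
      have 2: "(\<Sum>m\<in>I. y' m) \<in> T.F.span (\<Union>m. N' \<inter> ffun_gr \<mu> m)"
        by (rule T.F.span_sum, rule T.F.span_base) (use y'(1) y'_N' in blast)
      from T.F.span_add[OF 1 2] show "y \<in> T.F.span (\<Union>m. N' \<inter> ffun_gr \<mu> m)" by simp
    next
      fix v n y assume v: "v \<in> Vsp" and "y \<in> N'"
      then obtain x where x: "x \<in> M" "y - \<phi> x \<in> N" unfolding N'_def by blast
      have xA: "x \<in> A" using x(1) M(3) by blast
      have "ffun_vop l v n (y - \<phi> x) - (\<phi> (Y v n x) - ffun_vop l v n (\<phi> x)) \<in> N"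
        by (rule N_diff[OF N_vop[OF v x(2)] \<phi>_vop[OF v xA]])
      then have "ffun_vop l v n y - \<phi> (Y v n x) \<in> N" by (simp add: ffun_vop_diff)
      then show "ffun_vop l v n y \<in> N'" unfolding N'_def using submodule_Y[OF M(1) v x(1)] by blast
    qed
    have N'_VU: "N' \<subseteq> VU l S U f"
    proof
      fix y assume "y \<in> N'"
      then obtain x where x: "x \<in> M" "y - \<phi> x \<in> N" unfolding N'_def by blast
      have "(y - \<phi> x) + \<phi> x \<in> VU l S U f"
        by (rule T.F.subspace_add[OF sVU subsetD[OF psubset_imp_subset[OF N(3)] x(2)] \<phi>_VU[OF subsetD[OF M(3) x(1)]]])
      then show "y \<in> VU l S U f" by simp
    qed
    have in_N': "\<phi> x \<in> N'" if "x \<in> M" for x unfolding N'_def using that N_0 by force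
    show ?thesis
    proof (cases "N' = VU l S U f")
      case True
      have "A \<subseteq> M"
      proof
        fix x assume x: "x \<in> A"
        then have "\<phi> x \<in> N'" using True \<phi>_VU by simp
        then obtain x' where x': "x' \<in> M" "\<phi> x - \<phi> x' \<in> N" unfolding N'_def by blast
        have x'A: "x' \<in> A" "scl (-1) x' \<in> A"
          by (rule subsetD[OF M(3) x'(1)], rule subspace_scale[OF sA subsetD[OF M(3) x'(1)]])
        have "(\<phi> (x + scl (-1) x') - (\<phi> x + \<phi> (scl (-1) x'))) + ((\<phi> (scl (-1) x') - ffun_scale (-1) (\<phi> x')) + (\<phi> x - \<phi> x')) \<in> N"
          by (rule N_add[OF \<phi>_add[OF x x'A(2)] N_add[OF \<phi>_scale[OF x'A(1)] x'(2)]])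
        moreover have "ffun_scale (-1) (\<phi> x') = - \<phi> x'" using T.F.scale_minus_left[of 1 "\<phi> x'"] T.F.scale_one by metis
        ultimately have "\<phi> (x + scl (-1) x') \<in> N" by (simp add: algebra_simps)
        then have "x - x' \<in> B" using \<phi>_N[of "x + scl (-1) x'"] subspace_add[OF sA x x'A(2)] by simp
        then have "(x - x') + x' \<in> M" using M(2) x'(1) by (intro subspace_add[OF sM]) auto
        then show "x \<in> M" by simp
      qed
      then show ?thesis using M(3) by blast
    next
      case False
      then have "N' = N" using max[OF N' _ _ NN'] N'_VU N(2) NN' by blast
      then have "M \<subseteq> B" using in_N' \<phi>_N M(3) by blast
      then show ?thesis using M(2) by blast
    qed
  qed
qed

end

theorem proposition6p19:
  fixes S :: "'m::{t2_space,second_countable_topology} framed_surface"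
    and K :: real and l \<mu> :: complex and P :: nat
  assumes "space_form S K" and "K \<noteq> 0" and "orthonormal_frame S"
    and "l \<noteq> 0" and "P \<ge> 1"
  shows "\<not> (\<exists>(scl :: complex \<Rightarrow> 'w::ab_group_add \<Rightarrow> 'w) gr Y d D.
            V_module l scl gr Y d D \<and> indecomposable scl gr Y \<and> class_C l K S scl gr Y \<and>
            (\<exists>n\<ge>2. \<exists>Ws. W_series l S scl gr Y n Ws
                (\<lambda>i. complex_of_real (real P * (real P - 1) * K)) \<mu>))"
proof (rule notI, elim exE conjE)
  fix scl :: "complex \<Rightarrow> 'w \<Rightarrow> 'w" and gr Y d D n Ws
  assume V: "V_module l scl gr Y d D" and ind: "indecomposable scl gr Y" and C: "class_C l K S scl gr Y"
    and n: "2 \<le> n" and series: "W_series l S scl gr Y n Ws (\<lambda>i. complex_of_real (real P * (real P - 1) * K)) \<mu>"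
  interpret v_module l scl gr Y d D by (rule v_module.intro[OF V])
  obtain \<mu>' \<rho> where low: "lowest_weight_module scl gr Y \<mu>'" and zm: "zero_mode_module scl gr Y \<mu>' \<rho>"
    and cdc: "covariant_derivative_condition K (gr \<mu>') \<rho>"
    using C unfolding class_C_def by blast
  have S: "riemannian_surface S" using assms(1) unfolding space_form_def by blast
  define lam where "lam = complex_of_real (real P * (real P - 1) * K)"
  have Ws: "Ws 1 = UNIV" "Ws (n + 1) = {0}" "\<And>i. i \<in> {1..n+1} \<Longrightarrow> submodule scl gr Y (Ws i)"
    "\<And>i. i \<in> {1..n} \<Longrightarrow> Ws (i + 1) \<subseteq> Ws i"
    and iso: "\<And>i. i \<in> {1..n} \<Longrightarrow> iso_W l S scl gr Y (Ws i) (Ws (i + 1)) lam \<mu>"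
  proof -
    have w: "Ws 1 = UNIV \<and> Ws (n + 1) = {0} \<and> (\<forall>i\<in>{1..n+1}. submodule scl gr Y (Ws i)) \<and>
      (\<forall>i\<in>{1..n}. Ws (i + 1) \<subseteq> Ws i \<and> iso_W l S scl gr Y (Ws i) (Ws (i + 1)) lam \<mu>)"
      using series unfolding W_series_def lam_def .
    show "Ws 1 = UNIV" "Ws (n + 1) = {0}" using w by simp_all
    show "submodule scl gr Y (Ws i)" if "i \<in> {1..n+1}" for i using bspec[OF w[THEN conjunct2, THEN conjunct2, THEN conjunct1] that] .
    fix i assume "i \<in> {1..n}"
    from bspec[OF w[THEN conjunct2, THEN conjunct2, THEN conjunct2] this]
    show "Ws (i + 1) \<subseteq> Ws i" "iso_W l S scl gr Y (Ws i) (Ws (i + 1)) lam \<mu>" by (rule conjunct1, rule conjunct2)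
  qed
  have sub: "submodule scl gr Y (Ws i)" "submodule scl gr Y (Ws (i + 1))" if "i \<in> {1..n}" for i
    using that by (simp_all add: Ws(3))
  note simpleW = iso_W_simple[OF S assms(3) sub Ws(4) iso]
    and generatorW = iso_W_generator[OF S assms(3) sub Ws(4) iso]
    and weightsW = iso_W_weights[OF S assms(3) sub Ws(4) iso]
  \<comment> \<open>A nonzero vector leaves the series at some step, and there it is nonzero in a
    factor whose degrees are known.\<close>
  have weights: "\<exists>k::nat. m = \<mu> + of_nat k" if x: "x \<in> gr m" "x \<noteq> 0" for m x
  proof (rule ccontr)
    assume none: "\<not> (\<exists>k::nat. m = \<mu> + of_nat k)"
    have "x \<in> Ws (i + 1)" if "i \<le> n" for i
      using that
    proof (induction i)
      case (Suc i)
      then have i: "Suc i \<in> {1..n}" "x \<in> Ws (Suc i)" by auto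
      show ?case using weightsW[OF i(1) i(1) i(1) i(1) i(2) x(1)] none by auto
    qed (use Ws(1) in simp)
    from this[of n] show False using Ws(2) x(2) by simp
  qed
  obtain f where f: "f \<in> gr \<mu>" "f \<noteq> 0"
    using generatorW[of n] n unfolding Ws(2) by auto
  \<comment> \<open>The lowest weight of the class and the weight of the series are quantified
    separately. Each exceeds the other by a natural number, so they agree.\<close>
  have "\<mu>' = \<mu>"
  proof -
    have low': "\<And>m. (\<forall>k::nat. m \<noteq> \<mu>' + of_nat k) \<Longrightarrow> gr m = {0}" and "\<And>B. submodule scl gr Y B \<Longrightarrow> gr \<mu>' \<subseteq> B \<Longrightarrow> B = UNIV"
      using low unfolding lowest_weight_module_def by auto
    then obtain k1 :: nat where k1: "\<mu> = \<mu>' + of_nat k1" using f by blast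
    have "submodule scl gr Y {0}" using Ws(2) Ws(3)[of "n + 1"] by simp
    then have "\<not> gr \<mu>' \<subseteq> {0}" using \<open>\<And>B. submodule scl gr Y B \<Longrightarrow> gr \<mu>' \<subseteq> B \<Longrightarrow> B = UNIV\<close> f(2) by blast
    then obtain x where "x \<in> gr \<mu>'" "x \<noteq> 0" by blast
    then obtain k2 :: nat where k2: "\<mu>' = \<mu> + of_nat k2" using weights by blast
    from k1 k2 have "of_nat (k1 + k2) = (0 :: complex)" by (simp add: add.commute)
    then have "k1 = 0" by (simp only: of_nat_eq_0_iff)
    then show ?thesis using k1 by simp
  qed
  then interpret lw_module l scl gr Y d D K \<mu> \<rho>
    using low zm cdc by unfold_locales auto
  have generator: "\<exists>f. f \<in> Ws i \<and> f \<in> gr \<mu> \<and> f \<notin> Ws (i + 1) \<and> shifted_Lap P f \<in> Ws (i + 1)" if i: "i \<in> {1..n}" for i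
  proof -
    obtain f where f: "f \<in> Ws i" "f \<in> gr \<mu>" "f \<notin> Ws (i + 1)"
      "scl (1/2) (Yw [(True, 1), (False, 1)] 1 f + Yw [(False, 1), (True, 1)] 1 f) + scl lam f \<in> Ws (i + 1)"
      using generatorW[OF i i i i] by (elim exE conjE)
    have good: "good [(True, 1), (False, 1)]" "good [(False, 1), (True, 1)]" by (simp_all add: good_def proper_word_def balanced_def)
    have "Yw [(True, 1), (False, 1)] 1 f = Lap f"
      using zero_mode_word[OF good(1) f(2)] by (simp add: eval_word_def Lap_def balanced_def)
    \<comment> \<open>The last two letters of a word may be exchanged, so the symmetrised word of
      the geometric relation acts as \<open>Lap\<close>.\<close>
    moreover have "Yw [(False, 1), (True, 1)] 1 f = Lap f"
      using zero_mode_word[OF good(2) f(2)] act_swap[of True False "[]" "[]" f] f(2) by (simp add: eval_word_def Lap_def balanced_def)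
    moreover have "scl (1/2) (Lap f + Lap f) = Lap f" by (simp add: scale_right_distrib flip: scale_left_distrib)
    ultimately have "shifted_Lap P f \<in> Ws (i + 1)" using f(4) by (simp add: shifted_Lap_def lam_def)
    then show ?thesis using f by blast
  qed
  have simple: "B = Ws (i + 1) \<or> B = Ws i"
    if i: "i \<in> {1..n}" and "submodule scl gr Y B" "Ws (i + 1) \<subseteq> B" "B \<subseteq> Ws i" for i B
    by (rule simpleW[OF i i i i that(2-4)])
  interpret eigen_series l scl gr Y d D K \<mu> \<rho> P n Ws
    by (rule eigen_series.intro, rule lw_module_axioms, rule eigen_series_axioms.intro)
      (fact assms n Ws simple generator)+
  show False using decomposable ind by contradiction
qed

end
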